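(* Let $d\ge 1$, $k\ge 2$, $h\ge 2$ and $r\ge kh$ be fixed integers. Then: (1) For every $\varepsilon>0$ there is $n_0$ such that for all $n\ge n_0$ and every subset $A\subseteq [n]^d$ with $|A|\ge n^d-\frac{n^d}{\log n}$, $$(1-\varepsilon)\binom{r}{kh-1}(kh-1)^{|A|}\le g_r(A)\le (1+\varepsilon)\binom{r}{kh-1}(kh-1)^{|A|},$$ i.e. $g_r(A)=(1+o(1))\binom{r}{kh-1}(kh-1)^{|A|}$. (2) Moreover, for such $A$, all but an $o(1)$ proportion (as $n\to\infty$) of the $r$-colorings of $A$ without rainbow solutions to the $B_{k,h}$-equation use at most $kh-1$ distinct colors. (3) Furthermore, for all sufficiently large $n$, among all subsets $A\subseteq[n]^d$, the set $[n]^d$ is the unique subset maximizing $g_r(A)$; that is, $g_r(A)<g_r([n]^d)$ for every $A\subsetneq [n]^d$.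
   Context: For positive integers $n,d$, $[n]=\{1,\dots,n\}$ and $[n]^d$ is the $d$-dimensional grid, whose points are vectors in $\mathbb{Z}^d$ with all coordinates in $[n]$; addition is coordinatewise. For integers $k,h\ge2$, the $B_{k,h}$-equation is $\sum_{i=1}^h x_{1,i}=\sum_{i=1}^h x_{2,i}=\cdots=\sum_{i=1}^h x_{k,i}$ in $kh$ points $x_{\ell,i}$ ($\ell\in[k],i\in[h]$). An $r$-coloring of $A\subseteq[n]^d$ is a map $c:A\to[r]$. A solution (in $A$) is rainbow under $c$ if the colors $c(x_{\ell,i})$, $\ell\in[k],i\in[h]$, are pairwise distinct (so in particular the $kh$ points are pairwise distinct). For $r\ge kh$, $g_r(A)$ denotes the number of $r$-colorings of $A$ with no rainbow solution to the $B_{k,h}$-equation. Logarithms are base 2. *)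

theory Defs
  imports "HOL-Analysis.Finite_Cartesian_Product" "HOL-Library.FuncSet" Complex_Main
begin

text \<open>The dimension d is the cardinality of the index type \<open>'d\<close>.\<close>

definition grid :: "nat \<Rightarrow> (int ^ 'd) set" where
  "grid n = {x. \<forall>j. x $ j \<in> {1..int n}}"

text \<open>The points of a solution need not be distinct here; for rainbow solutions distinctness
  follows from that of the colors.\<close>

definition B_solution :: "nat \<Rightarrow> nat \<Rightarrow> (int ^ 'd) set \<Rightarrow> (nat \<Rightarrow> nat \<Rightarrow> int ^ 'd) \<Rightarrow> bool" where
  "B_solution k h A x \<longleftrightarrow>
     (\<forall>l\<in>{1..k}. \<forall>i\<in>{1..h}. x l i \<in> A) \<and>
     (\<forall>l\<in>{1..k}. \<forall>m\<in>{1..k}. (\<Sum>i=1..h. x l i) = (\<Sum>i=1..h. x m i))"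

definition rainbow ::
  "nat \<Rightarrow> nat \<Rightarrow> (int ^ 'd \<Rightarrow> nat) \<Rightarrow> (nat \<Rightarrow> nat \<Rightarrow> int ^ 'd) \<Rightarrow> bool" where
  "rainbow k h c x \<longleftrightarrow> inj_on (\<lambda>(l, i). c (x l i)) ({1..k} \<times> {1..h})"

text \<open>Colorings are extensional functions, so that each map from A to [r] is counted once.\<close>

definition rainbow_free_colorings ::
  "nat \<Rightarrow> nat \<Rightarrow> nat \<Rightarrow> (int ^ 'd) set \<Rightarrow> (int ^ 'd \<Rightarrow> nat) set" where
  "rainbow_free_colorings k h r A =
     {c \<in> A \<rightarrow>\<^sub>E {1..r}. \<not> (\<exists>x. B_solution k h A x \<and> rainbow k h c x)}"

definition num_rainbow_free :: "nat \<Rightarrow> nat \<Rightarrow> nat \<Rightarrow> (int ^ 'd) set \<Rightarrow> nat" where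
  "num_rainbow_free k h r A = card (rainbow_free_colorings k h r A)"

end

theory Submission
  imports Defs "HOL-Analysis.Convex" "HOL-Library.Disjoint_Sets" "HOL-Library.Indicator_Function"
begin

text \<open>
  Write \<open>s = k h\<close> and \<open>N = n ^ d\<close>. For a fixed set in every other slot, the number of solutions with
  \<open>x\<close> in a given slot is, after normalization, a correlation \<open>u(x) = (1/N) \<Sum>y. f(y) W(x + y)\<close> of functions
  with values in \<open>[0,1]\<close>; here \<open>h \<ge> 2\<close> is used. Rounding \<open>f\<close> and \<open>W\<close> to multiples of indicators of
  sparse sets shows that all such functions lie close in \<open>L\<^sup>1\<close> to a family of only \<open>exp(o(N))\<close> functions.
  If \<open>(D\<^sub>p)\<close> admits no solution, one replaces the sets slot by slot by the places where the approximate
  number of completions is small; the result comes from a family of size \<open>exp(o(N))\<close>, contains almost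
  all of each \<open>D\<^sub>p\<close>, and admits few solutions.

  Applied to the color classes, this places a rainbow-free coloring, up to \<open>o(N)\<close> points, inside one of
  \<open>exp(o(N))\<close> templates, i.e. assignments of lists of colors to points with few rainbow solutions.
  By convexity such a template has few lists of size at least \<open>s\<close>, and at most one list of size \<open>s - 1\<close>
  occurs often. Hence colorings that are not close to using a single palette of \<open>s - 1\<close> colors
  are exponentially rare compared to \<open>(s-1) ^ |A|\<close>. If a coloring is close to a palette but gives some \<open>y\<close> a
  color outside it, then each of linearly many solutions through \<open>y\<close>, disjoint apart from \<open>y\<close>, forbids a
  pattern on its remaining points, so these colorings are exponentially rare as well.
  All this works for \<open>|A| \<ge> (1 - \<delta>) N\<close> with a constant \<open>\<delta>\<close>, and for smaller \<open>A\<close> the template bound alone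
  beats \<open>(s-1) ^ N\<close>.
\<close>

section \<open>Large finite sets\<close>

definition large_sets :: "('a set \<Rightarrow> bool) \<Rightarrow> 'a set filter" where
  "large_sets P = inf (filtercomap card sequentially) (principal (Collect P))"

lemma large_sets_mono: "(\<And>G. P G \<Longrightarrow> Q G) \<Longrightarrow> large_sets P \<le> large_sets Q"
  unfolding large_sets_def by (intro inf_mono) auto

lemma filterlim_card_large_sets: "filterlim card sequentially (large_sets P)"
  unfolding large_sets_def by (rule filterlim_mono[OF filterlim_filtercomap order_refl inf_le1])

lemma eventually_large_sets:
  "\<forall>\<^sub>F G in large_sets P. P G \<and> finite G \<and> c \<le> real (card G)"
proof -
  have "\<forall>\<^sub>F G in large_sets P. P G"
    unfolding large_sets_def eventually_inf_principal by simp
  moreover have "filterlim (\<lambda>G. real (card G)) at_top (large_sets P)"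
    by (rule filterlim_compose[OF filterlim_real_sequentially filterlim_card_large_sets])
  then have "\<forall>\<^sub>F G in large_sets P. max 1 c \<le> real (card G)"
    unfolding filterlim_at_top by blast
  ultimately show ?thesis
    by eventually_elim (auto intro: card_ge_0_finite)
qed

lemma eventually_large_sets_power_le:
  fixes x \<epsilon> :: real
  assumes "0 \<le> x" "x < 1" "0 < \<epsilon>"
  shows "\<forall>\<^sub>F G in large_sets P. x ^ card G \<le> \<epsilon>"
proof -
  have "(\<lambda>m. x ^ m) \<longlonglongrightarrow> 0"
    using assms by (intro LIMSEQ_power_zero) simp
  then have "\<forall>\<^sub>F m in sequentially. x ^ m < \<epsilon>"
    using assms(3) by (rule order_tendstoD(2))
  from eventually_compose_filterlim[OF this filterlim_card_large_sets] show ?thesis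
    by eventually_elim simp
qed

lemma sum_power_card_Pow:
  fixes x :: "'b::comm_semiring_1"
  assumes "finite S"
  shows "(\<Sum>E\<in>Pow S. x ^ card E) = (1 + x) ^ card S"
  using prod_add[OF assms, of "\<lambda>_. x" "\<lambda>_. 1"] by (simp add: add.commute)

lemma sum_power_card_small_subsets_le:
  fixes x \<rho> m :: real
  assumes "finite S" "0 < x" "x \<le> 1" "0 \<le> \<rho>"
  shows "(\<Sum>E | E \<subseteq> S \<and> real (card E) \<le> m. \<rho> ^ card E) \<le> (1 + x * \<rho>) ^ card S / x powr m"
proof -
  have "(\<Sum>E | E \<subseteq> S \<and> real (card E) \<le> m. \<rho> ^ card E)
     \<le> (\<Sum>E | E \<subseteq> S \<and> real (card E) \<le> m. (x * \<rho>) ^ card E / x powr m)"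
  proof (rule sum_mono)
    fix E assume "E \<in> {E. E \<subseteq> S \<and> real (card E) \<le> m}"
    then have "x powr m \<le> x powr real (card E)"
      using assms by (intro powr_mono') auto
    then have "x powr m \<le> x ^ card E"
      using assms by (simp add: powr_realpow)
    then have "\<rho> ^ card E * x powr m \<le> \<rho> ^ card E * x ^ card E"
      using assms by (intro mult_left_mono) auto
    then show "\<rho> ^ card E \<le> (x * \<rho>) ^ card E / x powr m"
      using assms by (simp add: le_divide_eq power_mult_distrib mult_ac)
  qed
  also have "\<dots> \<le> (\<Sum>E\<in>Pow S. (x * \<rho>) ^ card E / x powr m)"
    using assms by (intro sum_mono2) auto
  also have "\<dots> = (1 + x * \<rho>) ^ card S / x powr m"
    using assms by (simp add: sum_power_card_Pow flip: sum_divide_distrib)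
  finally show ?thesis .
qed

lemma sum_power_card_small_subsets_subexponential:
  fixes b \<rho> :: real
  assumes "1 < b" "1 \<le> \<rho>"
  obtains \<alpha> where "0 < \<alpha>"
    "\<And>S M m. finite S \<Longrightarrow> real (card S) \<le> M \<Longrightarrow> m \<le> \<alpha> * M \<Longrightarrow>
      (\<Sum>E | E \<subseteq> S \<and> real (card E) \<le> m. \<rho> ^ card E) \<le> b powr M"
proof
  define x where "x = min (1/2) ((sqrt b - 1) / \<rho>)"
  define \<alpha> where "\<alpha> = - ln (sqrt b) / ln x"
  have sqrt_b: "1 < sqrt b" using assms by simp
  have x_bounds: "0 < x" "x < 1" using sqrt_b assms by (auto simp: x_def)
  have "x * \<rho> \<le> (sqrt b - 1) / \<rho> * \<rho>"
    using assms by (intro mult_right_mono) (auto simp: x_def)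
  then have base_le: "1 + x * \<rho> \<le> sqrt b" using assms by simp
  have ln_x: "ln x < 0" using x_bounds by simp
  then show "0 < \<alpha>" unfolding \<alpha>_def using sqrt_b by (intro divide_neg_neg) auto
  have x_powr: "x powr \<alpha> = 1 / sqrt b"
    unfolding powr_def \<alpha>_def using ln_x x_bounds sqrt_b by (simp add: exp_minus inverse_eq_divide)
  fix S :: "'a set" and M m
  assume "finite S" and card_S: "real (card S) \<le> M" and m: "m \<le> \<alpha> * M"
  then have "(\<Sum>E | E \<subseteq> S \<and> real (card E) \<le> m. \<rho> ^ card E) \<le> (1 + x * \<rho>) ^ card S / x powr m"
    using x_bounds assms by (intro sum_power_card_small_subsets_le) auto
  also have "\<dots> \<le> (1 + x * \<rho>) ^ card S / x powr (\<alpha> * M)"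
    using m x_bounds assms by (intro divide_left_mono powr_mono') auto
  also have "x powr (\<alpha> * M) = 1 / sqrt b powr M"
    using sqrt_b by (simp add: x_powr powr_divide flip: powr_powr)
  also have "(1 + x * \<rho>) ^ card S / (1 / sqrt b powr M) \<le> sqrt b ^ card S * sqrt b powr M"
    using base_le x_bounds assms by (auto intro!: mult_right_mono power_mono)
  also have "sqrt b ^ card S = sqrt b powr real (card S)" using sqrt_b by (simp add: powr_realpow)
  also have "\<dots> * sqrt b powr M \<le> sqrt b powr M * sqrt b powr M"
    using card_S sqrt_b by (intro mult_right_mono powr_mono) auto
  also have "\<dots> = b powr M" using assms by (simp flip: powr_mult)
  finally show "(\<Sum>E | E \<subseteq> S \<and> real (card E) \<le> m. \<rho> ^ card E) \<le> b powr M" .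
qed

section \<open>Sparse approximation of correlations\<close>

lemma exists_rounding_value:
  fixes a c p \<gamma> :: real
  assumes "0 \<le> a" "a \<le> 1" "0 < \<gamma>" "\<gamma> \<le> 1" "0 \<le> c"
  shows "\<exists>s\<in>{0, 1}. 2 * (s / \<gamma> - a) * p + (s / \<gamma> - a)\<^sup>2 * c \<le> c / \<gamma>"
proof (rule ccontr)
  define gain where "gain s = 2 * (s / \<gamma> - a) * p + (s / \<gamma> - a)\<^sup>2 * c" for s
  assume "\<not> ?thesis"
  then have "c / \<gamma> < gain 1" "c / \<gamma> < gain 0" by (auto simp: gain_def)
  moreover have "0 \<le> \<gamma> * a" "\<gamma> * a \<le> 1" using assms by (auto simp: mult_le_one)
  \<comment> \<open>the average of the gain if \<open>s = 1\<close> has probability \<open>\<gamma> a\<close>\<close>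
  ultimately have "c / \<gamma> < \<gamma> * a * gain 1 + (1 - \<gamma> * a) * gain 0"
    using convex_bound_lt[of "- gain 1" "- (c / \<gamma>)" "- gain 0" "\<gamma> * a" "1 - \<gamma> * a"]
    by (simp add: algebra_simps)
  also have "\<dots> = c * (a / \<gamma> - a\<^sup>2)"
    using assms unfolding gain_def by (simp add: field_simps power2_eq_square)
  also have "\<dots> \<le> c * (1 / \<gamma>)"
    using assms by (intro mult_left_mono) (smt (verit) divide_right_mono zero_le_power2)
  finally show False by simp
qed

definition rounding_error ::
  "'a set \<Rightarrow> real \<Rightarrow> ('a \<Rightarrow> real) \<Rightarrow> 'a set \<Rightarrow> ('a \<Rightarrow> real) \<Rightarrow> real" where
  "rounding_error Y \<gamma> f F w = (\<Sum>y\<in>Y. (indicator F y / \<gamma> - f y) * w y)"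

lemma rounding_error_insert:
  assumes "finite Y" "y \<notin> Y" "F \<subseteq> Y" "s \<in> {0, 1}"
  shows "rounding_error (insert y Y) \<gamma> f (if s = 1 then insert y F else F) w
    = rounding_error Y \<gamma> f F w + (s / \<gamma> - f y) * w y"
proof -
  have "rounding_error Y \<gamma> f (if s = 1 then insert y F else F) w = rounding_error Y \<gamma> f F w"
    unfolding rounding_error_def using assms by (intro sum.cong) (auto simp: indicator_def)
  moreover have "indicator (if s = 1 then insert y F else F) y = s"
    using assms by (auto simp: indicator_def)
  ultimately show ?thesis
    using assms(1,2) by (simp add: rounding_error_def add.commute)
qed

lemma rounding_error_const:
  assumes "finite Y" "F \<subseteq> Y"
  shows "rounding_error Y \<gamma> f F (\<lambda>_. s) = (real (card F) / \<gamma> - sum f Y) * s"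
proof -
  have "(\<Sum>y\<in>Y. indicator F y :: real) = real (card F)"
    using assms by (simp add: indicator_def sum.If_cases Int_absorb1 Collect_mem_eq)
  then show ?thesis
    by (simp add: rounding_error_def sum_subtractf flip: sum_distrib_right sum_divide_distrib)
qed

lemma sparse_rounding:
  fixes v :: "'a \<Rightarrow> 'b \<Rightarrow> real"
  assumes "finite Y" "f \<in> Y \<rightarrow> {0..1}" "0 < \<gamma>" "\<gamma> \<le> 1"
  shows "\<exists>F\<subseteq>Y. (\<Sum>x\<in>X. (rounding_error Y \<gamma> f F (\<lambda>y. v y x))\<^sup>2) \<le> (\<Sum>y\<in>Y. \<Sum>x\<in>X. (v y x)\<^sup>2) / \<gamma>"
  using assms(1,2)
proof (induction Y rule: finite_induct)
  case empty
  then show ?case by (simp add: rounding_error_def)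
next
  case (insert y Y)
  obtain F where F_subset: "F \<subseteq> Y" and F_error:
    "(\<Sum>x\<in>X. (rounding_error Y \<gamma> f F (\<lambda>y. v y x))\<^sup>2) \<le> (\<Sum>y\<in>Y. \<Sum>x\<in>X. (v y x)\<^sup>2) / \<gamma>"
    using insert by auto
  define w where "w x = rounding_error Y \<gamma> f F (\<lambda>y. v y x)" for x
  define p where "p = (\<Sum>x\<in>X. w x * v y x)"
  define c where "c = (\<Sum>x\<in>X. (v y x)\<^sup>2)"
  have square_expand: "(\<Sum>x\<in>X. (w x + t * v y x)\<^sup>2) = (\<Sum>x\<in>X. (w x)\<^sup>2) + (2 * t * p + t\<^sup>2 * c)" for t
    by (simp add: p_def c_def power2_sum sum.distrib sum_distrib_left algebra_simps power_mult_distrib)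
  have "0 \<le> f y" "f y \<le> 1" "0 \<le> c" using insert.prems by (auto simp: c_def sum_nonneg)
  then obtain s :: real where s: "s \<in> {0, 1}"
    and gain: "2 * (s / \<gamma> - f y) * p + (s / \<gamma> - f y)\<^sup>2 * c \<le> c / \<gamma>"
    using exists_rounding_value assms(3,4) by meson
  define F' where "F' = (if s = 1 then insert y F else F)"
  have "(\<Sum>x\<in>X. (rounding_error (insert y Y) \<gamma> f F' (\<lambda>y. v y x))\<^sup>2) = (\<Sum>x\<in>X. (w x + (s / \<gamma> - f y) * v y x)\<^sup>2)"
    unfolding F'_def w_def using insert.hyps F_subset s by (simp add: rounding_error_insert)
  also have "\<dots> \<le> (\<Sum>y\<in>Y. \<Sum>x\<in>X. (v y x)\<^sup>2) / \<gamma> + c / \<gamma>"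
    unfolding square_expand using F_error gain by (intro add_mono) (simp_all add: w_def)
  also have "\<dots> = (\<Sum>y\<in>insert y Y. \<Sum>x\<in>X. (v y x)\<^sup>2) / \<gamma>"
    using insert.hyps by (simp add: c_def add_divide_distrib)
  finally show ?case
    using F_subset by (intro exI[of _ F']) (auto simp: F'_def)
qed

text \<open>An additional coordinate of weight \<open>1 / sqrt N\<close> controls the size of the rounded set.\<close>

lemma sparse_rounding_small:
  fixes v :: "'a \<Rightarrow> 'b \<Rightarrow> real" and N K B :: real
  assumes "finite Y" "finite X" and f: "f \<in> Y \<rightarrow> {0..1}" and \<gamma>: "0 < \<gamma>" "\<gamma> \<le> 1"
    and N: "0 < N" and card_Y: "real (card Y) \<le> K * N"
    and v: "\<And>y. y \<in> Y \<Longrightarrow> (\<Sum>x\<in>X. (v y x)\<^sup>2) \<le> B / N"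
    and B: "0 \<le> B" "1 + B \<le> \<gamma> * K * N"
  shows "\<exists>F\<subseteq>Y. real (card F) \<le> 2 * \<gamma> * K * N \<and>
    (\<Sum>x\<in>X. (rounding_error Y \<gamma> f F (\<lambda>y. v y x))\<^sup>2) \<le> K * (1 + B) / \<gamma>"
proof -
  define v' where "v' y z = (case z of None \<Rightarrow> 1 / sqrt N | Some x \<Rightarrow> v y x)" for y z
  define X' where "X' = insert None (Some ` X)"
  have sum_X': "(\<Sum>z\<in>X'. g z) = g None + (\<Sum>x\<in>X. g (Some x))" for g :: "'b option \<Rightarrow> real"
    unfolding X'_def using \<open>finite X\<close> by (subst sum.insert) (auto simp: sum.reindex)
  obtain F where F_subset: "F \<subseteq> Y" and F_error:
    "(\<Sum>z\<in>X'. (rounding_error Y \<gamma> f F (\<lambda>y. v' y z))\<^sup>2) \<le> (\<Sum>y\<in>Y. \<Sum>z\<in>X'. (v' y z)\<^sup>2) / \<gamma>"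
    using sparse_rounding[OF \<open>finite Y\<close> f \<gamma>] by blast
  define err where "err = (\<Sum>x\<in>X. (rounding_error Y \<gamma> f F (\<lambda>y. v y x))\<^sup>2)"
  have "(\<Sum>y\<in>Y. \<Sum>z\<in>X'. (v' y z)\<^sup>2) \<le> (\<Sum>y\<in>Y. (1 + B) / N)"
    using v N by (intro sum_mono) (auto simp: sum_X' v'_def power_divide add_divide_distrib)
  also have "\<dots> = real (card Y) * ((1 + B) / N)" by simp
  also have "\<dots> \<le> (K * N) * ((1 + B) / N)"
    using card_Y B N by (intro mult_right_mono) auto
  also have "\<dots> = K * (1 + B)" using N by simp
  finally have "(\<Sum>y\<in>Y. \<Sum>z\<in>X'. (v' y z)\<^sup>2) / \<gamma> \<le> K * (1 + B) / \<gamma>"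
    using \<gamma> by (simp add: divide_right_mono)
  moreover have "rounding_error Y \<gamma> f F (\<lambda>y. v' y None) = (real (card F) / \<gamma> - sum f Y) / sqrt N"
    using rounding_error_const[OF \<open>finite Y\<close> F_subset, of \<gamma> f "1 / sqrt N"] by (simp add: v'_def)
  ultimately have total: "(real (card F) / \<gamma> - sum f Y)\<^sup>2 / N + err \<le> K * (1 + B) / \<gamma>"
    using F_error N by (simp add: sum_X' v'_def err_def power_divide)
  have "0 \<le> err" by (simp add: err_def sum_nonneg)
  then have "(real (card F) / \<gamma> - sum f Y)\<^sup>2 / N \<le> K * (1 + B) / \<gamma>"
    using total by linarith
  then have "(real (card F) / \<gamma> - sum f Y)\<^sup>2 \<le> K * (1 + B) / \<gamma> * N"
    using N by (rule pos_divide_le_eq[THEN iffD1, rotated])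
  also have "\<dots> \<le> K * (\<gamma> * K * N) / \<gamma> * N"
  proof -
    have "0 \<le> K * N" using card_Y by (meson of_nat_0_le_iff order_trans)
    then have "0 \<le> K" using N by (simp add: zero_le_mult_iff)
    then show ?thesis using B N \<gamma> by (intro mult_right_mono divide_right_mono mult_left_mono) auto
  qed
  also have "\<dots> = (K * N)\<^sup>2" using \<gamma> by (simp add: power2_eq_square)
  finally have "real (card F) / \<gamma> - sum f Y \<le> K * N"
    using abs_le_square_iff[of "real (card F) / \<gamma> - sum f Y" "K * N"] card_Y by linarith
  moreover have "sum f Y \<le> K * N"
    using sum_mono[of Y f "\<lambda>_. 1"] f card_Y by (auto simp: Pi_iff)
  ultimately have "real (card F) / \<gamma> \<le> 2 * (K * N)" by linarith
  then have "real (card F) \<le> 2 * \<gamma> * K * N" using \<gamma> by (simp add: field_simps)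
  moreover have "err \<le> K * (1 + B) / \<gamma>"
    using total N by (smt (verit) divide_nonneg_pos zero_le_power2)
  ultimately show ?thesis using F_subset unfolding err_def by blast
qed

definition correlation :: "'a set \<Rightarrow> ('a \<Rightarrow> real) \<Rightarrow> ('a::ab_group_add \<Rightarrow> real) \<Rightarrow> 'a \<Rightarrow> real" where
  "correlation Y f W x = (\<Sum>y\<in>Y. f y * W (x + y))"

lemma correlation_eq_sum_translate:
  assumes "finite Z" "\<And>y. y \<in> Y \<Longrightarrow> x + y \<in> Z" "\<And>y. y \<notin> Y \<Longrightarrow> f y = 0"
  shows "correlation Y f W x = (\<Sum>z\<in>Z. f (z - x) * W z)"
proof -
  have "(\<Sum>z\<in>Z. f (z - x) * W z) = (\<Sum>z\<in>(+) x ` Y. f (z - x) * W z)"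
  proof (rule sum.mono_neutral_right[OF \<open>finite Z\<close>])
    show "\<forall>z\<in>Z - (+) x ` Y. f (z - x) * W z = 0"
    proof
      fix z assume "z \<in> Z - (+) x ` Y"
      then have "z - x \<notin> Y" by (metis DiffD2 add.commute diff_add_cancel image_eqI)
      then show "f (z - x) * W z = 0" using assms(3) by simp
    qed
  qed (use assms(2) in auto)
  then show ?thesis by (simp add: correlation_def sum.reindex)
qed

lemma correlation_rounding_error:
  assumes "finite Z" "\<And>y. y \<in> Y \<Longrightarrow> x + y \<in> Z" "F \<subseteq> Y" "0 < N" "0 < \<gamma>"
  shows "correlation Y (indicator F) (indicator E) x / (\<gamma>\<^sup>2 * N) - correlation Y f W x / N
    = rounding_error Y \<gamma> f F (\<lambda>y. W (x + y) / N)
      + rounding_error Z \<gamma> W E (\<lambda>z. indicator F (z - x) / (\<gamma> * N))"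
proof -
  have "rounding_error Z \<gamma> W E (\<lambda>z. indicator F (z - x) / (\<gamma> * N))
      = (\<Sum>z\<in>Z. indicator F (z - x) * ((indicator E z / \<gamma> - W z) / (\<gamma> * N)))"
    by (simp add: rounding_error_def mult.commute)
  also have "\<dots> = correlation Y (indicator F) (\<lambda>z. (indicator E z / \<gamma> - W z) / (\<gamma> * N)) x"
    using assms by (intro correlation_eq_sum_translate[symmetric]) (auto simp: indicator_def)
  finally have second: "rounding_error Z \<gamma> W E (\<lambda>z. indicator F (z - x) / (\<gamma> * N))
      = correlation Y (indicator F) (\<lambda>z. (indicator E z / \<gamma> - W z) / (\<gamma> * N)) x" .
  have "indicator F y * indicator E (x + y) / (\<gamma>\<^sup>2 * N) - f y * W (x + y) / N
      = (indicator F y / \<gamma> - f y) * (W (x + y) / N)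
        + indicator F y * ((indicator E (x + y) / \<gamma> - W (x + y)) / (\<gamma> * N))" for y
    using assms(4,5) by (simp add: field_simps power2_eq_square)
  then show ?thesis
    unfolding second by (simp add: correlation_def rounding_error_def sum_divide_distrib
        flip: sum.distrib sum_subtractf)
qed

lemma sum_abs_add_le_of_sum_squares:
  fixes a b :: "'a \<Rightarrow> real"
  assumes "(\<Sum>x\<in>G. (a x)\<^sup>2) \<le> p" "(\<Sum>x\<in>G. (b x)\<^sup>2) \<le> q"
    and "2 * p + 2 * q \<le> \<epsilon>\<^sup>2 * real (card G)" "0 \<le> \<epsilon>"
  shows "(\<Sum>x\<in>G. \<bar>a x + b x\<bar>) \<le> \<epsilon> * real (card G)"
proof (rule power2_le_imp_le)
  have "(a x + b x)\<^sup>2 \<le> 2 * (a x)\<^sup>2 + 2 * (b x)\<^sup>2" for x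
    using zero_le_power2[of "a x - b x"] by (simp add: power2_sum power2_diff)
  then have "(\<Sum>x\<in>G. (a x + b x)\<^sup>2) \<le> (\<Sum>x\<in>G. 2 * (a x)\<^sup>2 + 2 * (b x)\<^sup>2)"
    by (rule sum_mono)
  also have "\<dots> = 2 * (\<Sum>x\<in>G. (a x)\<^sup>2) + 2 * (\<Sum>x\<in>G. (b x)\<^sup>2)"
    by (simp add: sum.distrib sum_distrib_left)
  also have "\<dots> \<le> \<epsilon>\<^sup>2 * real (card G)" using assms by linarith
  finally have "(\<Sum>x\<in>G. (a x + b x)\<^sup>2) * real (card G) \<le> \<epsilon>\<^sup>2 * real (card G) * real (card G)"
    by (rule mult_right_mono) simp
  moreover have "(\<Sum>x\<in>G. \<bar>a x + b x\<bar>)\<^sup>2 \<le> (\<Sum>x\<in>G. (a x + b x)\<^sup>2) * real (card G)"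
    using sum_squared_le_sum_of_squares[of "\<lambda>x. \<bar>a x + b x\<bar>" G] by simp
  ultimately show "(\<Sum>x\<in>G. \<bar>a x + b x\<bar>)\<^sup>2 \<le> (\<epsilon> * real (card G))\<^sup>2"
    by (simp add: power2_eq_square mult_ac)
qed (use assms in simp)

definition sparse_correlations :: "real \<Rightarrow> 'a set \<Rightarrow> 'a set \<Rightarrow> real \<Rightarrow> ('a::ab_group_add \<Rightarrow> real) set" where
  "sparse_correlations s Y Z m = (\<lambda>(F, E) x. correlation Y (indicator F) (indicator E) x / s) `
    ({F. F \<subseteq> Y \<and> real (card F) \<le> m} \<times> {E. E \<subseteq> Z \<and> real (card E) \<le> m})"

lemma finite_sparse_correlations: "finite Y \<Longrightarrow> finite Z \<Longrightarrow> finite (sparse_correlations s Y Z m)"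
  by (simp add: sparse_correlations_def)

lemma card_sparse_correlations_le:
  assumes "finite Y" "finite Z"
  shows "card (sparse_correlations s Y Z m)
    \<le> card {F. F \<subseteq> Y \<and> real (card F) \<le> m} * card {E. E \<subseteq> Z \<and> real (card E) \<le> m}"
  unfolding sparse_correlations_def card_cartesian_product[symmetric]
  using assms by (intro card_image_le finite_cartesian_product) auto

lemma correlation_rounding:
  fixes G Y Z :: "'a::ab_group_add set" and K :: real
  defines "N \<equiv> real (card G)"
  assumes fin: "finite G" "finite Y" "finite Z" and "G \<noteq> {}"
    and YZ: "\<And>x y. x \<in> G \<Longrightarrow> y \<in> Y \<Longrightarrow> x + y \<in> Z"
    and f: "f \<in> Y \<rightarrow> {0..1}" and W: "W \<in> Z \<rightarrow> {0..1}"
    and \<gamma>: "0 < \<gamma>" "\<gamma> \<le> 1" and card_Y: "real (card Y) \<le> K * N" and card_Z: "real (card Z) \<le> K * N"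
    and \<epsilon>: "0 < \<epsilon>" and N_large: "1 + 1 / \<gamma>\<^sup>2 \<le> \<gamma> * K * N" "8 * K / \<gamma> ^ 3 \<le> \<epsilon>\<^sup>2 * N"
  shows "\<exists>g\<in>sparse_correlations (\<gamma>\<^sup>2 * N) Y Z (2 * \<gamma> * K * N).
    (\<Sum>x\<in>G. \<bar>g x - correlation Y f W x / N\<bar>) \<le> \<epsilon> * N"
proof -
  have N: "0 < N" using fin \<open>G \<noteq> {}\<close> by (auto simp: N_def card_gt_0_iff)
  have \<gamma>_inverse: "1 \<le> 1 / \<gamma>\<^sup>2" using \<gamma> by (simp add: power_le_one)
  have sum_G: "(\<Sum>x\<in>G. s / N\<^sup>2) = s / N" for s
    using N by (simp add: N_def power2_eq_square)
  have "(\<Sum>x\<in>G. (W (x + y) / N)\<^sup>2) \<le> 1 / N" if "y \<in> Y" for y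
  proof -
    have "0 \<le> W (x + y)" "W (x + y) \<le> 1" if "x \<in> G" for x
      using W YZ[OF that \<open>y \<in> Y\<close>] by (auto simp: Pi_iff)
    then have "(\<Sum>x\<in>G. (W (x + y) / N)\<^sup>2) \<le> (\<Sum>x\<in>G. 1 / N\<^sup>2)"
      by (intro sum_mono) (simp add: power_divide power_le_one divide_right_mono)
    then show ?thesis unfolding sum_G .
  qed
  then obtain F where F: "F \<subseteq> Y" "real (card F) \<le> 2 * \<gamma> * K * N" and F_error:
    "(\<Sum>x\<in>G. (rounding_error Y \<gamma> f F (\<lambda>y. W (x + y) / N))\<^sup>2) \<le> K * (1 + 1) / \<gamma>"
    using sparse_rounding_small[OF fin(2,1) f \<gamma> N card_Y, of "\<lambda>y x. W (x + y) / N" 1]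
      N_large(1) \<gamma>_inverse by auto
  have "(\<Sum>x\<in>G. (indicator F (z - x) / (\<gamma> * N))\<^sup>2) \<le> 1 / \<gamma>\<^sup>2 / N" for z
  proof -
    have "(\<Sum>x\<in>G. (indicator F (z - x) / (\<gamma> * N))\<^sup>2) \<le> (\<Sum>x\<in>G. 1 / \<gamma>\<^sup>2 / N\<^sup>2)"
      by (intro sum_mono) (auto simp: indicator_def power_divide power_mult_distrib)
    then show ?thesis unfolding sum_G .
  qed
  then obtain E where E: "E \<subseteq> Z" "real (card E) \<le> 2 * \<gamma> * K * N" and E_error:
    "(\<Sum>x\<in>G. (rounding_error Z \<gamma> W E (\<lambda>z. indicator F (z - x) / (\<gamma> * N)))\<^sup>2) \<le> K * (1 + 1 / \<gamma>\<^sup>2) / \<gamma>"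
    using sparse_rounding_small[OF fin(3,1) W \<gamma> N card_Z, of "\<lambda>z x. indicator F (z - x) / (\<gamma> * N)" "1 / \<gamma>\<^sup>2"]
      N_large(1) by auto
  have "0 \<le> K * N" using card_Y by (meson of_nat_0_le_iff order_trans)
  then have K: "0 \<le> K" using N by (simp add: zero_le_mult_iff)
  have "2 * (K * (1 + 1) / \<gamma>) + 2 * (K * (1 + 1 / \<gamma>\<^sup>2) / \<gamma>) = 2 * K / \<gamma> * (3 + 1 / \<gamma>\<^sup>2)"
    by (simp add: algebra_simps add_divide_distrib)
  also have "\<dots> \<le> 2 * K / \<gamma> * (4 / \<gamma>\<^sup>2)"
  proof (rule mult_left_mono)
    show "3 + 1 / \<gamma>\<^sup>2 \<le> 4 / \<gamma>\<^sup>2" using \<gamma>_inverse by linarith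
  qed (use K \<gamma> in simp)
  also have "\<dots> \<le> \<epsilon>\<^sup>2 * N" using N_large(2) by (simp add: power2_eq_square power3_eq_cube)
  finally have "(\<Sum>x\<in>G. \<bar>correlation Y (indicator F) (indicator E) x / (\<gamma>\<^sup>2 * N) - correlation Y f W x / N\<bar>)
      \<le> \<epsilon> * N"
    using sum_abs_add_le_of_sum_squares[OF F_error E_error] \<epsilon> fin YZ F(1) N \<gamma>
    by (simp add: correlation_rounding_error[of Z] N_def cong: sum.cong)
  then show ?thesis
    using F E unfolding sparse_correlations_def by (intro bexI[OF _ imageI[of "(F, E)"]]) auto
qed

definition correlation_net ::
  "real \<Rightarrow> 'a set \<Rightarrow> 'a set \<Rightarrow> 'a set \<Rightarrow> ('a::ab_group_add \<Rightarrow> real) set \<Rightarrow> bool" where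
  "correlation_net \<epsilon> G Y Z \<N> \<longleftrightarrow> (\<forall>f\<in>Y \<rightarrow> {0..1}. \<forall>W\<in>Z \<rightarrow> {0..1}. \<exists>g\<in>\<N>.
     (\<Sum>x\<in>G. \<bar>g x - correlation Y f W x / real (card G)\<bar>) \<le> \<epsilon> * real (card G))"

lemma exists_small_correlation_net:
  fixes K \<epsilon> b :: real
  assumes "1 \<le> K" "0 < \<epsilon>" "1 < b"
  shows "\<forall>\<^sub>F G in large_sets P. \<forall>Y Z :: 'a::ab_group_add set. finite Y \<and> finite Z \<and>
    real (card Y) \<le> K * real (card G) \<and> real (card Z) \<le> K * real (card G) \<and> (\<forall>x\<in>G. \<forall>y\<in>Y. x + y \<in> Z) \<longrightarrow>
    (\<exists>\<N>. finite \<N> \<and> real (card \<N>) \<le> b ^ card G \<and> correlation_net \<epsilon> G Y Z \<N>)"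
proof -
  define b' where "b' = b powr (1 / (2 * K))"
  have "1 < b'" unfolding b'_def using assms by (simp add: gr_one_powr)
  obtain \<alpha> where \<alpha>: "0 < \<alpha>" and small_subsets: "\<And>S :: 'a set. \<And>M m. finite S \<Longrightarrow> real (card S) \<le> M \<Longrightarrow>
    m \<le> \<alpha> * M \<Longrightarrow> (\<Sum>E | E \<subseteq> S \<and> real (card E) \<le> m. 1 ^ card E) \<le> b' powr M"
    using sum_power_card_small_subsets_subexponential[OF \<open>1 < b'\<close> order_refl, where 'a = 'a] by blast
  define \<gamma> where "\<gamma> = min 1 (\<alpha> / 2)"
  have \<gamma>: "0 < \<gamma>" "\<gamma> \<le> 1" "2 * \<gamma> \<le> \<alpha>" using \<alpha> by (auto simp: \<gamma>_def)
  define c where "c = max 1 (max ((1 + 1 / \<gamma>\<^sup>2) / (\<gamma> * K)) (8 * K / \<gamma> ^ 3 / \<epsilon>\<^sup>2))"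
  show ?thesis
    using eventually_large_sets[of P c]
  proof (eventually_elim, intro allI impI, elim conjE)
    fix G Y Z :: "'a set"
    assume G: "finite G" "c \<le> real (card G)" and fin: "finite Y" "finite Z"
      and card_Y: "real (card Y) \<le> K * real (card G)" and card_Z: "real (card Z) \<le> K * real (card G)"
      and YZ: "\<forall>x\<in>G. \<forall>y\<in>Y. x + y \<in> Z"
    define N where "N = real (card G)"
    define m where "m = 2 * \<gamma> * K * N"
    have N: "1 \<le> N" "(1 + 1 / \<gamma>\<^sup>2) / (\<gamma> * K) \<le> N" "8 * K / \<gamma> ^ 3 / \<epsilon>\<^sup>2 \<le> N"
      using G by (auto simp: N_def c_def)
    have N_large: "1 + 1 / \<gamma>\<^sup>2 \<le> \<gamma> * K * N" "8 * K / \<gamma> ^ 3 \<le> \<epsilon>\<^sup>2 * N"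
      using N(2,3) \<gamma> assms by (simp_all add: pos_divide_le_eq mult_ac del: divide_divide_eq_left)
    have "m \<le> \<alpha> * (K * N)"
      using mult_right_mono[OF \<gamma>(3), of "K * N"] assms(1) N(1) by (simp add: m_def mult_ac)
    then have card_small: "real (card {E. E \<subseteq> S \<and> real (card E) \<le> m}) \<le> b' powr (K * N)"
      if "finite S" "real (card S) \<le> K * N" for S :: "'a set"
      using small_subsets[OF that] by simp
    have "real (card (sparse_correlations (\<gamma>\<^sup>2 * N) Y Z m))
        \<le> real (card {F. F \<subseteq> Y \<and> real (card F) \<le> m}) * real (card {E. E \<subseteq> Z \<and> real (card E) \<le> m})"
      using card_sparse_correlations_le[OF fin] by (simp flip: of_nat_mult)
    also have "\<dots> \<le> b' powr (K * N) * b' powr (K * N)"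
      using card_small fin card_Y card_Z by (intro mult_mono) (simp_all add: N_def)
    also have "\<dots> = b powr N" unfolding b'_def using assms by (simp add: powr_powr flip: powr_add)
    also have "\<dots> = b ^ card G" using assms by (simp add: N_def powr_realpow)
    finally have "real (card (sparse_correlations (\<gamma>\<^sup>2 * N) Y Z m)) \<le> b ^ card G" .
    moreover have "G \<noteq> {}" using N(1) by (auto simp: N_def)
    then have "correlation_net \<epsilon> G Y Z (sparse_correlations (\<gamma>\<^sup>2 * N) Y Z m)"
      using correlation_rounding[OF _ fin _ _ _ _ \<gamma>(1,2) card_Y card_Z assms(2)] N_large G YZ
      unfolding correlation_net_def N_def m_def by blast
    ultimately show "\<exists>\<N>. finite \<N> \<and> real (card \<N>) \<le> b ^ card G \<and> correlation_net \<epsilon> G Y Z \<N>"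
      using finite_sparse_correlations[OF fin] unfolding N_def by blast
  qed
qed

section \<open>Counting solutions\<close>

abbreviation slots :: "nat \<Rightarrow> nat \<Rightarrow> (nat \<times> nat) set" where
  "slots k h \<equiv> {1..k} \<times> {1..h}"

definition sumset :: "'i set \<Rightarrow> 'a::comm_monoid_add set \<Rightarrow> 'a set" where
  "sumset I G = (\<lambda>u. sum u I) ` (I \<rightarrow>\<^sub>E G)"

lemma finite_sumset: "finite I \<Longrightarrow> finite G \<Longrightarrow> finite (sumset I G)"
  unfolding sumset_def by (intro finite_imageI finite_PiE)

lemma sum_fun_upd:
  assumes "finite I" "i \<in> I"
  shows "sum (u(i := x)) I = x + sum u (I - {i})"
proof -
  have "sum (u(i := x)) (I - {i}) = sum u (I - {i})" by (rule sum.cong) auto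
  then show ?thesis using assms by (simp only: sum.remove[OF assms] fun_upd_same)
qed

lemma add_mem_sumset:
  assumes "finite I" "i \<in> I" "x \<in> G" "y \<in> sumset (I - {i}) G"
  shows "x + y \<in> sumset I G"
proof -
  obtain u where u: "u \<in> (I - {i}) \<rightarrow>\<^sub>E G" "y = sum u (I - {i})"
    using assms(4) by (auto simp: sumset_def)
  have "x + y = sum (u(i := x)) I" using assms(1,2) by (simp only: sum_fun_upd u(2))
  moreover have "u(i := x) \<in> I \<rightarrow>\<^sub>E G" using u(1) assms(2,3) by (auto simp: PiE_iff extensional_def)
  ultimately show ?thesis unfolding sumset_def by blast
qed

lemma card_sumset_remove_le:
  fixes G :: "'a::ab_group_add set"
  assumes "finite I" "i \<in> I" "finite G" "G \<noteq> {}"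
  shows "card (sumset (I - {i}) G) \<le> card (sumset I G)"
proof -
  obtain x where "x \<in> G" using \<open>G \<noteq> {}\<close> by blast
  then have "(+) x ` sumset (I - {i}) G \<subseteq> sumset I G"
    using add_mem_sumset[OF assms(1,2)] by blast
  then show ?thesis
    using assms by (intro card_inj_on_le[of "(+) x"] finite_sumset) auto
qed

definition representations :: "'i set \<Rightarrow> ('i \<Rightarrow> 'a set) \<Rightarrow> 'a::comm_monoid_add \<Rightarrow> ('i \<Rightarrow> 'a) set" where
  "representations I D z = {u \<in> Pi\<^sub>E I D. sum u I = z}"

lemma representations_cong:
  "(\<And>i. i \<in> I \<Longrightarrow> D i = D' i) \<Longrightarrow> representations I D z = representations I D' z"
  unfolding representations_def by (auto cong: PiE_cong)

lemma finite_representations: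
  assumes "finite I" "\<And>i. i \<in> I \<Longrightarrow> finite (D i)"
  shows "finite (representations I D z)"
  unfolding representations_def using finite_PiE[OF assms] by simp

lemma representations_eq_empty:
  assumes "\<And>i. i \<in> I \<Longrightarrow> D i \<subseteq> G" "z \<notin> sumset I G"
  shows "representations I D z = {}"
  using assms PiE_mono[of I D "\<lambda>_. G"] unfolding representations_def sumset_def by blast

lemma sum_card_representations:
  assumes "finite I" "finite G" "\<And>i. i \<in> I \<Longrightarrow> D i \<subseteq> G"
  shows "(\<Sum>z\<in>sumset I G. card (representations I D z)) = (\<Prod>i\<in>I. card (D i))"
proof -
  have finite_D: "finite (D i)" if "i \<in> I" for i using assms(2) assms(3)[OF that] finite_subset by blast
  have "Pi\<^sub>E I D \<subseteq> I \<rightarrow>\<^sub>E G" using assms(3) by (rule PiE_mono)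
  then have "Pi\<^sub>E I D = (\<Union>z\<in>sumset I G. representations I D z)"
    by (auto simp: representations_def sumset_def)
  moreover have "card (\<Union>z\<in>sumset I G. representations I D z) = (\<Sum>z\<in>sumset I G. card (representations I D z))"
  proof (rule card_UN_disjoint)
    show "finite (sumset I G)" using assms(1,2) by (rule finite_sumset)
    show "\<forall>z\<in>sumset I G. finite (representations I D z)"
      using assms(1) finite_D by (simp add: finite_representations)
  qed (auto simp: representations_def)
  ultimately show ?thesis using card_PiE[OF assms(1), of D] by metis
qed

lemma card_representations_remove:
  fixes D :: "'i \<Rightarrow> 'a::ab_group_add set"
  assumes "finite I" "j \<in> I" "\<And>i. i \<in> I \<Longrightarrow> finite (D i)"
  shows "card (representations I D z) = (\<Sum>x\<in>D j. card (representations (I - {j}) D (z - x)))"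
proof -
  define extend where "extend x u = u(j := x)" for x :: 'a and u :: "'i \<Rightarrow> 'a"
  have "Pi\<^sub>E I D = (\<lambda>(x, u). extend x u) ` (D j \<times> Pi\<^sub>E (I - {j}) D)"
    using PiE_insert_eq[of j "I - {j}" D] \<open>j \<in> I\<close> by (simp add: insert_absorb extend_def)
  moreover have "sum (extend x u) I = x + sum u (I - {j})" for x u
    using assms(1,2) by (simp only: extend_def sum_fun_upd)
  ultimately have union: "representations I D z = (\<Union>x\<in>D j. extend x ` representations (I - {j}) D (z - x))"
    unfolding representations_def by (auto simp: algebra_simps)
  have inj_extend: "inj_on (extend x) (representations (I - {j}) D (z - x))" for x
    unfolding extend_def representations_def
    by (auto simp: inj_on_def fun_eq_iff PiE_iff extensional_def) metis
  have "extend x ` representations (I - {j}) D (z - x)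
      \<inter> extend x' ` representations (I - {j}) D (z - x') = {}" if "x \<noteq> x'" for x x'
    using that by (auto simp: extend_def dest: fun_upd_eqD)
  then have "card (representations I D z)
      = (\<Sum>x\<in>D j. card (extend x ` representations (I - {j}) D (z - x)))"
    unfolding union using assms
    by (intro card_UN_disjoint ballI impI) (auto intro!: finite_imageI finite_representations)
  then show ?thesis using inj_extend by (simp add: card_image)
qed

lemma card_representations_le:
  fixes D :: "'i \<Rightarrow> 'a::ab_group_add set"
  assumes "finite I" "I \<noteq> {}" "\<And>i. i \<in> I \<Longrightarrow> finite (D i) \<and> card (D i) \<le> N"
  shows "card (representations I D z) \<le> N ^ (card I - 1)"
  using assms
proof (induction I arbitrary: z rule: finite_ne_induct)
  case (singleton i)
  have "representations {i} D z \<subseteq> {\<lambda>j\<in>{i}. z}"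
    by (auto simp: representations_def fun_eq_iff PiE_iff extensional_def)
  then have "card (representations {i} D z) \<le> card {\<lambda>j\<in>{i}. z}" by (intro card_mono) simp
  then show ?case by simp
next
  case (insert i I)
  have "card (representations (insert i I) D z) = (\<Sum>x\<in>D i. card (representations I D (z - x)))"
    using insert by (subst card_representations_remove[of _ i]) auto
  also have "\<dots> \<le> card (D i) * N ^ (card I - 1)"
    using sum_bounded_above[of "D i" "\<lambda>x. card (representations I D (z - x))" "N ^ (card I - 1)"]
      insert.IH insert.prems by simp
  also have "\<dots> \<le> N * N ^ (card I - 1)"
    using insert.prems by (intro mult_right_mono) auto
  also have "\<dots> = N ^ (card (insert i I) - 1)"
    using insert.hyps by (simp add: card_gt_0_iff flip: power_Suc)
  finally show ?case .
qed

definition solutions :: "nat \<Rightarrow> nat \<Rightarrow> (nat \<times> nat \<Rightarrow> 'a::comm_monoid_add set) \<Rightarrow> (nat \<Rightarrow> nat \<Rightarrow> 'a) set" where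
  "solutions k h D = {x \<in> (\<Pi>\<^sub>E l\<in>{1..k}. \<Pi>\<^sub>E i\<in>{1..h}. D (l, i)).
     \<forall>l\<in>{1..k}. \<forall>m\<in>{1..k}. (\<Sum>i=1..h. x l i) = (\<Sum>i=1..h. x m i)}"

lemma finite_solutions:
  assumes "\<And>q. q \<in> slots k h \<Longrightarrow> finite (D q)"
  shows "finite (solutions k h D)"
proof -
  have "finite (\<Pi>\<^sub>E l\<in>{1..k}. \<Pi>\<^sub>E i\<in>{1..h}. D (l, i))"
    using assms by (intro finite_PiE) auto
  then show ?thesis by (simp add: solutions_def)
qed

lemma solutions_mono:
  assumes "\<And>q. q \<in> slots k h \<Longrightarrow> D q \<subseteq> D' q"
  shows "solutions k h D \<subseteq> solutions k h D'"
proof -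
  have "(\<Pi>\<^sub>E l\<in>{1..k}. \<Pi>\<^sub>E i\<in>{1..h}. D (l, i)) \<subseteq> (\<Pi>\<^sub>E l\<in>{1..k}. \<Pi>\<^sub>E i\<in>{1..h}. D' (l, i))"
    using assms by (intro PiE_mono) auto
  then show ?thesis by (auto simp: solutions_def)
qed

lemma card_solutions:
  fixes D :: "nat \<times> nat \<Rightarrow> 'a::comm_monoid_add set"
  assumes "1 \<le> k" "finite G" and D: "\<And>q. q \<in> slots k h \<Longrightarrow> D q \<subseteq> G"
  shows "card (solutions k h D)
    = (\<Sum>z\<in>sumset {1..h} G. \<Prod>l=1..k. card (representations {1..h} (\<lambda>i. D (l, i)) z))"
proof -
  define rows where "rows z = (\<Pi>\<^sub>E l\<in>{1..k}. representations {1..h} (\<lambda>i. D (l, i)) z)" for z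
  have finite_D: "finite (D (l, i))" if "l \<in> {1..k}" "i \<in> {1..h}" for l i
    using finite_subset[OF D[of "(l, i)"] \<open>finite G\<close>] that by simp
  have "solutions k h D = (\<Union>z\<in>sumset {1..h} G. rows z)"
  proof
    show "solutions k h D \<subseteq> (\<Union>z\<in>sumset {1..h} G. rows z)"
    proof
      fix x assume x: "x \<in> solutions k h D"
      then have x_mem: "x \<in> (\<Pi>\<^sub>E l\<in>{1..k}. \<Pi>\<^sub>E i\<in>{1..h}. D (l, i))" by (simp add: solutions_def)
      then have "x 1 \<in> (\<Pi>\<^sub>E i\<in>{1..h}. D (1, i))"
        by (rule PiE_mem) (use \<open>1 \<le> k\<close> in simp)
      moreover have "(\<Pi>\<^sub>E i\<in>{1..h}. D (1, i)) \<subseteq> {1..h} \<rightarrow>\<^sub>E G"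
        using D \<open>1 \<le> k\<close> by (intro PiE_mono) simp
      ultimately have "(\<Sum>i=1..h. x 1 i) \<in> sumset {1..h} G" unfolding sumset_def by blast
      moreover have "x \<in> rows (\<Sum>i=1..h. x 1 i)"
        unfolding rows_def
      proof (rule PiE_I)
        fix l assume l: "l \<in> {1..k}"
        have "1 \<in> {1..k}" using \<open>1 \<le> k\<close> by simp
        then have "(\<Sum>i=1..h. x l i) = (\<Sum>i=1..h. x 1 i)"
          using x l unfolding solutions_def by blast
        then show "x l \<in> representations {1..h} (\<lambda>i. D (l, i)) (\<Sum>i=1..h. x 1 i)"
          using PiE_mem[OF x_mem l] by (simp add: representations_def)
      qed (rule PiE_arb[OF x_mem])
      ultimately show "x \<in> (\<Union>z\<in>sumset {1..h} G. rows z)" by blast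
    qed
    show "(\<Union>z\<in>sumset {1..h} G. rows z) \<subseteq> solutions k h D"
      unfolding solutions_def rows_def representations_def by (auto simp: PiE_iff)
  qed
  moreover have "rows z \<inter> rows z' = {}" if "z \<noteq> z'" for z z'
    using that \<open>1 \<le> k\<close> unfolding rows_def representations_def by (auto simp: PiE_iff Ball_def)
  moreover have "finite (rows z)" for z
    unfolding rows_def using finite_D by (intro finite_PiE finite_representations) auto
  ultimately have "card (solutions k h D) = (\<Sum>z\<in>sumset {1..h} G. card (rows z))"
    using finite_sumset[of "{1..h}" G] \<open>finite G\<close> by (simp only:, intro card_UN_disjoint) auto
  then show ?thesis by (simp add: rows_def card_PiE)
qed

lemma sum_power_le_power_sum:
  fixes a :: "'a \<Rightarrow> real"
  assumes "finite Z" "Z \<noteq> {}" "\<And>z. z \<in> Z \<Longrightarrow> 0 \<le> a z" "1 \<le> k"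
  shows "(\<Sum>z\<in>Z. a z) ^ k \<le> real (card Z) ^ (k - 1) * (\<Sum>z\<in>Z. a z ^ k)"
proof -
  have card_Z: "0 < real (card Z)" using assms by (simp add: card_gt_0_iff)
  have "(\<Sum>z\<in>Z. (1 / card Z) *\<^sub>R a z) ^ k \<le> (\<Sum>z\<in>Z. (1 / card Z) * a z ^ k)"
  proof (rule convex_on_sum[OF assms(1,2)])
    show "convex_on {0..} (\<lambda>x::real. x ^ k)"
      by (cases "even k") (auto intro: convex_power_odd convex_on_subset[OF convex_power_even])
  qed (use assms card_Z in auto)
  then have "((\<Sum>z\<in>Z. a z) / card Z) ^ k \<le> (\<Sum>z\<in>Z. a z ^ k) / card Z"
    by (simp add: sum_divide_distrib)
  then have "(\<Sum>z\<in>Z. a z) ^ k \<le> (\<Sum>z\<in>Z. a z ^ k) / card Z * card Z ^ k"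
    using card_Z by (simp add: power_divide divide_le_eq)
  also have "\<dots> = card Z ^ (k - 1) * (\<Sum>z\<in>Z. a z ^ k)"
    using card_Z assms(4) by (cases k) auto
  finally show ?thesis by simp
qed

text \<open>Using the same sets in every row makes the number of solutions a \<open>k\<close>-th moment of the
  representation function, so convexity bounds it from below.\<close>

lemma card_solutions_equal_rows_ge:
  fixes B :: "nat \<Rightarrow> 'a::ab_group_add set"
  assumes "1 \<le> k" "finite G" "G \<noteq> {}" and B: "\<And>i. i \<in> {1..h} \<Longrightarrow> B i \<subseteq> G"
  shows "real (\<Prod>i=1..h. card (B i)) ^ k
    \<le> real (card (sumset {1..h} G)) ^ (k - 1) * real (card (solutions k h (\<lambda>q. B (snd q))))"
proof -
  define Z where "Z = sumset {1..h} G"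
  define reps where "reps z = real (card (representations {1..h} B z))" for z
  have "finite Z" using \<open>finite G\<close> by (simp add: Z_def finite_sumset)
  moreover have "Z \<noteq> {}" using \<open>G \<noteq> {}\<close> by (simp add: Z_def sumset_def PiE_eq_empty_iff)
  ultimately have "(\<Sum>z\<in>Z. reps z) ^ k \<le> real (card Z) ^ (k - 1) * (\<Sum>z\<in>Z. reps z ^ k)"
    using \<open>1 \<le> k\<close> by (intro sum_power_le_power_sum) (auto simp: reps_def)
  moreover have "(\<Sum>z\<in>Z. reps z) = real (\<Prod>i=1..h. card (B i))"
    using sum_card_representations[of "{1..h}" G B] assms
    unfolding Z_def reps_def by (simp flip: of_nat_sum)
  moreover have "(\<Sum>z\<in>Z. reps z ^ k) = real (card (solutions k h (\<lambda>q. B (snd q))))"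
    using card_solutions[of k G h "\<lambda>q. B (snd q)"] assms by (auto simp: Z_def reps_def)
  ultimately show ?thesis by (simp add: Z_def)
qed

definition row_completions :: "nat \<Rightarrow> (nat \<times> nat \<Rightarrow> 'a::comm_monoid_add set) \<Rightarrow> nat \<times> nat \<Rightarrow> 'a \<Rightarrow> nat" where
  "row_completions h D p y = card (representations ({1..h} - {snd p}) (\<lambda>i. D (fst p, i)) y)"

definition other_rows :: "nat \<Rightarrow> nat \<Rightarrow> (nat \<times> nat \<Rightarrow> 'a::comm_monoid_add set) \<Rightarrow> nat \<times> nat \<Rightarrow> 'a \<Rightarrow> nat" where
  "other_rows k h D p z = (\<Prod>l\<in>{1..k} - {fst p}. card (representations {1..h} (\<lambda>i. D (l, i)) z))"

lemma row_completions_fun_upd [simp]: "row_completions h (D(p := B)) p = row_completions h D p"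
  unfolding row_completions_def
  by (intro ext arg_cong[of _ _ card] representations_cong) (cases p, auto)

lemma other_rows_fun_upd [simp]: "other_rows k h (D(p := B)) p = other_rows k h D p"
  unfolding other_rows_def
  by (intro ext prod.cong refl arg_cong[of _ _ card] representations_cong) (cases p, auto)

lemma row_completions_le:
  fixes D :: "nat \<times> nat \<Rightarrow> 'a::ab_group_add set"
  assumes "2 \<le> h" "p \<in> slots k h" "finite G" "\<And>q. D q \<subseteq> G"
  shows "row_completions h D p y \<le> card G ^ (h - 2)"
proof -
  have "card ({1..h} - {snd p}) = h - 1" using assms(2) by auto
  then have "card ({1..h} - {snd p}) - 1 = h - 2" "{1..h} - {snd p} \<noteq> {}"
    using \<open>2 \<le> h\<close> by (simp, metis card.empty diff_is_0_eq not_less_eq_eq numeral_2_eq_2 One_nat_def)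
  then show ?thesis
    using card_representations_le[of "{1..h} - {snd p}" "\<lambda>i. D (fst p, i)" "card G" y]
      finite_subset[OF assms(4,3)] card_mono[OF assms(3,4)]
    unfolding row_completions_def by simp
qed

lemma other_rows_le:
  fixes D :: "nat \<times> nat \<Rightarrow> 'a::ab_group_add set"
  assumes "1 \<le> h" "p \<in> slots k h" "finite G" "\<And>q. D q \<subseteq> G"
  shows "other_rows k h D p z \<le> card G ^ ((k - 1) * (h - 1))"
proof -
  have "other_rows k h D p z \<le> (\<Prod>l\<in>{1..k} - {fst p}. card G ^ (h - 1))"
    unfolding other_rows_def
  proof (rule prod_mono, intro conjI)
    fix l
    show "card (representations {1..h} (\<lambda>i. D (l, i)) z) \<le> card G ^ (h - 1)"
      using card_representations_le[of "{1..h}" "\<lambda>i. D (l, i)" "card G" z]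
        finite_subset[OF assms(4,3)] card_mono[OF assms(3,4)] \<open>1 \<le> h\<close>
      by simp
  qed simp
  also have "\<dots> = card G ^ ((k - 1) * (h - 1))"
    using assms(2) by (auto simp: mult.commute simp flip: power_mult)
  finally show ?thesis .
qed

text \<open>The normalized number of solutions with entry \<open>x\<close> in slot \<open>p\<close>.\<close>

definition slot_degree ::
  "nat \<Rightarrow> nat \<Rightarrow> 'a set \<Rightarrow> (nat \<times> nat \<Rightarrow> 'a::ab_group_add set) \<Rightarrow> nat \<times> nat \<Rightarrow> 'a \<Rightarrow> real" where
  "slot_degree k h G D p x = correlation (sumset ({1..h} - {snd p}) G)
     (\<lambda>y. real (row_completions h D p y) / real (card G) ^ (h - 2))
     (\<lambda>z. real (other_rows k h D p z) / real (card G) ^ ((k - 1) * (h - 1))) x / real (card G)"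

lemma slot_degree_fun_upd [simp]: "slot_degree k h G (D(p := B)) p = slot_degree k h G D p"
  by (simp add: slot_degree_def fun_eq_iff)

lemma slot_degree_nonneg: "0 \<le> slot_degree k h G D p x"
  unfolding slot_degree_def correlation_def by (intro divide_nonneg_nonneg sum_nonneg mult_nonneg_nonneg) auto

lemma card_solutions_eq_sum_slot_degree:
  fixes D :: "nat \<times> nat \<Rightarrow> 'a::ab_group_add set"
  assumes "2 \<le> h" and p: "p \<in> slots k h" and G: "finite G" "G \<noteq> {}" "\<And>q. D q \<subseteq> G"
  shows "real (card (solutions k h D)) = real (card G) ^ (k * (h - 1)) * (\<Sum>x\<in>D p. slot_degree k h G D p x)"
proof -
  define N where "N = real (card G)"
  define Y where "Y = sumset ({1..h} - {snd p}) G"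
  define Z where "Z = sumset {1..h} G"
  have "1 \<le> k" "fst p \<in> {1..k}" "snd p \<in> {1..h}" using p by auto
  have finite_D: "finite (D q)" for q using G finite_subset by blast
  have "0 < N" using G by (simp add: N_def card_gt_0_iff)
  have completions_outside: "row_completions h D p y = 0" if "y \<notin> Y" for y
    using representations_eq_empty[of "{1..h} - {snd p}" "\<lambda>i. D (fst p, i)" G y] that G(3)
    unfolding Y_def row_completions_def by simp
  have shift: "x + y \<in> Z" if "x \<in> D p" "y \<in> Y" for x y
    using that G(3)[of p] \<open>snd p \<in> {1..h}\<close> unfolding Y_def Z_def by (intro add_mem_sumset[of _ "snd p"]) auto
  have "real (card (solutions k h D))
      = (\<Sum>z\<in>Z. real (card (representations {1..h} (\<lambda>i. D (fst p, i)) z)) * real (other_rows k h D p z))"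
    using card_solutions[OF \<open>1 \<le> k\<close> G(1), of h D] G(3) \<open>fst p \<in> {1..k}\<close>
    by (simp add: Z_def other_rows_def prod.remove)
  also have "\<dots> = (\<Sum>z\<in>Z. \<Sum>x\<in>D p. real (row_completions h D p (z - x)) * real (other_rows k h D p z))"
    using card_representations_remove[of "{1..h}" "snd p" "\<lambda>i. D (fst p, i)"] \<open>snd p \<in> {1..h}\<close> finite_D
    by (simp add: row_completions_def sum_distrib_right)
  also have "\<dots> = (\<Sum>x\<in>D p. \<Sum>z\<in>Z. real (row_completions h D p (z - x)) * real (other_rows k h D p z))"
    by (rule sum.swap)
  also have "\<dots> = (\<Sum>x\<in>D p. correlation Y (row_completions h D p) (other_rows k h D p) x)"
    using G(1) shift completions_outside
    by (intro sum.cong correlation_eq_sum_translate[symmetric]) (auto simp: Z_def finite_sumset)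
  also have "\<dots> = N ^ (k * (h - 1)) * (\<Sum>x\<in>D p. slot_degree k h G D p x)"
  proof -
    obtain k' h' where "k = Suc k'" "h = 2 + h'" using \<open>1 \<le> k\<close> \<open>2 \<le> h\<close> by (metis le_Suc_ex plus_1_eq_Suc)
    then have "N ^ (k * (h - 1)) = N ^ (h - 2) * N ^ ((k - 1) * (h - 1)) * N"
      by (simp add: power_add)
    then show ?thesis
      using \<open>0 < N\<close> by (simp add: slot_degree_def correlation_def N_def Y_def sum_distrib_left sum_divide_distrib)
  qed
  finally show ?thesis by (simp add: N_def)
qed

section \<open>Containers for solution-free families\<close>

definition small_sumset :: "nat \<Rightarrow> real \<Rightarrow> 'a::comm_monoid_add set \<Rightarrow> bool" where
  "small_sumset h K G \<longleftrightarrow> real (card (sumset {1..h} G)) \<le> K * real (card G)"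

definition few_solutions ::
  "nat \<Rightarrow> nat \<Rightarrow> real \<Rightarrow> 'a set \<Rightarrow> (nat \<times> nat \<Rightarrow> 'a::comm_monoid_add set) \<Rightarrow> bool" where
  "few_solutions k h \<eta> G D \<longleftrightarrow> real (card (solutions k h D)) \<le> \<eta> * real (card G) ^ (k * (h - 1) + 1)"

definition slot_degree_net ::
  "nat \<Rightarrow> nat \<Rightarrow> real \<Rightarrow> 'a set \<Rightarrow> nat \<times> nat \<Rightarrow> ('a::ab_group_add \<Rightarrow> real) set \<Rightarrow> bool" where
  "slot_degree_net k h \<epsilon> G p \<N> \<longleftrightarrow> (\<forall>D. (\<forall>q. D q \<subseteq> G) \<longrightarrow>
     (\<exists>g\<in>\<N>. (\<Sum>x\<in>G. \<bar>g x - slot_degree k h G D p x\<bar>) \<le> \<epsilon> * real (card G)))"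

lemma slot_degree_net_of_correlation_net:
  assumes "2 \<le> h" "p \<in> slots k h" "finite G" "G \<noteq> {}"
    and net: "correlation_net \<epsilon> G (sumset ({1..h} - {snd p}) G) (sumset {1..h} G) \<N>"
  shows "slot_degree_net k h \<epsilon> G p \<N>"
  unfolding slot_degree_net_def
proof (intro allI impI)
  fix D :: "nat \<times> nat \<Rightarrow> 'a set"
  assume "\<forall>q. D q \<subseteq> G"
  then have D: "\<And>q. D q \<subseteq> G" by blast
  have card_G: "0 < real (card G)" using assms(3,4) by (simp add: card_gt_0_iff)
  define f where "f y = real (row_completions h D p y) / real (card G) ^ (h - 2)" for y
  define W where "W z = real (other_rows k h D p z) / real (card G) ^ ((k - 1) * (h - 1))" for z
  have "f y \<in> {0..1}" for y
    using row_completions_le[OF assms(1-3) D, where y = y] card_G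
    unfolding f_def by (simp add: divide_le_eq flip: of_nat_power)
  moreover have "W z \<in> {0..1}" for z
    using other_rows_le[OF _ assms(2,3) D, where z = z] assms(1) card_G
    unfolding W_def by (simp add: divide_le_eq flip: of_nat_power)
  ultimately show "\<exists>g\<in>\<N>. (\<Sum>x\<in>G. \<bar>g x - slot_degree k h G D p x\<bar>) \<le> \<epsilon> * real (card G)"
    using net unfolding correlation_net_def slot_degree_def f_def W_def by blast
qed

lemma exists_small_slot_degree_net:
  fixes \<epsilon> b K :: real
  assumes "2 \<le> h" "p \<in> slots k h" "1 \<le> K" "0 < \<epsilon>" "1 < b"
  shows "\<forall>\<^sub>F G :: 'a::ab_group_add set in large_sets (small_sumset h K).
    (\<exists>\<N>. finite \<N> \<and> real (card \<N>) \<le> b ^ card G \<and> slot_degree_net k h \<epsilon> G p \<N>)"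
  using exists_small_correlation_net[OF assms(3-5)] eventually_large_sets[of "small_sumset h K" 1]
proof eventually_elim
  case (elim G)
  define Y where "Y = sumset ({1..h} - {snd p}) G"
  define Z where "Z = sumset {1..h} G"
  have "finite G" "G \<noteq> {}" "snd p \<in> {1..h}" using elim(2) assms(2) by auto
  then have "finite Y" "finite Z" "card Y \<le> card Z" "\<forall>x\<in>G. \<forall>y\<in>Y. x + y \<in> Z"
    unfolding Y_def Z_def by (auto intro: finite_sumset card_sumset_remove_le add_mem_sumset)
  moreover have "real (card Z) \<le> K * real (card G)"
    using elim(2) by (simp add: small_sumset_def Z_def)
  ultimately have "\<exists>\<N>. finite \<N> \<and> real (card \<N>) \<le> b ^ card G \<and> correlation_net \<epsilon> G Y Z \<N>"
    using elim(1)[THEN spec[of _ Y], THEN spec[of _ Z]] by force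
  then show ?case
    using slot_degree_net_of_correlation_net[OF assms(1,2) \<open>finite G\<close> \<open>G \<noteq> {}\<close>]
    unfolding Y_def Z_def by blast
qed

lemma card_superlevel_le:
  fixes g u :: "'a \<Rightarrow> real"
  assumes "finite G" "D \<subseteq> G" "\<And>x. 0 \<le> u x" "(\<Sum>x\<in>G. \<bar>g x - u x\<bar>) \<le> \<epsilon>"
  shows "real (card (D - {x \<in> G. g x \<le> \<tau>})) * \<tau> \<le> (\<Sum>x\<in>D. u x) + \<epsilon>"
proof -
  define D' where "D' = D - {x \<in> G. g x \<le> \<tau>}"
  have "D' \<subseteq> D" "D' \<subseteq> G" "finite D" using assms(1,2) finite_subset by (auto simp: D'_def)
  have "real (card D') * \<tau> \<le> (\<Sum>x\<in>D'. g x)"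
    using assms(2) by (intro sum_bounded_below[where K = \<tau>, simplified]) (auto simp: D'_def)
  also have "\<dots> \<le> (\<Sum>x\<in>D'. u x + \<bar>g x - u x\<bar>)" by (intro sum_mono) linarith
  also have "\<dots> = (\<Sum>x\<in>D'. u x) + (\<Sum>x\<in>D'. \<bar>g x - u x\<bar>)" by (rule sum.distrib)
  also have "(\<Sum>x\<in>D'. u x) \<le> (\<Sum>x\<in>D. u x)"
    using \<open>D' \<subseteq> D\<close> \<open>finite D\<close> assms(3) by (intro sum_mono2) auto
  also have "(\<Sum>x\<in>D'. \<bar>g x - u x\<bar>) \<le> (\<Sum>x\<in>G. \<bar>g x - u x\<bar>)"
    using \<open>D' \<subseteq> G\<close> assms(1) by (intro sum_mono2) auto
  finally show ?thesis using assms(4) by (simp add: D'_def)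
qed

lemma sum_sublevel_le:
  fixes g u :: "'a \<Rightarrow> real"
  assumes "finite G" "0 \<le> \<tau>" "(\<Sum>x\<in>G. \<bar>g x - u x\<bar>) \<le> \<epsilon>"
  shows "(\<Sum>x | x \<in> G \<and> g x \<le> \<tau>. u x) \<le> \<tau> * real (card G) + \<epsilon>"
proof -
  define E where "E = {x \<in> G. g x \<le> \<tau>}"
  have "E \<subseteq> G" by (auto simp: E_def)
  have "(\<Sum>x\<in>E. u x) \<le> (\<Sum>x\<in>E. \<tau> + \<bar>g x - u x\<bar>)"
    by (intro sum_mono) (auto simp: E_def)
  also have "\<dots> = \<tau> * real (card E) + (\<Sum>x\<in>E. \<bar>g x - u x\<bar>)" by (simp add: sum.distrib)
  also have "\<dots> \<le> \<tau> * real (card G) + (\<Sum>x\<in>G. \<bar>g x - u x\<bar>)"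
    using \<open>E \<subseteq> G\<close> assms(1,2) by (intro add_mono mult_left_mono of_nat_mono card_mono sum_mono2) auto
  finally show ?thesis using assms(3) by (simp add: E_def)
qed

lemma close_slot:
  fixes k h :: nat and G :: "'a::ab_group_add set" and D p g \<epsilon> \<tau> \<eta> \<eta>'
  defines "u \<equiv> slot_degree k h G D p"
  assumes h: "2 \<le> h" and p: "p \<in> slots k h" and G: "finite G" "G \<noteq> {}" and D: "\<And>q. D q \<subseteq> G"
    and few: "few_solutions k h \<eta>' G D"
    and g: "(\<Sum>x\<in>G. \<bar>g x - u x\<bar>) \<le> \<epsilon> * real (card G)"
    and \<tau>: "0 < \<tau>" and \<eta>: "\<eta>' + \<epsilon> \<le> \<eta> * \<tau>" "\<tau> + \<epsilon> \<le> \<eta>"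
  defines "E \<equiv> {x \<in> G. g x \<le> \<tau>}"
  shows "real (card (D p - E)) \<le> \<eta> * real (card G)" and "few_solutions k h \<eta> G (D(p := E))"
proof -
  define N where "N = real (card G)"
  have N: "0 < N" using G by (simp add: N_def card_gt_0_iff)
  have "N ^ (k * (h - 1)) * (\<Sum>x\<in>D p. u x) \<le> N ^ (k * (h - 1)) * (\<eta>' * N)"
    using few card_solutions_eq_sum_slot_degree[OF h p G D]
    by (simp add: few_solutions_def u_def N_def mult_ac)
  then have "(\<Sum>x\<in>D p. u x) \<le> \<eta>' * N" using N by (simp add: mult_le_cancel_left)
  moreover have "real (card (D p - E)) * \<tau> \<le> (\<Sum>x\<in>D p. u x) + \<epsilon> * N"
    using card_superlevel_le[OF G(1) D _ g] slot_degree_nonneg unfolding u_def E_def N_def by blast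
  ultimately have "real (card (D p - E)) * \<tau> \<le> (\<eta>' + \<epsilon>) * N" by (simp add: algebra_simps)
  also have "\<dots> \<le> (\<eta> * \<tau>) * N" using \<eta>(1) N by (intro mult_right_mono) auto
  finally have "\<tau> * real (card (D p - E)) \<le> \<tau> * (\<eta> * N)" by (simp add: mult_ac)
  then show "real (card (D p - E)) \<le> \<eta> * real (card G)" using \<tau> by (simp add: N_def)
  have "(\<Sum>x\<in>E. u x) \<le> (\<tau> + \<epsilon>) * N"
    using sum_sublevel_le[OF G(1) less_imp_le[OF \<tau>] g] by (simp add: E_def N_def algebra_simps)
  also have "\<dots> \<le> \<eta> * N" using \<eta>(2) N by (intro mult_right_mono) auto
  finally have "N ^ (k * (h - 1)) * (\<Sum>x\<in>E. u x) \<le> N ^ (k * (h - 1)) * (\<eta> * N)"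
    using N by (intro mult_left_mono) auto
  moreover have "(D(p := E)) q \<subseteq> G" for q using D by (auto simp: E_def)
  ultimately show "few_solutions k h \<eta> G (D(p := E))"
    using card_solutions_eq_sum_slot_degree[OF h p G, of "D(p := E)"]
    by (simp add: few_solutions_def u_def N_def mult_ac)
qed

definition captures_solution_free ::
  "nat \<Rightarrow> nat \<Rightarrow> (nat \<times> nat) set \<Rightarrow> real \<Rightarrow> 'a set \<Rightarrow> (nat \<times> nat \<Rightarrow> 'a::comm_monoid_add set set) \<Rightarrow> bool" where
  "captures_solution_free k h S \<eta> G \<S> \<longleftrightarrow>
    (\<forall>D. (\<forall>q. D q \<subseteq> G) \<longrightarrow> solutions k h D = {} \<longrightarrow>
      (\<exists>F. (\<forall>q. F q \<subseteq> G) \<and> (\<forall>p. p \<notin> S \<longrightarrow> F p = D p) \<and> few_solutions k h \<eta> G F \<and>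
        (\<forall>p\<in>S. F p \<in> \<S> p \<and> real (card (D p - F p)) \<le> \<eta> * real (card G))))"

lemma captures_solution_free_insert:
  fixes \<S> :: "nat \<times> nat \<Rightarrow> 'a::ab_group_add set set"
  assumes h: "2 \<le> h" and p: "p \<in> slots k h" "p \<notin> S" and G: "finite G" "G \<noteq> {}"
    and captures: "captures_solution_free k h S \<eta>' G \<S>"
    and net: "slot_degree_net k h \<epsilon> G p \<N>"
    and "0 < \<tau>" "\<eta>' + \<epsilon> \<le> \<eta> * \<tau>" "\<tau> + \<epsilon> \<le> \<eta>" "\<eta>' \<le> \<eta>"
  shows "captures_solution_free k h (insert p S) \<eta> G (\<S>(p := (\<lambda>g. {x \<in> G. g x \<le> \<tau>}) ` \<N>))"
  unfolding captures_solution_free_def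
proof (intro allI impI)
  fix D :: "nat \<times> nat \<Rightarrow> 'a set"
  assume "\<forall>q. D q \<subseteq> G" "solutions k h D = {}"
  then obtain F where F: "\<And>q. F q \<subseteq> G" "\<And>q. q \<notin> S \<Longrightarrow> F q = D q" "few_solutions k h \<eta>' G F"
    "\<And>q. q \<in> S \<Longrightarrow> F q \<in> \<S> q" "\<And>q. q \<in> S \<Longrightarrow> real (card (D q - F q)) \<le> \<eta>' * real (card G)"
    using captures unfolding captures_solution_free_def by metis
  obtain g where g: "g \<in> \<N>" "(\<Sum>x\<in>G. \<bar>g x - slot_degree k h G F p x\<bar>) \<le> \<epsilon> * real (card G)"
    using net F(1) unfolding slot_degree_net_def by blast
  define E where "E = {x \<in> G. g x \<le> \<tau>}"
  note closed = close_slot[OF h p(1) G F(1,3) g(2) assms(8-10), folded E_def]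
  have "\<eta>' * real (card G) \<le> \<eta> * real (card G)" using assms(11) by (rule mult_right_mono) simp
  then have "real (card (D q - F q)) \<le> \<eta> * real (card G)" if "q \<in> S" for q
    using F(5)[OF that] by linarith
  then have "\<forall>q\<in>insert p S. (F(p := E)) q \<in> (\<S>(p := (\<lambda>g. {x \<in> G. g x \<le> \<tau>}) ` \<N>)) q \<and>
      real (card (D q - (F(p := E)) q)) \<le> \<eta> * real (card G)"
    using F(2,4) p(2) g(1) closed(1) by (auto simp: E_def)
  moreover have "\<forall>q. (F(p := E)) q \<subseteq> G" using F(1) by (auto simp: E_def)
  ultimately show "\<exists>F. (\<forall>q. F q \<subseteq> G) \<and> (\<forall>q. q \<notin> insert p S \<longrightarrow> F q = D q) \<and> few_solutions k h \<eta> G F \<and>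
      (\<forall>q\<in>insert p S. F q \<in> (\<S>(p := (\<lambda>g. {x \<in> G. g x \<le> \<tau>}) ` \<N>)) q \<and>
        real (card (D q - F q)) \<le> \<eta> * real (card G))"
    using F(2) closed(2) by (intro exI[of _ "F(p := E)"]) auto
qed

text \<open>The slots are closed up one at a time: the set in slot \<open>p\<close> is replaced by the sublevel set of
  the approximate number of completions, computed from the sets already replaced and the
  remaining original ones.\<close>

lemma captures_solution_free_slots:
  fixes \<eta> b K :: real
  assumes h: "2 \<le> h" and K: "1 \<le> K" and b: "1 < b" and "finite S" "S \<subseteq> slots k h" "0 < \<eta>"
  shows "\<forall>\<^sub>F G :: 'a::ab_group_add set in large_sets (small_sumset h K).
    (\<exists>\<S>. (\<forall>p\<in>S. finite (\<S> p) \<and> real (card (\<S> p)) \<le> b ^ card G) \<and> captures_solution_free k h S \<eta> G \<S>)"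
  using assms(4-6)
proof (induction S arbitrary: \<eta> rule: finite_induct)
  case empty
  have "few_solutions k h \<eta> G D" if "solutions k h D = {}" for G and D :: "nat \<times> nat \<Rightarrow> 'a set"
    using that empty.prems(2) by (simp add: few_solutions_def)
  then have "captures_solution_free k h {} \<eta> G \<S>" for G and \<S> :: "nat \<times> nat \<Rightarrow> 'a set set"
    unfolding captures_solution_free_def by blast
  then show ?case by simp
next
  case (insert p S)
  have p: "p \<in> slots k h" and S: "S \<subseteq> slots k h" using insert.prems(1) by auto
  define \<tau> where "\<tau> = \<eta> / 2"
  define \<epsilon> where "\<epsilon> = min (\<eta> / 2) (\<eta> * \<tau> / 2)"
  have pos: "0 < \<tau>" "0 < \<epsilon>" using insert.prems(2) by (simp_all add: \<tau>_def \<epsilon>_def)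
  have "\<epsilon> \<le> \<eta> * \<tau> / 2" "\<epsilon> \<le> \<eta> / 2" by (simp_all add: \<epsilon>_def)
  then have params: "\<epsilon> + \<epsilon> \<le> \<eta> * \<tau>" "\<tau> + \<epsilon> \<le> \<eta>" "\<epsilon> \<le> \<eta>"
    using insert.prems(2) by (simp_all add: \<tau>_def)
  show ?case
    using insert.IH[OF S pos(2)] exists_small_slot_degree_net[OF h p K pos(2) b]
      eventually_large_sets[of "small_sumset h K" 1]
  proof eventually_elim
    case (elim G)
    obtain \<S> where card_\<S>: "\<forall>p\<in>S. finite (\<S> p) \<and> real (card (\<S> p)) \<le> b ^ card G"
      and captures: "captures_solution_free k h S \<epsilon> G \<S>" using elim(1) by blast
    obtain \<N> where card_\<N>: "finite \<N>" "real (card \<N>) \<le> b ^ card G"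
      and net: "slot_degree_net k h \<epsilon> G p \<N>" using elim(2) by blast
    define \<T> where "\<T> = (\<lambda>g. {x \<in> G. g x \<le> \<tau>}) ` \<N>"
    have "card \<T> \<le> card \<N>" unfolding \<T>_def using card_\<N>(1) by (rule card_image_le)
    then have "finite \<T>" "real (card \<T>) \<le> b ^ card G" using card_\<N> by (simp_all add: \<T>_def)
    then have "\<forall>q\<in>insert p S. finite ((\<S>(p := \<T>)) q) \<and> real (card ((\<S>(p := \<T>)) q)) \<le> b ^ card G"
      using card_\<S> by simp
    moreover have "finite G" "G \<noteq> {}" using elim(3) by auto
    then have "captures_solution_free k h (insert p S) \<eta> G (\<S>(p := \<T>))"
      unfolding \<T>_def
      by (rule captures_solution_free_insert[OF h p insert.hyps(2) _ _ captures net pos(1) params])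
    ultimately show ?case by blast
  qed
qed

definition containers ::
  "nat \<Rightarrow> nat \<Rightarrow> real \<Rightarrow> 'a set \<Rightarrow> (nat \<times> nat \<Rightarrow> 'a::comm_monoid_add set) set \<Rightarrow> bool" where
  "containers k h \<eta> G \<C> \<longleftrightarrow>
    (\<forall>F\<in>\<C>. (\<forall>p\<in>slots k h. F p \<subseteq> G) \<and> few_solutions k h \<eta> G F) \<and>
    (\<forall>D. (\<forall>q. D q \<subseteq> G) \<longrightarrow> solutions k h D = {} \<longrightarrow>
      (\<exists>F\<in>\<C>. \<forall>p\<in>slots k h. real (card (D p - F p)) \<le> \<eta> * real (card G)))"

lemma containers_of_captures_solution_free:
  assumes "captures_solution_free k h (slots k h) \<eta> G \<S>"
  shows "containers k h \<eta> G
    {F \<in> Pi\<^sub>E (slots k h) \<S>. (\<forall>p\<in>slots k h. F p \<subseteq> G) \<and> few_solutions k h \<eta> G F}"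
    (is "containers k h \<eta> G ?\<C>")
proof -
  have "\<exists>F\<in>?\<C>. \<forall>p\<in>slots k h. real (card (D p - F p)) \<le> \<eta> * real (card G)"
    if D: "\<forall>q. D q \<subseteq> G" "solutions k h D = {}" for D
  proof -
    obtain F where F: "\<forall>q. F q \<subseteq> G" "few_solutions k h \<eta> G F"
      "\<forall>p\<in>slots k h. F p \<in> \<S> p \<and> real (card (D p - F p)) \<le> \<eta> * real (card G)"
      using assms[unfolded captures_solution_free_def, THEN spec, THEN mp, THEN mp, OF D] by blast
    define F' where "F' = restrict F (slots k h)"
    have "solutions k h F' = solutions k h F"
      by (intro equalityI solutions_mono) (auto simp: F'_def)
    then have "F' \<in> ?\<C>" using F by (auto simp: F'_def few_solutions_def)
    moreover have "\<forall>p\<in>slots k h. real (card (D p - F' p)) \<le> \<eta> * real (card G)"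
      using F(3) by (simp add: F'_def)
    ultimately show ?thesis by blast
  qed
  then show ?thesis unfolding containers_def by blast
qed

theorem solution_free_containers:
  fixes \<eta> b K :: real
  assumes "2 \<le> h" "1 \<le> K" "1 < b" "0 < \<eta>"
  shows "\<forall>\<^sub>F G :: 'a::ab_group_add set in large_sets (small_sumset h K).
    (\<exists>\<C>. finite \<C> \<and> real (card \<C>) \<le> b ^ card G \<and> containers k h \<eta> G \<C>)"
proof -
  define m where "m = Suc (k * h)"
  define b' where "b' = root m b"
  have "0 < m" by (simp add: m_def)
  then have b': "1 < b'" "b' ^ m = b" using assms(3) by (simp_all add: b'_def)
  have "finite (slots k h)" by simp
  from captures_solution_free_slots[OF assms(1,2) b'(1) this order_refl assms(4)] show ?thesis
  proof eventually_elim
    case (elim G)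
    then obtain \<S> where card_\<S>: "\<forall>p\<in>slots k h. finite (\<S> p) \<and> real (card (\<S> p)) \<le> b' ^ card G"
      and captures: "captures_solution_free k h (slots k h) \<eta> G \<S>" by blast
    define \<C> where "\<C> = {F \<in> Pi\<^sub>E (slots k h) \<S>. (\<forall>p\<in>slots k h. F p \<subseteq> G) \<and> few_solutions k h \<eta> G F}"
    have finite_PiE_\<S>: "finite (Pi\<^sub>E (slots k h) \<S>)" using card_\<S> by (intro finite_PiE) auto
    then have "finite \<C>" by (simp add: \<C>_def)
    have "real (card \<C>) \<le> real (card (Pi\<^sub>E (slots k h) \<S>))"
      using finite_PiE_\<S> by (intro of_nat_mono card_mono) (auto simp: \<C>_def)
    also have "\<dots> = (\<Prod>p\<in>slots k h. real (card (\<S> p)))" by (simp add: card_PiE)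
    also have "\<dots> \<le> (\<Prod>p\<in>slots k h. b' ^ card G)" using card_\<S> by (intro prod_mono) auto
    also have "\<dots> = (b' ^ (k * h)) ^ card G" by (simp add: card_cartesian_product mult.commute flip: power_mult)
    also have "\<dots> \<le> (b' ^ m) ^ card G" using b'(1) by (intro power_mono power_increasing) (auto simp: m_def)
    finally show ?case
      using \<open>finite \<C>\<close> containers_of_captures_solution_free[OF captures, folded \<C>_def] b'(2) by blast
  qed
qed

section \<open>Templates of lists of colors\<close>

definition arrangements :: "nat \<Rightarrow> nat \<Rightarrow> nat \<Rightarrow> (nat \<times> nat \<Rightarrow> nat) set" where
  "arrangements k h r = {a \<in> slots k h \<rightarrow>\<^sub>E {1..r}. inj_on a (slots k h)}"

lemma finite_arrangements: "finite (arrangements k h r)"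
proof -
  have "finite (slots k h \<rightarrow>\<^sub>E {1..r})" by (intro finite_PiE) auto
  then show ?thesis by (simp add: arrangements_def)
qed

lemma exists_arrangement:
  assumes "1 \<le> h" "K \<subseteq> {1..r}" "J \<subseteq> {1..r}" "K \<inter> J = {}" "card K = k" "card J = k * (h - 1)"
  shows "\<exists>a\<in>arrangements k h r. (\<forall>l\<in>{1..k}. a (l, 1) \<in> K) \<and> (\<forall>l\<in>{1..k}. \<forall>i\<in>{2..h}. a (l, i) \<in> J)"
proof -
  define first where "first = {1..k} \<times> {1::nat}"
  define rest where "rest = {1..k} \<times> {2..h}"
  have "finite K" "finite J" using assms(2,3) finite_subset by blast+
  then obtain f g where f: "bij_betw f first K" and g: "bij_betw g rest J"
    using finite_same_card_bij[of first K] finite_same_card_bij[of rest J] assms(5,6)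
    by (auto simp: first_def rest_def card_cartesian_product)
  define a where "a = restrict (\<lambda>p. if p \<in> first then f p else g p) (slots k h)"
  have slots_split: "slots k h = first \<union> rest" using assms(1) by (auto simp: first_def rest_def)
  have disjoint: "first \<inter> rest = {}" by (auto simp: first_def rest_def)
  have bij: "bij_betw a (slots k h) (K \<union> J)"
    using bij_betw_disjoint_Un[OF f g disjoint assms(4)]
    unfolding a_def slots_split by (simp only: bij_betw_restrict_eq)
  have "a \<in> slots k h \<rightarrow>\<^sub>E {1..r}"
  proof (rule PiE_I)
    show "a p \<in> {1..r}" if "p \<in> slots k h" for p using bij_betwE[OF bij] that assms(2,3) by blast
  qed (simp add: a_def)
  then have "a \<in> arrangements k h r"
    using bij_betw_imp_inj_on[OF bij] by (simp add: arrangements_def)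
  moreover have "a p \<in> K" if "p \<in> first" for p
    using f that slots_split by (auto simp: a_def bij_betw_def)
  moreover have "a p \<in> J" if "p \<in> rest" for p
    using g that slots_split disjoint by (auto simp: a_def bij_betw_def)
  ultimately show ?thesis by (intro bexI[of _ a]) (auto simp: first_def rest_def)
qed

lemma color_classes_solution_free:
  assumes c: "c \<in> rainbow_free_colorings k h r A" and a: "a \<in> arrangements k h r"
  shows "solutions k h (\<lambda>p. {x \<in> A. c x = a p}) = {}"
proof (rule ccontr)
  assume "\<not> ?thesis"
  then obtain x where x: "x \<in> solutions k h (\<lambda>p. {x \<in> A. c x = a p})" by blast
  then have x_PiE: "x \<in> (\<Pi>\<^sub>E l\<in>{1..k}. \<Pi>\<^sub>E i\<in>{1..h}. {x \<in> A. c x = a (l, i)})"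
    unfolding solutions_def by blast
  have x_color: "x l i \<in> A" "c (x l i) = a (l, i)" if "l \<in> {1..k}" "i \<in> {1..h}" for l i
    using PiE_mem[OF PiE_mem[OF x_PiE that(1)] that(2)] by auto
  have "B_solution k h A x"
    using x x_color(1) unfolding B_solution_def solutions_def by blast
  moreover have "rainbow k h c x"
  proof -
    have "inj_on (\<lambda>(l, i). c (x l i)) (slots k h) \<longleftrightarrow> inj_on a (slots k h)"
      using x_color(2) by (intro inj_on_cong) auto
    then show ?thesis using a by (simp add: rainbow_def arrangements_def)
  qed
  ultimately show False using c by (auto simp: rainbow_free_colorings_def)
qed

lemma few_solutions_imp_small_column:
  fixes F :: "nat \<times> nat \<Rightarrow> 'a::ab_group_add set" and \<delta> \<eta> K :: real
  assumes "1 \<le> k" "1 \<le> h" and G: "finite G" "G \<noteq> {}" and "0 < \<delta>"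
    and sumset: "small_sumset h K G" and few: "few_solutions k h \<eta> G F"
    and F: "\<And>p. p \<in> slots k h \<Longrightarrow> F p \<subseteq> G"
    and B: "\<And>l i. l \<in> {1..k} \<Longrightarrow> i \<in> {1..h} \<Longrightarrow> B i \<subseteq> F (l, i)"
    and \<eta>: "\<eta> * K ^ (k - 1) < \<delta> ^ (k * h)"
  shows "\<exists>i\<in>{1..h}. real (card (B i)) < \<delta> * real (card G)"
proof (rule ccontr)
  define N where "N = real (card G)"
  have N: "0 < N" using G by (simp add: N_def card_gt_0_iff)
  assume "\<not> ?thesis"
  then have large: "\<delta> * N \<le> real (card (B i))" if "i \<in> {1..h}" for i
    using that unfolding N_def by (meson not_less)
  have B_subset: "B i \<subseteq> G" if "i \<in> {1..h}" for i
    using B[of 1 i] F[of "(1, i)"] that \<open>1 \<le> k\<close> by auto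
  have finite_F: "finite (F p)" if "p \<in> slots k h" for p
    using F[OF that] G(1) by (rule finite_subset)
  have "\<delta> ^ (k * h) * N ^ (k * h) = ((\<delta> * N) ^ h) ^ k"
    by (simp add: power_mult_distrib mult.commute flip: power_mult)
  also have "(\<delta> * N) ^ h = (\<Prod>i=1..h. \<delta> * N)" by simp
  also have "\<dots> ^ k \<le> (\<Prod>i=1..h. real (card (B i))) ^ k"
    using large N \<open>0 < \<delta>\<close> by (intro power_mono prod_mono prod_nonneg) auto
  also have "\<dots> \<le> real (card (sumset {1..h} G)) ^ (k - 1) * real (card (solutions k h (\<lambda>q. B (snd q))))"
    using card_solutions_equal_rows_ge[OF \<open>1 \<le> k\<close> G B_subset] by simp
  also have "\<dots> \<le> (K * N) ^ (k - 1) * (\<eta> * N ^ (k * (h - 1) + 1))"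
  proof (rule mult_mono)
    show "real (card (sumset {1..h} G)) ^ (k - 1) \<le> (K * N) ^ (k - 1)"
      using sumset by (intro power_mono) (auto simp: small_sumset_def N_def)
    then show "0 \<le> (K * N) ^ (k - 1)" by (rule order_trans[rotated]) simp
    have "B (snd p) \<subseteq> F p" if "p \<in> slots k h" for p
      using B[of "fst p" "snd p"] that by (simp add: mem_Times_iff)
    then have "card (solutions k h (\<lambda>q. B (snd q))) \<le> card (solutions k h F)"
      using finite_F by (intro card_mono finite_solutions solutions_mono)
    then show "real (card (solutions k h (\<lambda>q. B (snd q)))) \<le> \<eta> * N ^ (k * (h - 1) + 1)"
      using few unfolding few_solutions_def N_def by linarith
  qed simp
  also have "\<dots> = \<eta> * K ^ (k - 1) * N ^ (k * h)"
  proof -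
    obtain k' h' where "k = Suc k'" "h = Suc h'" using \<open>1 \<le> k\<close> \<open>1 \<le> h\<close> by (metis Suc_le_D One_nat_def)
    then have "k * h = (k - 1) + (k * (h - 1) + 1)" by simp
    then show ?thesis by (simp only: power_mult_distrib power_add mult_ac)
  qed
  finally show False using \<eta> N by simp
qed

definition template ::
  "nat \<Rightarrow> nat \<Rightarrow> nat \<Rightarrow> ((nat \<times> nat \<Rightarrow> nat) \<Rightarrow> nat \<times> nat \<Rightarrow> 'a set) \<Rightarrow> 'a \<Rightarrow> nat set" where
  "template k h r \<Phi> x =
    {j \<in> {1..r}. \<forall>a\<in>arrangements k h r. \<forall>p\<in>slots k h. a p = j \<longrightarrow> x \<in> \<Phi> a p}"

lemma template_subset: "template k h r \<Phi> x \<subseteq> {1..r}"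
  by (auto simp: template_def)

definition outliers :: "('a \<Rightarrow> nat) \<Rightarrow> ('a \<Rightarrow> nat set) \<Rightarrow> 'a set \<Rightarrow> 'a set" where
  "outliers c P A = {x \<in> A. c x \<notin> P x}"

lemma outliers_subset: "outliers c P A \<subseteq> A"
  by (auto simp: outliers_def)

text \<open>The lists \<open>P\<close> admit few rainbow solutions of any color pattern.\<close>

definition sparse_lists :: "nat \<Rightarrow> nat \<Rightarrow> nat \<Rightarrow> real \<Rightarrow> 'a set \<Rightarrow> ('a \<Rightarrow> nat set) \<Rightarrow> bool" where
  "sparse_lists k h r t A P \<longleftrightarrow>
    (\<forall>a\<in>arrangements k h r. \<exists>i\<in>{1..h}. real (card {x \<in> A. \<forall>l\<in>{1..k}. a (l, i) \<in> P x}) < t)"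

lemma sparse_lists_template:
  fixes \<Phi> :: "(nat \<times> nat \<Rightarrow> nat) \<Rightarrow> nat \<times> nat \<Rightarrow> 'a::ab_group_add set"
  assumes "1 \<le> k" "1 \<le> h" "finite G" "G \<noteq> {}" "0 < \<delta>" "small_sumset h K G" "\<eta> * K ^ (k - 1) < \<delta> ^ (k * h)"
    and "containers k h \<eta> G \<C>" "\<Phi> \<in> arrangements k h r \<rightarrow> \<C>"
  shows "sparse_lists k h r (\<delta> * real (card G)) A (template k h r \<Phi>)"
  unfolding sparse_lists_def
proof
  fix a assume a: "a \<in> arrangements k h r"
  then have "\<Phi> a \<in> \<C>" using assms(9) by blast
  then have "few_solutions k h \<eta> G (\<Phi> a)" "\<And>p. p \<in> slots k h \<Longrightarrow> \<Phi> a p \<subseteq> G"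
    using assms(8) unfolding containers_def by blast+
  then show "\<exists>i\<in>{1..h}. real (card {x \<in> A. \<forall>l\<in>{1..k}. a (l, i) \<in> template k h r \<Phi> x}) < \<delta> * real (card G)"
    using a assms(7) by (intro few_solutions_imp_small_column[OF assms(1-6)]) (auto simp: template_def)
qed

lemma template_captures_coloring:
  assumes c: "c \<in> rainbow_free_colorings k h r A" and "A \<subseteq> G" "finite G"
    and containers: "containers k h \<eta> G \<C>"
  shows "\<exists>\<Phi>\<in>arrangements k h r \<rightarrow>\<^sub>E \<C>. real (card (outliers c (template k h r \<Phi>) A))
    \<le> real (card (arrangements k h r \<times> slots k h)) * (\<eta> * real (card G))"
proof -
  define D where "D a p = {x \<in> A. c x = a p}" for a :: "nat \<times> nat \<Rightarrow> nat" and p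
  have "\<exists>F\<in>\<C>. \<forall>p\<in>slots k h. real (card (D a p - F p)) \<le> \<eta> * real (card G)" if "a \<in> arrangements k h r" for a
  proof -
    have "solutions k h (D a) = {}" unfolding D_def using c that by (rule color_classes_solution_free)
    moreover have "\<forall>q. D a q \<subseteq> G" using \<open>A \<subseteq> G\<close> by (auto simp: D_def)
    ultimately show ?thesis using containers unfolding containers_def by blast
  qed
  then obtain F where F: "\<And>a. a \<in> arrangements k h r \<Longrightarrow> F a \<in> \<C>"
    "\<And>a p. a \<in> arrangements k h r \<Longrightarrow> p \<in> slots k h \<Longrightarrow> real (card (D a p - F a p)) \<le> \<eta> * real (card G)"
    by metis
  define \<Phi> where "\<Phi> = restrict F (arrangements k h r)"
  define I where "I = arrangements k h r \<times> slots k h"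
  have "finite I" by (simp add: I_def finite_arrangements)
  have "finite A" using assms(2,3) by (rule finite_subset)
  have "outliers c (template k h r \<Phi>) A \<subseteq> (\<Union>(a, p)\<in>I. D a p - F a p)"
  proof
    fix x assume x: "x \<in> outliers c (template k h r \<Phi>) A"
    then have "c x \<in> {1..r}"
      using c by (auto simp: rainbow_free_colorings_def outliers_def)
    then obtain a p where ap: "a \<in> arrangements k h r" "p \<in> slots k h" "a p = c x" "x \<notin> \<Phi> a p"
      using x unfolding template_def outliers_def by blast
    then have "x \<in> D a p - F a p" using x by (simp add: D_def \<Phi>_def outliers_def)
    then show "x \<in> (\<Union>(a, p)\<in>I. D a p - F a p)" using ap(1,2) unfolding I_def by blast
  qed
  then have "card (outliers c (template k h r \<Phi>) A) \<le> card (\<Union>(a, p)\<in>I. D a p - F a p)"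
    using \<open>finite A\<close> \<open>finite I\<close> by (intro card_mono) (auto simp: D_def)
  also have "\<dots> \<le> (\<Sum>(a, p)\<in>I. card (D a p - F a p))"
    using card_UN_le[OF \<open>finite I\<close>, of "\<lambda>(a, p). D a p - F a p"] by (simp add: case_prod_unfold)
  finally have "real (card (outliers c (template k h r \<Phi>) A)) \<le> (\<Sum>(a, p)\<in>I. real (card (D a p - F a p)))"
    by (simp add: case_prod_unfold flip: of_nat_sum)
  also have "\<dots> \<le> real (card I) * (\<eta> * real (card G))"
    using F(2) by (intro sum_bounded_above) (auto simp: I_def)
  finally show ?thesis
    using F(1) unfolding I_def by (intro bexI[of _ \<Phi>]) (auto simp: \<Phi>_def)
qed

section \<open>Sizes of sparse lists\<close>

definition palettes :: "nat \<Rightarrow> nat \<Rightarrow> nat set set" where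
  "palettes r q = {L. L \<subseteq> {1..r} \<and> card L = q}"

lemma finite_palettes: "finite (palettes r q)"
  by (simp add: palettes_def)

lemma finite_palette: "L \<in> palettes r q \<Longrightarrow> finite L"
  unfolding palettes_def using finite_subset by blast

lemma card_palettes: "card (palettes r q) = r choose q"
  unfolding palettes_def using n_subsets[of "{1..r}" q] by simp

lemma card_palettes_le: "card (palettes r q) \<le> 2 ^ r"
proof -
  have "card (palettes r q) \<le> card (Pow {1..r})"
    by (rule card_mono) (auto simp: palettes_def)
  then show ?thesis by (simp add: card_Pow)
qed

lemma card_UN_palettes_le:
  assumes "\<And>L. L \<in> palettes r q \<Longrightarrow> real (card (X L)) \<le> t" "0 \<le> t" "I \<subseteq> palettes r q"
  shows "real (card (\<Union>L\<in>I. X L)) \<le> 2 ^ r * t"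
proof -
  have "finite I" using assms(3) finite_palettes by (rule finite_subset)
  then have "real (card (\<Union>L\<in>I. X L)) \<le> (\<Sum>L\<in>I. real (card (X L)))"
    using card_UN_le[of I X] by (simp flip: of_nat_sum)
  also have "\<dots> \<le> real (card I) * t"
    using assms by (intro sum_bounded_above) auto
  also have "\<dots> \<le> 2 ^ r * t"
  proof (rule mult_right_mono[OF _ assms(2)])
    have "card I \<le> 2 ^ r" using card_mono[OF finite_palettes assms(3)] card_palettes_le by (rule order_trans)
    then show "real (card I) \<le> 2 ^ r" by (simp flip: of_nat_power)
  qed
  finally show ?thesis .
qed

lemma card_lists_gt_le:
  assumes "finite A" "\<And>x. P x \<subseteq> {1..r}" "0 \<le> t"
    and "\<And>S. S \<in> palettes r (Suc q) \<Longrightarrow> real (card {x \<in> A. S \<subseteq> P x}) \<le> t"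
  shows "real (card {x \<in> A. q < card (P x)}) \<le> 2 ^ r * t"
proof -
  have "\<exists>S\<in>palettes r (Suc q). S \<subseteq> P x" if large: "q < card (P x)" for x
  proof -
    obtain S where "S \<subseteq> P x" "card S = Suc q"
      using obtain_subset_with_card_n[of "Suc q" "P x"] large by auto
    then show ?thesis using assms(2)[of x] by (auto simp: palettes_def)
  qed
  then have "{x \<in> A. q < card (P x)} \<subseteq> (\<Union>S\<in>palettes r (Suc q). {x \<in> A. S \<subseteq> P x})" by blast
  then have "card {x \<in> A. q < card (P x)} \<le> card (\<Union>S\<in>palettes r (Suc q). {x \<in> A. S \<subseteq> P x})"
    using assms(1) by (intro card_mono finite_UN_I finite_palettes) auto
  moreover have "real (card (\<Union>S\<in>palettes r (Suc q). {x \<in> A. S \<subseteq> P x})) \<le> 2 ^ r * t"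
    using assms(3,4) by (intro card_UN_palettes_le[of r "Suc q"]) auto
  ultimately show ?thesis by linarith
qed

lemma card_lists_eq_le:
  assumes "finite A" "\<And>x. P x \<subseteq> {1..r}" "0 \<le> t" "u \<le> real (card A)"
    and one_popular: "\<And>L M. L \<in> palettes r q \<Longrightarrow> M \<in> palettes r q \<Longrightarrow> L \<noteq> M \<Longrightarrow>
      real (card {x \<in> A. P x = L}) \<le> t \<or> real (card {x \<in> A. P x = M}) \<le> t"
    and not_all: "\<And>L. L \<in> palettes r q \<Longrightarrow> real (card {x \<in> A. P x = L}) \<le> real (card A) - u"
  shows "real (card {x \<in> A. card (P x) = q}) \<le> real (card A) - u + 2 ^ r * t"
proof -
  define X where "X L = {x \<in> A. P x = L}" for L

  have cover: "{x \<in> A. card (P x) = q} = (\<Union>L\<in>palettes r q. X L)"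
    using assms(2) by (auto simp: palettes_def X_def)
  show ?thesis
  proof (cases "\<exists>L\<in>palettes r q. t < real (card (X L))")
    case True
    then obtain L where L: "L \<in> palettes r q" "t < real (card (X L))" by blast
    define X' where "X' M = (if M = L then {} else X M)" for M
    have "real (card (X' M)) \<le> t" if "M \<in> palettes r q" for M
      using one_popular[OF L(1) that] L(2) assms(3) by (auto simp: X'_def X_def)
    then have "real (card (\<Union>M\<in>palettes r q. X' M)) \<le> 2 ^ r * t"
      using assms(3) by (intro card_UN_palettes_le[of r q]) auto
    moreover have "card {x \<in> A. card (P x) = q} \<le> card (X L \<union> (\<Union>M\<in>palettes r q. X' M))"
      unfolding cover using assms(1) by (intro card_mono) (auto simp: X'_def X_def finite_palettes split: if_splits)
    moreover have "card (X L \<union> (\<Union>M\<in>palettes r q. X' M)) \<le> card (X L) + card (\<Union>M\<in>palettes r q. X' M)"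
      by (rule card_Un_le)
    ultimately show ?thesis using not_all[OF L(1)] unfolding X_def by linarith
  next
    case False
    then have "real (card (\<Union>L\<in>palettes r q. X L)) \<le> 2 ^ r * t"
      using assms(3) by (intro card_UN_palettes_le[of r q]) (auto simp: not_less)
    then show ?thesis unfolding cover using assms(4) by linarith
  qed
qed

lemma card_lists_lt_ge:
  assumes "finite A" "real (card {x \<in> A. q < card (P x)}) \<le> m"
    and "real (card {x \<in> A. card (P x) = q}) \<le> real (card A) - u + m"
  shows "u - 2 * m \<le> real (card {x \<in> A. card (P x) < q})"
proof -
  have "card A = card ({x \<in> A. q < card (P x)} \<union> {x \<in> A. card (P x) = q} \<union> {x \<in> A. card (P x) < q})"
    by (rule arg_cong[of _ _ card]) auto
  also have "\<dots> \<le> card {x \<in> A. q < card (P x)} + card {x \<in> A. card (P x) = q} + card {x \<in> A. card (P x) < q}"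
    by (meson add_mono card_Un_le order_refl order_trans)
  finally show ?thesis using assms by linarith
qed

lemma prod_list_sizes_le:
  assumes "finite A" "\<And>x. P x \<subseteq> {1..r}" "1 \<le> r" "2 \<le> q"
  shows "real (\<Prod>x\<in>A. max 1 (card (P x))) \<le> real r ^ card {x \<in> A. q < card (P x)} *
    (real q ^ card A * ((real q - 1) / real q) ^ card {x \<in> A. card (P x) < q})"
proof -
  define large where "large x = (if q < card (P x) then real r else 1)" for x
  define small where "small x = (if card (P x) < q then (real q - 1) / real q else 1)" for x
  have "real (\<Prod>x\<in>A. max 1 (card (P x))) \<le> (\<Prod>x\<in>A. large x * (real q * small x))"
    unfolding of_nat_prod
  proof (intro prod_mono conjI)
    fix x
    have "card (P x) \<le> r" using card_mono[OF _ assms(2)[of x]] by simp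
    moreover have "real r \<le> real r * real q" using assms(4) mult_left_mono[of 1 "real q" "real r"] by simp
    ultimately have "real (card (P x)) \<le> real r * real q" by linarith
    then show "real (max 1 (card (P x))) \<le> large x * (real q * small x)"
      using assms(4) by (auto simp: large_def small_def max_def)
  qed simp
  also have "\<dots> = (\<Prod>x\<in>A. large x) * ((\<Prod>x\<in>A. real q) * (\<Prod>x\<in>A. small x))"
    by (simp add: prod.distrib)
  also have "(\<Prod>x\<in>A. large x) = real r ^ card {x \<in> A. q < card (P x)}"
    unfolding large_def using assms(1) by (simp add: prod.If_cases Int_def)
  also have "(\<Prod>x\<in>A. small x) = ((real q - 1) / real q) ^ card {x \<in> A. card (P x) < q}"
    unfolding small_def using assms(1) by (simp add: prod.If_cases Int_def)
  finally show ?thesis by simp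
qed

lemma sparse_listsD:
  assumes sparse: "sparse_lists k h r t A P" and "finite A" and a: "a \<in> arrangements k h r"
    and columns: "\<And>l. l \<in> {1..k} \<Longrightarrow> a (l, 1) \<in> M" "\<And>l i. l \<in> {1..k} \<Longrightarrow> i \<in> {2..h} \<Longrightarrow> a (l, i) \<in> L"
  shows "real (card {x \<in> A. L \<subseteq> P x}) < t \<or> real (card {x \<in> A. M \<subseteq> P x}) < t"
proof -
  obtain i where i: "i \<in> {1..h}" "real (card {x \<in> A. \<forall>l\<in>{1..k}. a (l, i) \<in> P x}) < t"
    using sparse a unfolding sparse_lists_def by blast
  have column_bound: "real (card {x \<in> A. S \<subseteq> P x}) < t" if "\<And>l. l \<in> {1..k} \<Longrightarrow> a (l, i) \<in> S" for S
  proof -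
    have "card {x \<in> A. S \<subseteq> P x} \<le> card {x \<in> A. \<forall>l\<in>{1..k}. a (l, i) \<in> P x}"
      using \<open>finite A\<close> that by (intro card_mono) auto
    then show ?thesis using i(2) by linarith
  qed
  show ?thesis
  proof (cases "i = 1")
    case True
    then show ?thesis using column_bound[of M] columns(1) by simp
  next
    case False
    then show ?thesis using column_bound[of L] columns(2) i(1) by simp
  qed
qed

lemma sparse_lists_card_superset_less:
  assumes "sparse_lists k h r t A P" "finite A" "1 \<le> h" "S \<in> palettes r (k * h)"
  shows "real (card {x \<in> A. S \<subseteq> P x}) < t"
proof -
  have S: "S \<subseteq> {1..r}" "card S = k * h" "finite S"
    using assms(4) finite_palette[OF assms(4)] by (auto simp: palettes_def)
  obtain K where K: "K \<subseteq> S" "card K = k"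
    using obtain_subset_with_card_n[of k S] S(2) assms(3) by auto
  have "card (S - K) = k * (h - 1)"
    using S K finite_subset[OF K(1)] by (simp add: card_Diff_subset diff_mult_distrib2)
  then obtain a where "a \<in> arrangements k h r" "\<forall>l\<in>{1..k}. a (l, 1) \<in> K"
    "\<forall>l\<in>{1..k}. \<forall>i\<in>{2..h}. a (l, i) \<in> S - K"
    using exists_arrangement[of h K r "S - K" k] S K assms(3) by blast
  then show ?thesis using sparse_listsD[OF assms(1,2), of a S S] K(1) by blast
qed

lemma sparse_lists_one_popular:
  assumes "sparse_lists k h r t A P" "finite A" "1 \<le> k" "2 \<le> h"
    and L: "L \<in> palettes r (k * h - 1)" and M: "M \<in> palettes r (k * h - 1)" and "L \<noteq> M"
  shows "real (card {x \<in> A. L \<subseteq> P x}) < t \<or> real (card {x \<in> A. M \<subseteq> P x}) < t"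
proof -
  have fin: "finite L" "finite M" using L M by (auto intro: finite_palette)
  have card_LM: "card L = k * h - 1" "card M = k * h - 1" and subset_LM: "L \<subseteq> {1..r}" "M \<subseteq> {1..r}"
    using L M by (auto simp: palettes_def)
  have "\<not> M \<subseteq> L" using card_subset_eq[OF fin(1), of M] card_LM \<open>L \<noteq> M\<close> by auto
  then obtain b where b: "b \<in> M" "b \<notin> L" by blast
  have "k * 2 \<le> k * h" using \<open>2 \<le> h\<close> by (rule mult_le_mono2)
  moreover have "card (M - {b}) = k * h - 2" using card_LM b(1) fin by simp
  ultimately have "k - 1 \<le> card (M - {b})" using \<open>1 \<le> k\<close> by linarith
  then obtain K' where K': "K' \<subseteq> M - {b}" "card K' = k - 1" by (meson obtain_subset_with_card_n)
  define K where "K = insert b K'"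
  have "finite K'" using K'(1) fin finite_subset by blast
  then have K: "K \<subseteq> M" "card K = k" using K' b(1) \<open>1 \<le> k\<close> by (auto simp: K_def card_insert_if)
  have "card L \<le> card (L - K) + card K'"
    using b fin \<open>finite K'\<close> card_Un_le[of "L - K" K'] card_mono[of "(L - K) \<union> K'" L]
    by (force simp: K_def)
  then have "k * (h - 1) \<le> card (L - K)" using K'(2) card_LM \<open>1 \<le> k\<close> by (simp add: diff_mult_distrib2)
  then obtain J where J: "J \<subseteq> L - K" "card J = k * (h - 1)" by (meson obtain_subset_with_card_n)
  have "1 \<le> h" "K \<subseteq> {1..r}" "J \<subseteq> {1..r}" "K \<inter> J = {}"
    using \<open>2 \<le> h\<close> K(1) J(1) subset_LM by auto
  then obtain a where "a \<in> arrangements k h r" "\<forall>l\<in>{1..k}. a (l, 1) \<in> K" "\<forall>l\<in>{1..k}. \<forall>i\<in>{2..h}. a (l, i) \<in> J"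
    using exists_arrangement[of h K r J k] K(2) J(2) by blast
  then show ?thesis using sparse_listsD[OF assms(1,2), of a M L] J(1) K(1) by blast
qed

section \<open>Colorings far from every palette\<close>

lemma real_card_eq_sum_fibers:
  assumes "finite C" "finite I" "f ` C \<subseteq> I"
  shows "real (card C) = (\<Sum>i\<in>I. real (card {c \<in> C. f c = i}))"
  using sum.group[OF assms, of "\<lambda>_. 1::real"] by simp

lemma card_colorings_with_outliers_le:
  assumes "finite A" "\<And>x. finite (P x)" "E \<subseteq> A"
  shows "card {c \<in> A \<rightarrow>\<^sub>E {1..r}. outliers c P A = E} \<le> r ^ card E * (\<Prod>x\<in>A. max 1 (card (P x)))"
proof -
  define C where "C = Pi\<^sub>E A (\<lambda>x. if x \<in> E then {1..r} else P x)"
  have "finite C" unfolding C_def using assms(1,2) by (intro finite_PiE) auto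
  moreover have "{c \<in> A \<rightarrow>\<^sub>E {1..r}. outliers c P A = E} \<subseteq> C"
    by (auto simp: C_def outliers_def PiE_iff extensional_def)
  ultimately have "card {c \<in> A \<rightarrow>\<^sub>E {1..r}. outliers c P A = E} \<le> card C" by (rule card_mono)
  also have "\<dots> = (\<Prod>x\<in>A. card (if x \<in> E then {1..r} else P x))"
    unfolding C_def using assms(1) by (rule card_PiE)
  also have "\<dots> \<le> (\<Prod>x\<in>A. (if x \<in> E then r else 1) * max 1 (card (P x)))"
    by (intro prod_mono) auto
  also have "\<dots> = r ^ card E * (\<Prod>x\<in>A. max 1 (card (P x)))"
    using assms(1,3) by (simp add: prod.distrib prod.If_cases Int_absorb1)
  finally show ?thesis .
qed

lemma card_colorings_few_outliers_le:
  assumes "finite A" "\<And>x. finite (P x)"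
  shows "real (card {c \<in> A \<rightarrow>\<^sub>E {1..r}. real (card (outliers c P A)) \<le> t})
    \<le> (\<Sum>E | E \<subseteq> A \<and> real (card E) \<le> t. real r ^ card E) * real (\<Prod>x\<in>A. max 1 (card (P x)))"
proof -
  define C where "C = {c \<in> A \<rightarrow>\<^sub>E {1..r}. real (card (outliers c P A)) \<le> t}"
  define \<E> where "\<E> = {E. E \<subseteq> A \<and> real (card E) \<le> t}"
  have "finite (A \<rightarrow>\<^sub>E {1..r})" using assms(1) by (intro finite_PiE) auto
  then have finite_C: "finite C" by (simp add: C_def)
  have "(\<lambda>c. outliers c P A) ` C \<subseteq> \<E>"
    by (rule image_subsetI) (simp add: C_def \<E>_def outliers_subset)
  then have "real (card C) = (\<Sum>E\<in>\<E>. real (card {c \<in> C. outliers c P A = E}))"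
    using finite_C assms(1) by (intro real_card_eq_sum_fibers) (auto simp: \<E>_def)
  also have "\<dots> \<le> (\<Sum>E\<in>\<E>. real (r ^ card E * (\<Prod>x\<in>A. max 1 (card (P x)))))"
  proof (rule sum_mono)
    fix E assume "E \<in> \<E>"
    have "card {c \<in> C. outliers c P A = E} \<le> card {c \<in> A \<rightarrow>\<^sub>E {1..r}. outliers c P A = E}"
      using \<open>finite (A \<rightarrow>\<^sub>E {1..r})\<close> by (intro card_mono) (auto simp: C_def)
    also have "\<dots> \<le> r ^ card E * (\<Prod>x\<in>A. max 1 (card (P x)))"
      using assms \<open>E \<in> \<E>\<close> by (intro card_colorings_with_outliers_le) (auto simp: \<E>_def)
    finally show "real (card {c \<in> C. outliers c P A = E}) \<le> real (r ^ card E * (\<Prod>x\<in>A. max 1 (card (P x))))"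
      by (rule of_nat_mono)
  qed
  also have "\<dots> = (\<Sum>E\<in>\<E>. real r ^ card E) * real (\<Prod>x\<in>A. max 1 (card (P x)))"
    by (simp add: sum_distrib_right)
  finally show ?thesis by (simp add: C_def \<E>_def)
qed

lemma card_colorings_captured_le:
  assumes "finite A" "finite \<F>" "C \<subseteq> A \<rightarrow>\<^sub>E {1..r}" "\<And>\<Phi> x. finite (P \<Phi> x)" "0 \<le> s"
    and captured: "\<And>c. c \<in> C \<Longrightarrow> \<exists>\<Phi>\<in>\<F>. real (card (outliers c (P \<Phi>) A)) \<le> t \<and>
      real (\<Prod>x\<in>A. max 1 (card (P \<Phi> x))) \<le> s"
  shows "real (card C) \<le> real (card \<F>) * ((\<Sum>E | E \<subseteq> A \<and> real (card E) \<le> t. real r ^ card E) * s)"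
proof -
  define near where "near \<Phi> = {c \<in> A \<rightarrow>\<^sub>E {1..r}. real (card (outliers c (P \<Phi>) A)) \<le> t}" for \<Phi>
  define \<F>' where "\<F>' = {\<Phi> \<in> \<F>. real (\<Prod>x\<in>A. max 1 (card (P \<Phi> x))) \<le> s}"
  define W where "W = (\<Sum>E | E \<subseteq> A \<and> real (card E) \<le> t. real r ^ card E)"
  have "finite \<F>'" using assms(2) by (simp add: \<F>'_def)
  have "finite (A \<rightarrow>\<^sub>E {1..r})" using assms(1) by (intro finite_PiE) auto
  then have "finite (near \<Phi>)" for \<Phi> by (simp add: near_def)
  moreover have "C \<subseteq> (\<Union>\<Phi>\<in>\<F>'. near \<Phi>)"
  proof
    fix c assume "c \<in> C"
    then have "c \<in> A \<rightarrow>\<^sub>E {1..r}" using assms(3) by blast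
    then show "c \<in> (\<Union>\<Phi>\<in>\<F>'. near \<Phi>)"
      using captured[OF \<open>c \<in> C\<close>] unfolding near_def \<F>'_def by auto
  qed
  ultimately have "card C \<le> card (\<Union>\<Phi>\<in>\<F>'. near \<Phi>)"
    using \<open>finite \<F>'\<close> by (intro card_mono) auto
  also have "\<dots> \<le> (\<Sum>\<Phi>\<in>\<F>'. card (near \<Phi>))" using \<open>finite \<F>'\<close> by (rule card_UN_le)
  finally have "real (card C) \<le> (\<Sum>\<Phi>\<in>\<F>'. real (card (near \<Phi>)))" by (simp flip: of_nat_sum)
  also have "\<dots> \<le> (\<Sum>\<Phi>\<in>\<F>'. W * s)"
  proof (rule sum_mono)
    fix \<Phi> assume "\<Phi> \<in> \<F>'"
    have "real (card (near \<Phi>)) \<le> W * real (\<Prod>x\<in>A. max 1 (card (P \<Phi> x)))"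
      unfolding near_def W_def using assms(1,4) by (rule card_colorings_few_outliers_le)
    also have "\<dots> \<le> W * s"
      using \<open>\<Phi> \<in> \<F>'\<close> by (intro mult_left_mono) (auto simp: \<F>'_def W_def sum_nonneg)
    finally show "real (card (near \<Phi>)) \<le> W * s" .
  qed
  also have "\<dots> = real (card \<F>') * (W * s)" by simp
  also have "\<dots> \<le> real (card \<F>) * (W * s)"
    using assms(2,5) by (intro mult_right_mono of_nat_mono card_mono) (auto simp: \<F>'_def W_def sum_nonneg)
  finally show ?thesis by (simp add: W_def)
qed

lemma card_list_eq_add_outliers_le:
  assumes "finite A"
  shows "card {x \<in> A. P x = L} + card (outliers c (\<lambda>_. L) A) \<le> card A + card (outliers c P A)"
proof -
  define X where "X = {x \<in> A. P x = L}"
  define Y where "Y = outliers c (\<lambda>_. L) A"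
  have "X \<subseteq> A" "Y \<subseteq> A" "X \<inter> Y \<subseteq> outliers c P A" by (auto simp: X_def Y_def outliers_def)
  then have "card (X \<union> Y) \<le> card A" "card (X \<inter> Y) \<le> card (outliers c P A)"
    using assms finite_subset[OF outliers_subset assms] by (auto intro!: card_mono)
  moreover have "card X + card Y = card (X \<union> Y) + card (X \<inter> Y)"
    using assms by (intro card_Un_Int) (auto simp: X_def Y_def outliers_def)
  ultimately show ?thesis unfolding X_def Y_def by linarith
qed

lemma finite_rainbow_free_colorings:
  assumes "finite A"
  shows "finite (rainbow_free_colorings k h r A)"
proof -
  have "finite (A \<rightarrow>\<^sub>E {1..r})" using assms by (intro finite_PiE) auto
  then show ?thesis by (simp add: rainbow_free_colorings_def)
qed

lemma exists_base_gt_1: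
  fixes \<kappa> :: real
  assumes "0 < \<kappa>" "\<kappa> < 1"
  obtains b where "1 < b" "b ^ m * \<kappa> < 1"
proof
  define b where "b = root (Suc m) (1 / \<kappa>)"
  show "1 < b" unfolding b_def using assms by (subst real_root_gt_1_iff) auto
  have "b ^ Suc m = 1 / \<kappa>" unfolding b_def using assms by (intro real_root_pow_pos2) auto
  then have "b ^ m * \<kappa> = 1 / b" using assms \<open>1 < b\<close> by (simp add: field_simps)
  then show "b ^ m * \<kappa> < 1" using \<open>1 < b\<close> by simp
qed

locale rainbow_parameters =
  fixes k h r :: nat
  assumes k_ge_2: "2 \<le> k" and h_ge_2: "2 \<le> h" and kh_le_r: "k * h \<le> r"
begin

definition q :: nat where
  "q = k * h - 1"

lemma q_ge_3: "3 \<le> q"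
  unfolding q_def using mult_le_mono[OF k_ge_2 h_ge_2] by linarith

lemma kh_eq_Suc_q: "k * h = Suc q"
  using q_ge_3 by (simp add: q_def)

lemma q_less_r: "q < r"
  using kh_le_r kh_eq_Suc_q by simp

lemma prod_sparse_list_sizes_le:
  assumes "finite A" and P: "\<And>x. P x \<subseteq> {1..r}" and sparse: "sparse_lists k h r t A P"
    and "0 \<le> t" "u \<le> real (card A)"
    and not_all: "\<And>L. L \<in> palettes r q \<Longrightarrow> real (card {x \<in> A. P x = L}) \<le> real (card A) - u"
  shows "real (\<Prod>x\<in>A. max 1 (card (P x)))
    \<le> real r powr (2 ^ r * t) * (real q ^ card A * ((real q - 1) / real q) powr (u - 2 * (2 ^ r * t)))"
proof -
  define large where "large = card {x \<in> A. q < card (P x)}"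
  define small where "small = card {x \<in> A. card (P x) < q}"
  define \<theta> where "\<theta> = (real q - 1) / real q"
  have \<theta>: "0 < \<theta>" "\<theta> \<le> 1" using q_ge_3 by (simp_all add: \<theta>_def)
  have "1 \<le> k" "1 \<le> h" using k_ge_2 h_ge_2 by simp_all
  have superset_less: "real (card {x \<in> A. S \<subseteq> P x}) \<le> t" if "S \<in> palettes r (Suc q)" for S
    using sparse_lists_card_superset_less[OF sparse \<open>finite A\<close> \<open>1 \<le> h\<close>, of S] that
    by (simp add: kh_eq_Suc_q)
  have eq_le_superset: "card {x \<in> A. P x = L} \<le> card {x \<in> A. L \<subseteq> P x}" for L
    using \<open>finite A\<close> by (intro card_mono) auto
  have one_popular: "real (card {x \<in> A. P x = L}) \<le> t \<or> real (card {x \<in> A. P x = M}) \<le> t"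
    if "L \<in> palettes r q" "M \<in> palettes r q" "L \<noteq> M" for L M
    using sparse_lists_one_popular[OF sparse \<open>finite A\<close> \<open>1 \<le> k\<close> h_ge_2, folded q_def, OF that]
      eq_le_superset[of L] eq_le_superset[of M] by linarith
  have large_le: "real large \<le> 2 ^ r * t"
    unfolding large_def using assms(1,4) P superset_less by (intro card_lists_gt_le)
  have "u - 2 * (2 ^ r * t) \<le> real small"
    unfolding small_def
    using card_lists_lt_ge[OF \<open>finite A\<close> large_le[unfolded large_def]]
      card_lists_eq_le[OF \<open>finite A\<close> P assms(4,5) one_popular not_all] by blast
  then have "\<theta> ^ small \<le> \<theta> powr (u - 2 * (2 ^ r * t))"
    using \<theta> by (simp add: powr_mono' flip: powr_realpow)
  moreover have "real r ^ large \<le> real r powr (2 ^ r * t)"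
    using large_le q_less_r by (simp add: powr_mono flip: powr_realpow)
  ultimately have "real r ^ large * (real q ^ card A * \<theta> ^ small)
      \<le> real r powr (2 ^ r * t) * (real q ^ card A * \<theta> powr (u - 2 * (2 ^ r * t)))"
    using \<theta> by (intro mult_mono mult_left_mono) auto
  moreover have "real (\<Prod>x\<in>A. max 1 (card (P x))) \<le> real r ^ large * (real q ^ card A * \<theta> ^ small)"
    unfolding large_def small_def \<theta>_def using assms(1) P q_ge_3 q_less_r by (intro prod_list_sizes_le) auto
  ultimately show ?thesis by (simp add: \<theta>_def)
qed

definition far_colorings :: "real \<Rightarrow> (int ^ 'd) set \<Rightarrow> (int ^ 'd \<Rightarrow> nat) set" where
  "far_colorings t A =
    {c \<in> rainbow_free_colorings k h r A. \<forall>L\<in>palettes r q. t < real (card (outliers c (\<lambda>_. L) A))}"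

lemma prod_template_sizes_le_of_far:
  assumes "c \<in> far_colorings (\<beta> * N) A" and "finite A" and P: "\<And>x. P x \<subseteq> {1..r}"
    and "sparse_lists k h r (\<delta> * N) A P" "real (card (outliers c P A)) \<le> \<xi> * N"
    and "0 \<le> \<delta>" "0 \<le> \<xi>" "0 \<le> N" "\<xi> + 2 * 2 ^ r * \<delta> \<le> \<beta> / 2"
  shows "real (\<Prod>x\<in>A. max 1 (card (P x)))
    \<le> real r powr (2 ^ r * (\<delta> * N)) * (real q ^ card A * ((real q - 1) / real q) powr (\<beta> / 2 * N))"
proof -
  define \<theta> where "\<theta> = (real q - 1) / real q"
  define u where "u = \<beta> * N - \<xi> * N"
  have far: "\<beta> * N < real (card (outliers c (\<lambda>_. L) A))" if "L \<in> palettes r q" for L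
    using assms(1) that by (simp add: far_colorings_def)
  have not_all: "real (card {x \<in> A. P x = L}) \<le> real (card A) - u" if "L \<in> palettes r q" for L
    using far[OF that] card_list_eq_add_outliers_le[OF \<open>finite A\<close>, of P L c] assms(5)
    unfolding u_def by linarith
  have "palettes r q \<noteq> {}"
    using card_palettes[of r q] q_less_r by (metis card.empty binomial_eq_0_iff not_less_iff_gr_or_eq)
  then obtain L where "L \<in> palettes r q" by blast
  then have "u \<le> real (card A)" using not_all[of L] by simp
  then have "real (\<Prod>x\<in>A. max 1 (card (P x)))
      \<le> real r powr (2 ^ r * (\<delta> * N)) * (real q ^ card A * \<theta> powr (u - 2 * (2 ^ r * (\<delta> * N))))"
    unfolding \<theta>_def using assms not_all by (intro prod_sparse_list_sizes_le) auto
  also have "\<dots> \<le> real r powr (2 ^ r * (\<delta> * N)) * (real q ^ card A * \<theta> powr (\<beta> / 2 * N))"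
  proof (intro mult_left_mono powr_mono')
    have "(\<xi> + 2 * 2 ^ r * \<delta>) * N \<le> \<beta> / 2 * N" using assms(8,9) by (rule mult_right_mono[rotated])
    then show "\<beta> / 2 * N \<le> u - 2 * (2 ^ r * (\<delta> * N))" by (simp add: u_def algebra_simps)
  qed (use q_ge_3 in \<open>auto simp: \<theta>_def\<close>)
  finally show ?thesis unfolding \<theta>_def .
qed

lemma far_coloring_captured:
  fixes G A :: "(int ^ 'd::finite) set" and \<beta> \<delta> \<eta> \<xi> b K :: real
  defines "N \<equiv> real (card G)"
  assumes G: "finite G" "G \<noteq> {}" "small_sumset h K G" and A: "A \<subseteq> G" and \<C>: "containers k h \<eta> G \<C>"
    and \<delta>: "0 < \<delta>" "\<eta> * K ^ (k - 1) < \<delta> ^ (k * h)" "real r powr (2 ^ r * \<delta>) \<le> b"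
    and \<xi>: "0 \<le> \<xi>" "real (card (arrangements k h r \<times> slots k h)) * \<eta> \<le> \<xi>" "\<xi> + 2 * 2 ^ r * \<delta> \<le> \<beta> / 2"
    and b: "1 < b" and far: "c \<in> far_colorings (\<beta> * N) A"
  shows "\<exists>\<Phi>\<in>arrangements k h r \<rightarrow>\<^sub>E \<C>. real (card (outliers c (template k h r \<Phi>) A)) \<le> \<xi> * N \<and>
    real (\<Prod>x\<in>A. max 1 (card (template k h r \<Phi> x)))
      \<le> b ^ card G * (real q ^ card A * (((real q - 1) / real q) powr (\<beta> / 2)) ^ card G)"
proof -
  define \<kappa> where "\<kappa> = ((real q - 1) / real q) powr (\<beta> / 2)"
  have "0 < \<kappa>" "0 < N" using G q_ge_3 by (simp_all add: \<kappa>_def N_def card_gt_0_iff)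
  have finite_A: "finite A" using A G(1) by (rule finite_subset)
  have "1 \<le> k" "1 \<le> h" using k_ge_2 h_ge_2 by simp_all
  have "c \<in> rainbow_free_colorings k h r A" using far by (simp add: far_colorings_def)
  then obtain \<Phi> where \<Phi>: "\<Phi> \<in> arrangements k h r \<rightarrow>\<^sub>E \<C>" and captured:
    "real (card (outliers c (template k h r \<Phi>) A)) \<le> real (card (arrangements k h r \<times> slots k h)) * (\<eta> * N)"
    using template_captures_coloring[OF _ A G(1) \<C>] unfolding N_def by blast
  have few_outliers: "real (card (outliers c (template k h r \<Phi>) A)) \<le> \<xi> * N"
    using captured mult_right_mono[OF \<xi>(2), of N] \<open>0 < N\<close> by (simp only: mult.assoc) linarith
  have "sparse_lists k h r (\<delta> * N) A (template k h r \<Phi>)"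
    unfolding N_def using \<Phi>
    by (intro sparse_lists_template[OF \<open>1 \<le> k\<close> \<open>1 \<le> h\<close> G(1,2) \<delta>(1) G(3) \<delta>(2) \<C>]) auto
  then have "real (\<Prod>x\<in>A. max 1 (card (template k h r \<Phi> x)))
      \<le> real r powr (2 ^ r * (\<delta> * N)) * (real q ^ card A * ((real q - 1) / real q) powr (\<beta> / 2 * N))"
    using few_outliers \<delta>(1) \<xi>(1,3) \<open>0 < N\<close>
    by (intro prod_template_sizes_le_of_far[OF far finite_A template_subset]) auto
  also have "real r powr (2 ^ r * (\<delta> * N)) = (real r powr (2 ^ r * \<delta>)) powr N"
    by (simp add: powr_powr mult.assoc)
  also have "\<dots> \<le> b powr N" using \<delta>(3) \<open>0 < N\<close> by (intro powr_mono2) auto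
  also have "b powr N = b ^ card G" using b by (simp add: N_def powr_realpow)
  also have "((real q - 1) / real q) powr (\<beta> / 2 * N) = \<kappa> powr N"
    unfolding \<kappa>_def powr_powr ..
  also have "\<kappa> powr N = \<kappa> ^ card G" using \<open>0 < \<kappa>\<close> by (simp add: N_def powr_realpow)
  finally show ?thesis
    using \<Phi> few_outliers \<open>0 < \<kappa>\<close> unfolding \<kappa>_def by (intro bexI[of _ \<Phi>]) (auto intro: mult_right_mono)
qed

lemma card_far_colorings_le:
  fixes G A :: "(int ^ 'd::finite) set" and \<beta> \<delta> \<eta> \<xi> b K :: real
  defines "N \<equiv> real (card G)"
  assumes G: "finite G" "G \<noteq> {}" "small_sumset h K G" and A: "A \<subseteq> G"
    and \<C>: "finite \<C>" "real (card \<C>) \<le> b ^ card G" "containers k h \<eta> G \<C>"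
    and \<delta>: "0 < \<delta>" "\<eta> * K ^ (k - 1) < \<delta> ^ (k * h)" "real r powr (2 ^ r * \<delta>) \<le> b"
    and \<xi>: "0 \<le> \<xi>" "real (card (arrangements k h r \<times> slots k h)) * \<eta> \<le> \<xi>" "\<xi> + 2 * 2 ^ r * \<delta> \<le> \<beta> / 2"
    and few_sets: "(\<Sum>E | E \<subseteq> A \<and> real (card E) \<le> \<xi> * N. real r ^ card E) \<le> b ^ card G"
    and b: "1 < b"
  shows "real (card (far_colorings (\<beta> * N) A)) \<le> real q ^ card A *
    (b ^ (card (arrangements k h r) + 2) * ((real q - 1) / real q) powr (\<beta> / 2)) ^ card G"
proof -
  define \<kappa> where "\<kappa> = ((real q - 1) / real q) powr (\<beta> / 2)"
  define s where "s = b ^ card G * (real q ^ card A * \<kappa> ^ card G)"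
  have "0 \<le> s" using b by (simp add: s_def \<kappa>_def)
  have finite_A: "finite A" using A G(1) by (rule finite_subset)
  have "far_colorings (\<beta> * N) A \<subseteq> A \<rightarrow>\<^sub>E {1..r}"
    by (auto simp: far_colorings_def rainbow_free_colorings_def)
  then have "real (card (far_colorings (\<beta> * N) A)) \<le> real (card (arrangements k h r \<rightarrow>\<^sub>E \<C>)) *
      ((\<Sum>E | E \<subseteq> A \<and> real (card E) \<le> \<xi> * N. real r ^ card E) * s)"
    using \<C>(1) finite_A finite_arrangements finite_subset[OF template_subset] \<open>0 \<le> s\<close>
      far_coloring_captured[OF G A \<C>(3) \<delta> \<xi> b, folded N_def \<kappa>_def s_def]
    by (intro card_colorings_captured_le[where P = "template k h r"]) (auto intro: finite_PiE)
  also have "\<dots> \<le> (b ^ card G) ^ card (arrangements k h r) * (b ^ card G * s)"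
  proof (intro mult_mono)
    show "real (card (arrangements k h r \<rightarrow>\<^sub>E \<C>)) \<le> (b ^ card G) ^ card (arrangements k h r)"
      using \<C>(2) by (simp add: card_funcsetE finite_arrangements power_mono)
  qed (use few_sets b \<open>0 \<le> s\<close> in \<open>auto intro!: mult_nonneg_nonneg sum_nonneg\<close>)
  also have "\<dots> = real q ^ card A * (b ^ (card (arrangements k h r) + 2) * \<kappa>) ^ card G"
    by (simp add: s_def power_mult_distrib power_add mult_ac power2_eq_square flip: power_mult)
  finally show ?thesis by (simp add: \<kappa>_def)
qed

lemma exists_container_parameters:
  fixes \<alpha> \<beta> b K :: real
  assumes "0 < \<alpha>" "0 < \<beta>" "1 < b" "1 \<le> K" "0 \<le> R"
  obtains \<delta> \<eta> \<xi> where "0 < \<delta>" "real r powr (2 ^ r * \<delta>) \<le> b"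
    "0 < \<xi>" "\<xi> \<le> \<alpha>" "\<xi> + 2 * 2 ^ r * \<delta> \<le> \<beta> / 2"
    "0 < \<eta>" "R * \<eta> \<le> \<xi>" "\<eta> * K ^ (k - 1) < \<delta> ^ (k * h)"
proof
  have r: "1 \<le> real r" "0 < ln (real r)" using q_ge_3 q_less_r by simp_all
  define \<xi> where "\<xi> = min \<alpha> (\<beta> / 4)"
  define \<delta> where "\<delta> = min (\<beta> / 8) (ln b / ln (real r)) / 2 ^ r"
  define \<eta> where "\<eta> = min (\<xi> / (R + 1)) (\<delta> ^ (k * h) / (2 * K ^ (k - 1)))"
  have \<delta>: "2 ^ r * \<delta> = min (\<beta> / 8) (ln b / ln (real r))" by (simp add: \<delta>_def)
  show \<delta>_pos: "0 < \<delta>" using assms(2,3) r(2) by (simp add: \<delta>_def)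
  have "real r powr (2 ^ r * \<delta>) \<le> real r powr (ln b / ln (real r))"
    unfolding \<delta> using r(1) by (intro powr_mono) auto
  also have "\<dots> = b" using r assms(3) by (simp add: powr_def)
  finally show "real r powr (2 ^ r * \<delta>) \<le> b" .
  show \<xi>_pos: "0 < \<xi>" and "\<xi> \<le> \<alpha>" using assms(1,2) by (simp_all add: \<xi>_def)
  have "\<xi> \<le> \<beta> / 4" by (simp add: \<xi>_def)
  moreover have "2 ^ r * \<delta> \<le> \<beta> / 8" unfolding \<delta> by (rule min.cobounded1)
  ultimately show "\<xi> + 2 * 2 ^ r * \<delta> \<le> \<beta> / 2" by linarith
  have K_power: "0 < K ^ (k - 1)" using assms(4) by simp
  then show \<eta>_pos: "0 < \<eta>" using assms(5) \<xi>_pos \<delta>_pos by (auto simp: \<eta>_def)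
  have "\<eta> * (R + 1) \<le> \<xi>" using assms(5) by (simp add: \<eta>_def flip: pos_le_divide_eq)
  then show "R * \<eta> \<le> \<xi>" using \<eta>_pos by (simp add: algebra_simps)
  have "\<eta> * (2 * K ^ (k - 1)) \<le> \<delta> ^ (k * h)"
    using K_power by (simp add: \<eta>_def flip: pos_le_divide_eq)
  moreover have "0 < \<eta> * K ^ (k - 1)" using \<eta>_pos K_power by simp
  ultimately show "\<eta> * K ^ (k - 1) < \<delta> ^ (k * h)" by linarith
qed

lemma far_colorings_rare:
  fixes \<beta> K :: real
  assumes "0 < \<beta>" "1 \<le> K"
  shows "\<exists>\<kappa>>0. \<kappa> < 1 \<and> (\<forall>\<^sub>F G :: (int ^ 'd::finite) set in large_sets (small_sumset h K). \<forall>A\<subseteq>G.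
    real (card (far_colorings (\<beta> * real (card G)) A)) \<le> real q ^ card A * \<kappa> ^ card G)"
proof -
  define \<kappa>\<^sub>0 where "\<kappa>\<^sub>0 = ((real q - 1) / real q) powr (\<beta> / 2)"
  have "0 < (real q - 1) / real q" "(real q - 1) / real q < 1" using q_ge_3 by simp_all
  then have \<kappa>\<^sub>0: "0 < \<kappa>\<^sub>0" "\<kappa>\<^sub>0 < 1"
    unfolding \<kappa>\<^sub>0_def using assms(1) q_ge_3 by (simp_all only: powr01_less_one, simp_all)
  obtain b where b: "1 < b" "b ^ (card (arrangements k h r) + 2) * \<kappa>\<^sub>0 < 1"
    using exists_base_gt_1[OF \<kappa>\<^sub>0] by blast
  have "1 \<le> real r" using q_ge_3 q_less_r by simp
  obtain \<alpha> where \<alpha>: "0 < \<alpha>" and few_sets: "\<And>S :: (int ^ 'd) set. \<And>M m. finite S \<Longrightarrow> real (card S) \<le> M \<Longrightarrow>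
    m \<le> \<alpha> * M \<Longrightarrow> (\<Sum>E | E \<subseteq> S \<and> real (card E) \<le> m. real r ^ card E) \<le> b powr M"
    using sum_power_card_small_subsets_subexponential[OF b(1) \<open>1 \<le> real r\<close>] by blast
  obtain \<delta> \<eta> \<xi> where \<delta>: "0 < \<delta>" "real r powr (2 ^ r * \<delta>) \<le> b"
    and \<xi>: "0 < \<xi>" "\<xi> \<le> \<alpha>" "\<xi> + 2 * 2 ^ r * \<delta> \<le> \<beta> / 2"
    and \<eta>: "0 < \<eta>" "real (card (arrangements k h r \<times> slots k h)) * \<eta> \<le> \<xi>" "\<eta> * K ^ (k - 1) < \<delta> ^ (k * h)"
    using exists_container_parameters[OF \<alpha> assms(1) b(1) assms(2) of_nat_0_le_iff] by blast
  define \<kappa> where "\<kappa> = b ^ (card (arrangements k h r) + 2) * \<kappa>\<^sub>0"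
  have "\<forall>\<^sub>F G :: (int ^ 'd) set in large_sets (small_sumset h K). \<forall>A\<subseteq>G.
    real (card (far_colorings (\<beta> * real (card G)) A)) \<le> real q ^ card A * \<kappa> ^ card G"
    using solution_free_containers[OF h_ge_2 assms(2) b(1) \<eta>(1), where k = k]
      eventually_large_sets[of "small_sumset h K" 1]
  proof eventually_elim
    case (elim G)
    then have G: "finite G" "G \<noteq> {}" "small_sumset h K G" by auto
    obtain \<C> where \<C>: "finite \<C>" "real (card \<C>) \<le> b ^ card G" "containers k h \<eta> G \<C>"
      using elim(1) by blast
    show ?case
    proof (intro allI impI)
      fix A assume "A \<subseteq> G"
      then have "(\<Sum>E | E \<subseteq> A \<and> real (card E) \<le> \<xi> * real (card G). real r ^ card E) \<le> b ^ card G"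
        using few_sets[of A "real (card G)" "\<xi> * real (card G)"] G(1) b(1) \<xi>(2)
        by (simp add: card_mono finite_subset mult_right_mono powr_realpow)
      then show "real (card (far_colorings (\<beta> * real (card G)) A)) \<le> real q ^ card A * \<kappa> ^ card G"
        unfolding \<kappa>_def \<kappa>\<^sub>0_def using G \<C> \<delta> \<xi> \<eta> b(1) \<open>A \<subseteq> G\<close>
        by (intro card_far_colorings_le[where \<delta> = \<delta> and \<eta> = \<eta> and \<xi> = \<xi> and K = K]) auto
    qed
  qed
  then show ?thesis using b \<kappa>\<^sub>0(1) by (intro exI[of _ \<kappa>]) (simp add: \<kappa>_def)
qed

end

section \<open>Colorings close to a palette\<close>

lemma card_le_restrict_mult:
  assumes "finite Q" "finite R" "C \<subseteq> extensional A"
    and "\<And>c. c \<in> C \<Longrightarrow> restrict c B \<in> Q" "\<And>c. c \<in> C \<Longrightarrow> restrict c (A - B) \<in> R"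
  shows "card C \<le> card Q * card R"
proof -
  have "inj_on (\<lambda>c. (restrict c B, restrict c (A - B))) C"
  proof (rule inj_onI)
    fix c d assume "c \<in> C" "d \<in> C" and eq: "(restrict c B, restrict c (A - B)) = (restrict d B, restrict d (A - B))"
    show "c = d"
    proof (rule extensionalityI[of _ A])
      fix x assume "x \<in> A"
      then have "x \<in> B \<or> x \<in> A - B" by blast
      then show "c x = d x" using eq by (metis prod.inject restrict_apply')
    qed (use \<open>c \<in> C\<close> \<open>d \<in> C\<close> assms(3) in auto)
  qed
  moreover have "(\<lambda>c. (restrict c B, restrict c (A - B))) ` C \<subseteq> Q \<times> R"
    using assms(4,5) by auto
  ultimately have "card C \<le> card (Q \<times> R)" using assms(1,2) by (intro card_inj_on_le) auto
  then show ?thesis by (simp add: card_cartesian_product)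
qed

lemma card_avoiding_block_le:
  assumes "finite D" "finite L" "L \<noteq> {}" "B \<subseteq> D" "p ` B \<subseteq> L" "finite R"
    and C: "\<And>c. c \<in> C \<Longrightarrow> c \<in> D \<rightarrow>\<^sub>E L \<and> (\<exists>x\<in>B. c x \<noteq> p x) \<and> restrict c (D - B) \<in> R"
  shows "real (card C) \<le> (real (card L) ^ card B - 1) * real (card R)"
proof -
  have "finite B" using assms(1,4) finite_subset by blast
  have "card C \<le> card ((B \<rightarrow>\<^sub>E L) - {restrict p B}) * card R"
  proof (rule card_le_restrict_mult[OF _ \<open>finite R\<close>])
    show "finite ((B \<rightarrow>\<^sub>E L) - {restrict p B})" using \<open>finite B\<close> assms(2) by (simp add: finite_PiE)
    show "C \<subseteq> extensional D" using C by (auto simp: PiE_def)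
    fix c assume c: "c \<in> C"
    then obtain x where "x \<in> B" "c x \<noteq> p x" using C by blast
    then have "restrict c B \<noteq> restrict p B" by (metis restrict_apply')
    then show "restrict c B \<in> (B \<rightarrow>\<^sub>E L) - {restrict p B}" using C[OF c] assms(4) by auto
    show "restrict c (D - B) \<in> R" using C[OF c] by blast
  qed
  also have "card ((B \<rightarrow>\<^sub>E L) - {restrict p B}) = card L ^ card B - 1"
    using assms(5) \<open>finite B\<close> by (subst card_Diff_singleton) (auto simp: card_funcsetE)
  finally have "real (card C) \<le> real ((card L ^ card B - 1) * card R)" by (rule of_nat_mono)
  moreover have "1 \<le> card L ^ card B" using assms(2,3) by (simp add: Suc_le_eq card_gt_0_iff)
  ultimately show ?thesis by (simp add: of_nat_diff)
qed

definition avoiding_colorings ::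
  "'t set \<Rightarrow> ('t \<Rightarrow> 'a set) \<Rightarrow> ('a \<Rightarrow> 'b) \<Rightarrow> 'a set \<Rightarrow> 'b set \<Rightarrow> ('a \<Rightarrow> 'b) set" where
  "avoiding_colorings T B p D L = {c \<in> D \<rightarrow>\<^sub>E L. \<forall>t\<in>T. B t \<subseteq> D \<longrightarrow> (\<exists>x\<in>B t. c x \<noteq> p x)}"

lemma finite_avoiding_colorings:
  "finite D \<Longrightarrow> finite L \<Longrightarrow> finite (avoiding_colorings T B p D L)"
  using finite_PiE[of D "\<lambda>_. L"] by (simp add: avoiding_colorings_def)

lemma restrict_mem_avoiding_colorings:
  assumes c: "c \<in> avoiding_colorings T B p D L" and "T' \<subseteq> T" "D' \<subseteq> D"
    and blocks: "\<And>t. t \<in> T' \<Longrightarrow> B t \<subseteq> D'"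
  shows "restrict c D' \<in> avoiding_colorings T' B p D' L"
proof -
  have "\<exists>x\<in>B t. restrict c D' x \<noteq> p x" if "t \<in> T'" for t
  proof -
    have "t \<in> T" "B t \<subseteq> D" using assms(2,3) blocks[OF that] that by auto
    then obtain x where x: "x \<in> B t" "c x \<noteq> p x"
      using c unfolding avoiding_colorings_def by blast
    then have "x \<in> D'" using blocks[OF that] by blast
    then show ?thesis using x by (intro bexI[of _ x]) simp_all
  qed
  moreover have "c \<in> D \<rightarrow>\<^sub>E L" using c by (simp add: avoiding_colorings_def)
  then have "restrict c D' \<in> D' \<rightarrow>\<^sub>E L" using assms(3) by auto
  ultimately show ?thesis by (simp add: avoiding_colorings_def)
qed

lemma card_avoiding_colorings_disjoint_le:
  assumes "finite T" "finite D" and L: "finite L" "L \<noteq> {}"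
    and "\<And>t. t \<in> T \<Longrightarrow> B t \<subseteq> D \<and> card (B t) = m \<and> p ` B t \<subseteq> L" and "disjoint_family_on B T"
  shows "real (card (avoiding_colorings T B p D L))
    \<le> real (card L) ^ card D * (1 - 1 / real (card L) ^ m) ^ card T"
  using assms(1,2,5,6)
proof (induction T arbitrary: D rule: finite_induct)
  case empty
  then show ?case by (simp add: avoiding_colorings_def card_funcsetE)
next
  case (insert t T)
  define s where "s = real (card L)"
  have s: "1 \<le> s" using L by (simp add: s_def Suc_le_eq card_gt_0_iff)
  define D' where "D' = D - B t"
  have block_t: "B t \<subseteq> D" "card (B t) = m" "p ` B t \<subseteq> L" using insert.prems(2) by auto
  have D': "D' \<subseteq> D" "finite D'" using insert.prems(1) by (auto simp: D'_def)
  have card_D: "card D = m + card D'"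
    using block_t insert.prems(1) card_mono[OF insert.prems(1) block_t(1)]
    by (simp add: D'_def card_Diff_subset finite_subset[OF block_t(1)])
  have disjoint: "B t \<inter> \<Union> (B ` T) = {}" "disjoint_family_on B T"
    using insert.prems(3) insert.hyps(2) by (simp_all add: disjoint_family_on_insert)
  have blocks_D': "B u \<subseteq> D' \<and> card (B u) = m \<and> p ` B u \<subseteq> L" if "u \<in> T" for u
    using insert.prems(2)[of u] disjoint(1) that by (auto simp: D'_def)
  have IH: "real (card (avoiding_colorings T B p D' L)) \<le> s ^ card D' * (1 - 1 / s ^ m) ^ card T"
    unfolding s_def using D'(2) blocks_D' disjoint(2) by (intro insert.IH)
  have "real (card (avoiding_colorings (insert t T) B p D L))
      \<le> (s ^ m - 1) * real (card (avoiding_colorings T B p D' L))"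
    unfolding s_def block_t(2)[symmetric]
  proof (rule card_avoiding_block_le[OF insert.prems(1) L block_t(1,3)
        finite_avoiding_colorings[OF D'(2) L(1)]])
    fix c assume c: "c \<in> avoiding_colorings (insert t T) B p D L"
    then have "c \<in> D \<rightarrow>\<^sub>E L" "\<exists>x\<in>B t. c x \<noteq> p x"
      using block_t(1) by (simp_all add: avoiding_colorings_def)
    moreover have "restrict c D' \<in> avoiding_colorings T B p D' L"
      using blocks_D' by (intro restrict_mem_avoiding_colorings[OF c _ D'(1)]) auto
    ultimately show "c \<in> D \<rightarrow>\<^sub>E L \<and> (\<exists>x\<in>B t. c x \<noteq> p x) \<and>
        restrict c (D - B t) \<in> avoiding_colorings T B p D' L"
      unfolding D'_def by blast
  qed
  also have "\<dots> \<le> (s ^ m - 1) * (s ^ card D' * (1 - 1 / s ^ m) ^ card T)"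
    using IH s by (intro mult_left_mono) auto
  also have "\<dots> = s ^ card D * (1 - 1 / s ^ m) ^ card (insert t T)"
  proof -
    have "s ^ m - 1 = s ^ m * (1 - 1 / s ^ m)" using s by (simp add: right_diff_distrib)
    then show ?thesis using insert.hyps by (simp add: card_D power_add)
  qed
  finally show ?case by (simp add: s_def)
qed

lemma card_le_disjoint_family:
  assumes "finite T" "disjoint_family_on B T" "finite W"
  shows "card T \<le> card {t \<in> T. B t \<inter> W = {}} + card W"
proof -
  define f where "f t = (SOME x. x \<in> B t \<inter> W)" for t
  have f: "f t \<in> B t \<inter> W" if "B t \<inter> W \<noteq> {}" for t
  proof -
    have "\<exists>x. x \<in> B t \<inter> W" using that by blast
    then show ?thesis unfolding f_def by (rule someI_ex)
  qed
  have "inj_on f {t \<in> T. B t \<inter> W \<noteq> {}}"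
  proof (rule inj_onI, rule ccontr)
    fix t u assume tu: "t \<in> {t \<in> T. B t \<inter> W \<noteq> {}}" "u \<in> {t \<in> T. B t \<inter> W \<noteq> {}}" "f t = f u" "t \<noteq> u"
    then have "B t \<inter> B u = {}" using assms(2) by (simp add: disjoint_family_on_def)
    moreover have "f t \<in> B t" "f t \<in> B u" using f[of t] f[of u] tu by auto
    ultimately show False by blast
  qed
  moreover have "f ` {t \<in> T. B t \<inter> W \<noteq> {}} \<subseteq> W" using f by blast
  ultimately have "card {t \<in> T. B t \<inter> W \<noteq> {}} \<le> card W" using assms(3) by (rule card_inj_on_le)
  moreover have "card T = card {t \<in> T. B t \<inter> W = {}} + card {t \<in> T. B t \<inter> W \<noteq> {}}"
    using assms(1) by (subst card_Un_disjoint[symmetric]) (auto intro: arg_cong[of _ _ card])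
  ultimately show ?thesis by linarith
qed

definition block :: "nat \<Rightarrow> nat \<Rightarrow> (nat \<Rightarrow> nat \<Rightarrow> 'a) \<Rightarrow> 'a set" where
  "block k h x = (\<lambda>(l, i). x l i) ` (slots k h - {(1, 1)})"

lemma mem_block: "(l, i) \<in> slots k h - {(1, 1)} \<Longrightarrow> x l i \<in> block k h x"
  unfolding block_def by (rule image_eqI[of _ _ "(l, i)"]) simp_all

definition solution_star ::
  "nat \<Rightarrow> nat \<Rightarrow> (int ^ 'd) set \<Rightarrow> int ^ 'd \<Rightarrow> 't set \<Rightarrow> ('t \<Rightarrow> nat \<Rightarrow> nat \<Rightarrow> int ^ 'd) \<Rightarrow> bool" where
  "solution_star k h G y T X \<longleftrightarrow> (\<forall>t\<in>T. B_solution k h G (X t) \<and> X t 1 1 = y) \<and>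
     inj_on (\<lambda>(t, l, i). X t l i) (T \<times> (slots k h - {(1, 1)}))"

lemma solution_star_blocks:
  assumes star: "solution_star k h G y T X" and "1 \<le> k" "1 \<le> h"
  shows "disjoint_family_on (\<lambda>t. block k h (X t)) T"
    and "t \<in> T \<Longrightarrow> card (block k h (X t)) = k * h - 1"
    and "t \<in> T \<Longrightarrow> block k h (X t) \<subseteq> G"
proof -
  have inj: "t = t'" "p = p'"
    if "t \<in> T" "t' \<in> T" "p \<in> slots k h - {(1, 1)}" "p' \<in> slots k h - {(1, 1)}"
      "X t (fst p) (snd p) = X t' (fst p') (snd p')" for t t' p p'
    using star that inj_onD[of "\<lambda>(t, l, i). X t l i" "T \<times> (slots k h - {(1, 1)})" "(t, p)" "(t', p')"]
    unfolding solution_star_def by (auto simp: case_prod_unfold)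
  show "disjoint_family_on (\<lambda>t. block k h (X t)) T"
    unfolding disjoint_family_on_def
  proof (intro ballI impI, rule ccontr)
    fix t t' assume t: "t \<in> T" "t' \<in> T" "t \<noteq> t'" and "block k h (X t) \<inter> block k h (X t') \<noteq> {}"
    then obtain p p' where "p \<in> slots k h - {(1, 1)}" "p' \<in> slots k h - {(1, 1)}"
      "X t (fst p) (snd p) = X t' (fst p') (snd p')"
      by (auto simp: block_def case_prod_unfold)
    then show False using inj(1) t by blast
  qed
  have "card (slots k h - {(1, 1)}) = k * h - 1"
    using assms(2,3) by (simp add: card_cartesian_product)
  moreover assume "t \<in> T"
  then have "inj_on (\<lambda>(l, i). X t l i) (slots k h - {(1, 1)})"
    using inj(2) by (intro inj_onI) (simp add: case_prod_unfold)
  ultimately show "card (block k h (X t)) = k * h - 1"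
    unfolding block_def by (simp only: card_image)
  show "block k h (X t) \<subseteq> G"
    using star \<open>t \<in> T\<close> unfolding solution_star_def B_solution_def block_def by auto
qed

lemma exists_rainbow_pattern:
  assumes "solution_star k h G y T X" "bij_betw \<phi> (slots k h - {(1, 1)}) L"
  obtains p where "\<And>t. t \<in> T \<Longrightarrow> bij_betw (\<lambda>(l, i). p (X t l i)) (slots k h - {(1, 1)}) L"
proof -
  define rest where "rest = slots k h - {(1, 1)}"
  define f where "f = (\<lambda>(t, l, i). X t l i)"
  define p where "p x = \<phi> (snd (the_inv_into (T \<times> rest) f x))" for x
  have inj: "inj_on f (T \<times> rest)"
    using assms(1) by (simp add: solution_star_def f_def rest_def)
  have "p (X t l i) = \<phi> (l, i)" if "t \<in> T" "(l, i) \<in> rest" for t l i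
  proof -
    have "the_inv_into (T \<times> rest) f (f (t, l, i)) = (t, l, i)"
      using inj that by (intro the_inv_into_f_f) auto
    then show ?thesis by (simp add: p_def f_def)
  qed
  then have "bij_betw (\<lambda>(l, i). p (X t l i)) rest L \<longleftrightarrow> bij_betw \<phi> rest L" if "t \<in> T" for t
    using that by (intro bij_betw_cong) auto
  then show thesis using that[of p] assms(2) unfolding rest_def by blast
qed

lemma rainbow_if_outlier:
  assumes "c (x 1 1) \<notin> L" "bij_betw (\<lambda>(l, i). c (x l i)) (slots k h - {(1, 1)}) L"
  shows "rainbow k h c x"
proof -
  have "inj_on (\<lambda>(l, i). c (x l i)) (insert (1, 1) (slots k h - {(1, 1)}))"
    using assms unfolding bij_betw_def inj_on_insert by simp
  then show ?thesis unfolding rainbow_def by (rule inj_on_subset) auto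
qed

lemma outlier_solution_avoids_pattern:
  assumes "c \<in> rainbow_free_colorings k h r A" "B_solution k h G x" "x 1 1 \<in> A" "block k h x \<subseteq> A"
    and "c (x 1 1) \<notin> L" and pattern: "bij_betw (\<lambda>(l, i). p (x l i)) (slots k h - {(1, 1)}) L"
  shows "\<exists>z\<in>block k h x. c z \<noteq> p z"
proof (rule ccontr)
  assume "\<not> ?thesis"
  then have "(\<lambda>(l, i). c (x l i)) a = (\<lambda>(l, i). p (x l i)) a" if "a \<in> slots k h - {(1, 1)}" for a
    using mem_block[of "fst a" "snd a" k h x] that by (simp add: case_prod_unfold)
  then have "bij_betw (\<lambda>(l, i). c (x l i)) (slots k h - {(1, 1)}) L"
    using pattern by (rule bij_betw_cong[THEN iffD2])
  then have "rainbow k h c x" using rainbow_if_outlier assms(5) by blast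
  moreover have "x l i \<in> A" if "l \<in> {1..k}" "i \<in> {1..h}" for l i
    using assms(3,4) mem_block[of l i k h x] that by (cases "(l, i) = (1, 1)") auto
  then have "B_solution k h A x" using assms(2) unfolding B_solution_def by blast
  ultimately show False using assms(1) by (auto simp: rainbow_free_colorings_def)
qed

lemma restrict_outlier_coloring_avoids_pattern:
  assumes c: "c \<in> rainbow_free_colorings k h r A" and E: "y \<in> outliers c (\<lambda>_. L) A"
    and star: "solution_star k h G y T X"
    and pattern: "\<And>t. t \<in> T \<Longrightarrow> bij_betw (\<lambda>(l, i). p (X t l i)) (slots k h - {(1, 1)}) L"
  defines "D \<equiv> A - outliers c (\<lambda>_. L) A"
  shows "restrict c D \<in> avoiding_colorings T (\<lambda>t. block k h (X t)) p D L"
proof -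
  have "\<exists>x\<in>block k h (X t). restrict c D x \<noteq> p x" if t: "t \<in> T" "block k h (X t) \<subseteq> D" for t
  proof -
    have X: "X t 1 1 = y" "B_solution k h G (X t)"
      using star t(1) by (auto simp: solution_star_def)
    have y: "X t 1 1 \<in> A" "c (X t 1 1) \<notin> L" using E X(1) by (auto simp: outliers_def)
    have "block k h (X t) \<subseteq> A" using t(2) by (auto simp: D_def)
    from outlier_solution_avoids_pattern[OF c X(2) y(1) this y(2) pattern[OF t(1)]]
    obtain x where "x \<in> block k h (X t)" "c x \<noteq> p x" by blast
    then show ?thesis using t(2) by (intro bexI[of _ x]) auto
  qed
  moreover have "restrict c D \<in> D \<rightarrow>\<^sub>E L" by (auto simp: D_def outliers_def)
  ultimately show ?thesis by (simp add: avoiding_colorings_def)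
qed

definition dense_in :: "real \<Rightarrow> 'a set \<Rightarrow> 'a set \<Rightarrow> bool" where
  "dense_in \<delta> G A \<longleftrightarrow> A \<subseteq> G \<and> (1 - \<delta>) * real (card G) \<le> real (card A)"

definition star_rich :: "nat \<Rightarrow> nat \<Rightarrow> real \<Rightarrow> (int ^ 'd) set \<Rightarrow> bool" where
  "star_rich k h s G \<longleftrightarrow> (\<forall>y\<in>G. \<exists>(T :: (int ^ 'd) set) X. finite T \<and>
     s * real (card G) \<le> real (card T) \<and> solution_star k h G y T X)"

context rainbow_parameters
begin

lemma card_star_avoiding_colorings_le:
  fixes G D :: "(int ^ 'd::finite) set"
  assumes "finite G" "D \<subseteq> G" and L: "L \<in> palettes r q"
    and T: "finite T" and star: "solution_star k h G y T X"
    and pattern: "\<And>t. t \<in> T \<Longrightarrow> p ` block k h (X t) \<subseteq> L"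
    and u: "real (card (G - D)) + u \<le> real (card T)"
  shows "real (card (avoiding_colorings T (\<lambda>t. block k h (X t)) p D L))
    \<le> real q ^ card D * (1 - 1 / real q ^ q) powr u"
proof -
  define B where "B = (\<lambda>t. block k h (X t))"
  define T' where "T' = {t \<in> T. B t \<inter> (G - D) = {}}"
  define \<rho> where "\<rho> = 1 - 1 / real q ^ q"
  have "1 < real q ^ q" using q_ge_3 by (intro one_less_power) auto
  then have \<rho>: "0 < \<rho>" "\<rho> < 1" using q_ge_3 by (simp_all add: \<rho>_def)
  have "1 \<le> k" "1 \<le> h" using k_ge_2 h_ge_2 by simp_all
  note blocks = solution_star_blocks[OF star this, folded B_def q_def]
  have "finite D" using assms(1,2) finite_subset by blast
  have L': "finite L" "card L = q" "L \<noteq> {}"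
    using finite_palette[OF L] L q_ge_3 by (auto simp: palettes_def)
  have blocks_T': "B t \<subseteq> D \<and> card (B t) = q \<and> p ` B t \<subseteq> L" if "t \<in> T'" for t
    using that blocks(2,3)[of t] pattern[of t] by (auto simp: T'_def B_def)
  have "disjoint_family_on B T'"
    using blocks(1) by (auto simp: T'_def disjoint_family_on_def)
  have "avoiding_colorings T B p D L \<subseteq> avoiding_colorings T' B p D L"
    by (auto simp: avoiding_colorings_def T'_def)
  then have "real (card (avoiding_colorings T B p D L)) \<le> real (card (avoiding_colorings T' B p D L))"
    using finite_avoiding_colorings[OF \<open>finite D\<close> L'(1)] by (intro of_nat_mono card_mono)
  also have "\<dots> \<le> real q ^ card D * \<rho> ^ card T'"
    using card_avoiding_colorings_disjoint_le[OF _ \<open>finite D\<close> L'(1,3) blocks_T' \<open>disjoint_family_on B T'\<close>] T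
    by (simp add: \<rho>_def L'(2) T'_def)
  also have "\<dots> \<le> real q ^ card D * \<rho> powr u"
  proof -
    have "u \<le> real (card T')"
      using card_le_disjoint_family[OF T blocks(1), of "G - D"] \<open>finite G\<close> u by (simp add: T'_def)
    then show ?thesis using \<rho> by (simp add: mult_left_mono powr_mono' flip: powr_realpow)
  qed
  finally show ?thesis unfolding \<rho>_def B_def .
qed

lemma card_colorings_with_outlier_le:
  fixes A G E :: "(int ^ 'd::finite) set"
  assumes "finite G" and A: "A \<subseteq> G" and L: "L \<in> palettes r q" and E: "E \<subseteq> A" "y \<in> E"
    and T: "finite T" and star: "solution_star k h G y T X"
    and u: "real (card (G - A)) + real (card E) + u \<le> real (card T)"
  shows "real (card {c \<in> rainbow_free_colorings k h r A. outliers c (\<lambda>_. L) A = E})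
    \<le> real r ^ card E * (real q ^ card A * (1 - 1 / real q ^ q) powr u)"
    (is "real (card ?C) \<le> _")
proof -
  have finite_A: "finite A" and finite_E: "finite E"
    using finite_subset[OF A \<open>finite G\<close>] finite_subset[OF E(1)] by auto
  have "card (slots k h - {(1, 1)}) = card L"
    using k_ge_2 h_ge_2 L by (simp add: q_def palettes_def card_cartesian_product)
  then obtain \<phi> where "bij_betw \<phi> (slots k h - {(1, 1)}) L"
    using finite_same_card_bij[of "slots k h - {(1, 1)}" L] finite_palette[OF L] by blast
  then obtain p where pattern:
    "\<And>t. t \<in> T \<Longrightarrow> bij_betw (\<lambda>(l, i). p (X t l i)) (slots k h - {(1, 1)}) L"
    using exists_rainbow_pattern[OF star] by blast
  define D where "D = avoiding_colorings T (\<lambda>t. block k h (X t)) p (A - E) L"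
  have "finite D"
    unfolding D_def using finite_A finite_palette[OF L] by (intro finite_avoiding_colorings) auto
  have "card ?C \<le> card (E \<rightarrow>\<^sub>E {1..r}) * card D"
  proof (rule card_le_restrict_mult[OF _ \<open>finite D\<close>])
    show "finite (E \<rightarrow>\<^sub>E {1..r})" using finite_E by (intro finite_PiE) auto
    show "?C \<subseteq> extensional A" by (auto simp: rainbow_free_colorings_def PiE_def)
    fix c assume c: "c \<in> ?C"
    then have "c \<in> A \<rightarrow>\<^sub>E {1..r}" by (simp add: rainbow_free_colorings_def)
    then show "restrict c E \<in> E \<rightarrow>\<^sub>E {1..r}" using E(1) by auto
    show "restrict c (A - E) \<in> D"
      using restrict_outlier_coloring_avoids_pattern[OF _ _ star pattern, of c r A] c E(2)
      by (auto simp: D_def)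
  qed
  then have "real (card ?C) \<le> real r ^ card E * real (card D)"
    using finite_E by (simp add: card_funcsetE flip: of_nat_power of_nat_mult)
  also have "real (card D) \<le> real q ^ card (A - E) * (1 - 1 / real q ^ q) powr u"
    unfolding D_def
  proof (rule card_star_avoiding_colorings_le[OF \<open>finite G\<close> _ L T star])
    show "p ` block k h (X t) \<subseteq> L" if "t \<in> T" for t
      using pattern[OF that] by (auto simp: bij_betw_def block_def)
    have "G - (A - E) \<subseteq> (G - A) \<union> E" by blast
    then have "card (G - (A - E)) \<le> card (G - A) + card E"
      using \<open>finite G\<close> finite_E by (intro order_trans[OF card_mono card_Un_le]) auto
    then show "real (card (G - (A - E))) + u \<le> real (card T)" using u by linarith
  qed (use A in blast)
  also have "real q ^ card (A - E) \<le> real q ^ card A"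
    using q_ge_3 finite_A by (intro power_increasing card_mono) auto
  finally show ?thesis by (simp add: mult_left_mono mult_right_mono)
qed

definition near_colorings :: "real \<Rightarrow> (int ^ 'd) set \<Rightarrow> (int ^ 'd \<Rightarrow> nat) set" where
  "near_colorings t A =
    {c \<in> rainbow_free_colorings k h r A. \<exists>L\<in>palettes r q. real (card (outliers c (\<lambda>_. L) A)) \<le> t}"

lemma far_Un_near: "far_colorings t A \<union> near_colorings t A = rainbow_free_colorings k h r A"
  unfolding far_colorings_def near_colorings_def by (auto simp: not_le)

lemma card_le_by_outliers:
  fixes A :: "(int ^ 'd::finite) set"
  assumes "finite A" "C \<subseteq> near_colorings t A" "0 \<le> Q"
    and class_le: "\<And>L E. L \<in> palettes r q \<Longrightarrow> E \<subseteq> A \<Longrightarrow> real (card E) \<le> t \<Longrightarrow>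
      real (card {c \<in> C. outliers c (\<lambda>_. L) A = E}) \<le> real r ^ card E * Q"
  shows "real (card C) \<le> 2 ^ r * ((\<Sum>E | E \<subseteq> A \<and> real (card E) \<le> t. real r ^ card E) * Q)"
proof -
  define \<E> where "\<E> = {E. E \<subseteq> A \<and> real (card E) \<le> t}"
  define close where "close L = {c \<in> C. real (card (outliers c (\<lambda>_. L) A)) \<le> t}" for L
  have "finite (near_colorings t A)"
    using finite_rainbow_free_colorings[OF assms(1), of k h r] by (simp add: near_colorings_def)
  then have "finite C" using assms(2) finite_subset by blast
  have "real (card (close L)) \<le> (\<Sum>E\<in>\<E>. real r ^ card E) * Q" if L: "L \<in> palettes r q" for L
  proof -
    have "real (card (close L)) = (\<Sum>E\<in>\<E>. real (card {c \<in> close L. outliers c (\<lambda>_. L) A = E}))"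
    proof (rule real_card_eq_sum_fibers)
      show "(\<lambda>c. outliers c (\<lambda>_. L) A) ` close L \<subseteq> \<E>"
        by (rule image_subsetI) (simp add: close_def \<E>_def outliers_subset)
    qed (use \<open>finite C\<close> assms(1) in \<open>simp_all add: close_def \<E>_def\<close>)
    also have "\<dots> \<le> (\<Sum>E\<in>\<E>. real (card {c \<in> C. outliers c (\<lambda>_. L) A = E}))"
      using \<open>finite C\<close> by (intro sum_mono of_nat_mono card_mono) (auto simp: close_def)
    also have "\<dots> \<le> (\<Sum>E\<in>\<E>. real r ^ card E * Q)"
      using class_le[OF L] by (intro sum_mono) (simp add: \<E>_def)
    finally show ?thesis by (simp add: sum_distrib_right)
  qed
  then have "real (card (\<Union>L\<in>palettes r q. close L)) \<le> 2 ^ r * ((\<Sum>E\<in>\<E>. real r ^ card E) * Q)"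
    using assms(3) by (intro card_UN_palettes_le[of r q]) (auto intro!: mult_nonneg_nonneg sum_nonneg)
  moreover have "C = (\<Union>L\<in>palettes r q. close L)"
    using assms(2) by (auto simp: near_colorings_def close_def)
  ultimately show ?thesis by (simp add: \<E>_def)
qed

lemma card_near_colorings_le:
  fixes A :: "(int ^ 'd::finite) set"
  assumes "finite A"
  shows "real (card (near_colorings t A))
    \<le> 2 ^ r * ((\<Sum>E | E \<subseteq> A \<and> real (card E) \<le> t. real r ^ card E) * real q ^ card A)"
proof (rule card_le_by_outliers[OF assms order_refl])
  fix L E assume L: "L \<in> palettes r q" and "E \<subseteq> A"
  have "max 1 (card L) = q" using L q_ge_3 by (simp add: palettes_def)
  then have "card {c \<in> A \<rightarrow>\<^sub>E {1..r}. outliers c (\<lambda>_. L) A = E} \<le> r ^ card E * q ^ card A"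
    using card_colorings_with_outliers_le[OF assms, of "\<lambda>_. L" E r] finite_palette[OF L] \<open>E \<subseteq> A\<close> by simp
  moreover have "finite (A \<rightarrow>\<^sub>E {1..r})" using assms by (intro finite_PiE) auto
  then have "card {c \<in> near_colorings t A. outliers c (\<lambda>_. L) A = E}
      \<le> card {c \<in> A \<rightarrow>\<^sub>E {1..r}. outliers c (\<lambda>_. L) A = E}"
    by (intro card_mono) (auto simp: near_colorings_def rainbow_free_colorings_def)
  ultimately have "card {c \<in> near_colorings t A. outliers c (\<lambda>_. L) A = E} \<le> r ^ card E * q ^ card A"
    by (rule order_trans[rotated])
  then show "real (card {c \<in> near_colorings t A. outliers c (\<lambda>_. L) A = E}) \<le> real r ^ card E * real q ^ card A"
    by (simp flip: of_nat_power of_nat_mult)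
qed simp

definition multicolored :: "(int ^ 'd) set \<Rightarrow> (int ^ 'd \<Rightarrow> nat) set" where
  "multicolored A = {c \<in> rainbow_free_colorings k h r A. \<not> card (c ` A) \<le> q}"

lemma outliers_multicolored_nonempty:
  assumes "c \<in> multicolored A" "L \<in> palettes r q"
  shows "outliers c (\<lambda>_. L) A \<noteq> {}"
proof
  assume "outliers c (\<lambda>_. L) A = {}"
  then have "c ` A \<subseteq> L" by (auto simp: outliers_def)
  then have "card (c ` A) \<le> q"
    using card_mono[OF finite_palette[OF assms(2)]] assms(2) by (auto simp: palettes_def)
  then show False using assms(1) by (simp add: multicolored_def)
qed

lemma card_near_multicolored_le:
  fixes A G :: "(int ^ 'd::finite) set"
  assumes "finite G" and rich: "star_rich k h s G" and dense: "dense_in (s / 4) G A"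
    and t: "t \<le> s / 4 * real (card G)"
  shows "real (card (near_colorings t A \<inter> multicolored A))
    \<le> 2 ^ r * ((\<Sum>E | E \<subseteq> A \<and> real (card E) \<le> t. real r ^ card E) *
        (real q ^ card A * (1 - 1 / real q ^ q) powr (s / 2 * real (card G))))"
proof (rule card_le_by_outliers)
  have A: "A \<subseteq> G" using dense by (simp add: dense_in_def)
  then show "finite A" using assms(1) by (rule finite_subset)
  fix L E assume L: "L \<in> palettes r q" and E: "E \<subseteq> A" "real (card E) \<le> t"
  let ?C = "{c \<in> near_colorings t A \<inter> multicolored A. outliers c (\<lambda>_. L) A = E}"
  let ?Q = "real q ^ card A * (1 - 1 / real q ^ q) powr (s / 2 * real (card G))"
  show "real (card ?C) \<le> real r ^ card E * ?Q"
  proof (cases "E = {}")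
    case True
    then have "?C = {}" using outliers_multicolored_nonempty[OF _ L] by blast
    then show ?thesis by (simp only: card.empty) simp
  next
    case False
    then obtain y where y: "y \<in> E" by blast
    then obtain T :: "(int ^ 'd) set" and X where T: "finite T" "s * real (card G) \<le> real (card T)"
      and star: "solution_star k h G y T X"
      using rich E(1) A unfolding star_rich_def by blast
    have "real (card (G - A)) = real (card G) - real (card A)"
      using A assms(1) by (simp add: card_Diff_subset finite_subset card_mono of_nat_diff)
    moreover have "real (card G) - s / 4 * real (card G) \<le> real (card A)"
      using dense by (simp add: dense_in_def algebra_simps)
    moreover have "s * real (card G) = 4 * (s / 4 * real (card G))"
        "s / 2 * real (card G) = 2 * (s / 4 * real (card G))"
      by simp_all
    ultimately have "real (card (G - A)) + real (card E) + s / 2 * real (card G) \<le> real (card T)"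
      using E(2) t T(2) by linarith
    then have "real (card {c \<in> rainbow_free_colorings k h r A. outliers c (\<lambda>_. L) A = E}) \<le> real r ^ card E * ?Q"
      using card_colorings_with_outlier_le[OF assms(1) A L E(1) y T(1) star] by blast
    moreover have "card ?C \<le> card {c \<in> rainbow_free_colorings k h r A. outliers c (\<lambda>_. L) A = E}"
      using finite_rainbow_free_colorings[OF \<open>finite A\<close>, of k h r]
      by (intro card_mono) (auto simp: multicolored_def)
    ultimately show ?thesis by linarith
  qed
qed auto

lemma near_multicolored_rare:
  fixes s :: real
  assumes "0 < s"
  shows "\<exists>\<beta>>0. \<exists>\<kappa>>0. \<kappa> < 1 \<and> (\<forall>\<^sub>F G :: (int ^ 'd::finite) set in large_sets (star_rich k h s).
    \<forall>A. dense_in (s / 4) G A \<longrightarrow>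
      real (card (near_colorings (\<beta> * real (card G)) A \<inter> multicolored A))
        \<le> 2 ^ r * (real q ^ card A * \<kappa> ^ card G))"
proof -
  define \<rho> where "\<rho> = 1 - 1 / real q ^ q"
  have "1 < real q ^ q" using q_ge_3 by (intro one_less_power) auto
  then have \<rho>: "0 < \<rho>" "\<rho> < 1" using q_ge_3 by (simp_all add: \<rho>_def)
  define \<kappa>\<^sub>0 where "\<kappa>\<^sub>0 = \<rho> powr (s / 2)"
  have \<kappa>\<^sub>0: "0 < \<kappa>\<^sub>0" "\<kappa>\<^sub>0 < 1" using \<rho> assms by (simp_all add: \<kappa>\<^sub>0_def powr01_less_one)
  obtain b where b: "1 < b" "b * \<kappa>\<^sub>0 < 1"
    using exists_base_gt_1[OF \<kappa>\<^sub>0, of 1] by auto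
  have "1 \<le> real r" using q_ge_3 q_less_r by simp
  obtain \<alpha> where \<alpha>: "0 < \<alpha>" and few_sets: "\<And>S :: (int ^ 'd) set. \<And>M m. finite S \<Longrightarrow> real (card S) \<le> M \<Longrightarrow>
    m \<le> \<alpha> * M \<Longrightarrow> (\<Sum>E | E \<subseteq> S \<and> real (card E) \<le> m. real r ^ card E) \<le> b powr M"
    using sum_power_card_small_subsets_subexponential[OF b(1) \<open>1 \<le> real r\<close>] by blast
  define \<beta> where "\<beta> = min \<alpha> (s / 4)"
  have \<beta>: "0 < \<beta>" "\<beta> \<le> \<alpha>" "\<beta> \<le> s / 4" using \<alpha> assms by (simp_all add: \<beta>_def)
  define \<kappa> where "\<kappa> = b * \<kappa>\<^sub>0"
  have "\<forall>\<^sub>F G :: (int ^ 'd) set in large_sets (star_rich k h s). \<forall>A. dense_in (s / 4) G A \<longrightarrow>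
      real (card (near_colorings (\<beta> * real (card G)) A \<inter> multicolored A))
        \<le> 2 ^ r * (real q ^ card A * \<kappa> ^ card G)"
    using eventually_large_sets[of "star_rich k h s" 1]
  proof (eventually_elim, intro allI impI, elim conjE)
    fix G A :: "(int ^ 'd) set"
    assume G: "star_rich k h s G" "finite G" and dense: "dense_in (s / 4) G A"
    define N where "N = real (card G)"
    have A: "A \<subseteq> G" "finite A" using dense G(2) finite_subset by (auto simp: dense_in_def)
    have "\<beta> * N \<le> s / 4 * N" "\<beta> * N \<le> \<alpha> * N" using \<beta> unfolding N_def by (intro mult_right_mono; simp)+
    moreover have "real (card A) \<le> N" using A G(2) by (simp add: N_def card_mono)
    ultimately have "(\<Sum>E | E \<subseteq> A \<and> real (card E) \<le> \<beta> * N. real r ^ card E) \<le> b powr N"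
      using few_sets A(2) by blast
    moreover have "\<rho> powr (s / 2 * N) = \<kappa>\<^sub>0 powr N" unfolding \<kappa>\<^sub>0_def powr_powr ..
    ultimately have "(\<Sum>E | E \<subseteq> A \<and> real (card E) \<le> \<beta> * N. real r ^ card E) * (real q ^ card A * \<rho> powr (s / 2 * N))
        \<le> b powr N * (real q ^ card A * \<kappa>\<^sub>0 powr N)"
      by (simp add: mult_right_mono)
    also have "\<dots> = real q ^ card A * \<kappa> ^ card G"
      using b(1) \<kappa>\<^sub>0(1) by (simp add: \<kappa>_def N_def powr_realpow power_mult_distrib)
    finally show "real (card (near_colorings (\<beta> * real (card G)) A \<inter> multicolored A))
        \<le> 2 ^ r * (real q ^ card A * \<kappa> ^ card G)"
      using card_near_multicolored_le[OF G(2,1) dense, of "\<beta> * N"] \<open>\<beta> * N \<le> s / 4 * N\<close>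
      unfolding N_def \<rho>_def by (meson mult_left_mono order_trans zero_le_numeral zero_le_power)
  qed
  then show ?thesis using \<beta>(1) b \<kappa>\<^sub>0(1) by (intro exI[of _ \<beta>] conjI exI[of _ \<kappa>]) (auto simp: \<kappa>_def)
qed

lemma card_multicolored_le:
  assumes "finite A"
  shows "card (multicolored A) \<le> card (near_colorings t A \<inter> multicolored A) + card (far_colorings t A)"
proof -
  have "finite (near_colorings t A)" "finite (far_colorings t A)"
    using finite_rainbow_free_colorings[OF assms, of k h r] unfolding far_Un_near[of t A, symmetric] by auto
  moreover have "multicolored A \<subseteq> (near_colorings t A \<inter> multicolored A) \<union> far_colorings t A"
    using far_Un_near[of t A] by (auto simp: multicolored_def)
  ultimately show ?thesis by (intro order_trans[OF card_mono card_Un_le]) auto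
qed

lemma multicolored_rare:
  fixes s K :: real
  assumes "0 < s" "1 \<le> K"
  shows "\<exists>\<delta>>0. \<exists>\<kappa>>0. \<kappa> < 1 \<and>
    (\<forall>\<^sub>F G :: (int ^ 'd::finite) set in large_sets (\<lambda>G. small_sumset h K G \<and> star_rich k h s G).
      \<forall>A. dense_in \<delta> G A \<longrightarrow> real (card (multicolored A)) \<le> (2 ^ r + 1) * (real q ^ card A * \<kappa> ^ card G))"
proof -
  define good where "good G \<longleftrightarrow> small_sumset h K G \<and> star_rich k h s G" for G :: "(int ^ 'd) set"
  obtain \<beta> \<kappa>\<^sub>1 where \<beta>: "0 < \<beta>" and \<kappa>\<^sub>1: "0 < \<kappa>\<^sub>1" "\<kappa>\<^sub>1 < 1" and near:
    "\<forall>\<^sub>F G :: (int ^ 'd) set in large_sets (star_rich k h s). \<forall>A. dense_in (s / 4) G A \<longrightarrow>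
      real (card (near_colorings (\<beta> * real (card G)) A \<inter> multicolored A))
        \<le> 2 ^ r * (real q ^ card A * \<kappa>\<^sub>1 ^ card G)"
    using near_multicolored_rare[OF assms(1)] by blast
  obtain \<kappa>\<^sub>2 where \<kappa>\<^sub>2: "0 < \<kappa>\<^sub>2" "\<kappa>\<^sub>2 < 1" and far:
    "\<forall>\<^sub>F G :: (int ^ 'd) set in large_sets (small_sumset h K). \<forall>A\<subseteq>G.
      real (card (far_colorings (\<beta> * real (card G)) A)) \<le> real q ^ card A * \<kappa>\<^sub>2 ^ card G"
    using far_colorings_rare[OF \<beta> assms(2)] by blast
  define \<kappa> where "\<kappa> = max \<kappa>\<^sub>1 \<kappa>\<^sub>2"
  have "large_sets good \<le> large_sets (star_rich k h s)" "large_sets good \<le> large_sets (small_sumset h K)"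
    by (auto simp: good_def intro!: large_sets_mono)
  note eventually_good = filter_leD[OF this(1) near] filter_leD[OF this(2) far]
  have "\<forall>\<^sub>F G in large_sets good. \<forall>A. dense_in (s / 4) G A \<longrightarrow>
      real (card (multicolored A)) \<le> (2 ^ r + 1) * (real q ^ card A * \<kappa> ^ card G)"
    using eventually_good eventually_large_sets[of good 1]
  proof (eventually_elim, intro allI impI)
    fix G A :: "(int ^ 'd) set"
    assume near_G: "\<forall>A. dense_in (s / 4) G A \<longrightarrow> real (card (near_colorings (\<beta> * real (card G)) A \<inter> multicolored A))
        \<le> 2 ^ r * (real q ^ card A * \<kappa>\<^sub>1 ^ card G)"
      and far_G: "\<forall>A\<subseteq>G. real (card (far_colorings (\<beta> * real (card G)) A)) \<le> real q ^ card A * \<kappa>\<^sub>2 ^ card G"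
      and "good G \<and> finite G \<and> 1 \<le> real (card G)" and dense: "dense_in (s / 4) G A"
    define t where "t = \<beta> * real (card G)"
    define Q where "Q = real q ^ card A"
    have A: "A \<subseteq> G" "finite A"
      using \<open>good G \<and> finite G \<and> _\<close> dense finite_subset by (auto simp: dense_in_def)
    have "card (multicolored A) \<le> card (near_colorings t A \<inter> multicolored A) + card (far_colorings t A)"
      using A(2) by (rule card_multicolored_le)
    also have "real \<dots> \<le> 2 ^ r * (Q * \<kappa>\<^sub>1 ^ card G) + Q * \<kappa>\<^sub>2 ^ card G"
      unfolding of_nat_add t_def Q_def using near_G far_G dense A(1) by (intro add_mono) blast+
    also have "\<dots> \<le> 2 ^ r * (Q * \<kappa> ^ card G) + Q * \<kappa> ^ card G"
      using \<kappa>\<^sub>1 \<kappa>\<^sub>2 by (intro add_mono mult_left_mono power_mono) (auto simp: \<kappa>_def Q_def)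
    finally show "real (card (multicolored A)) \<le> (2 ^ r + 1) * (real q ^ card A * \<kappa> ^ card G)"
      by (simp add: Q_def algebra_simps)
  qed
  then show ?thesis using assms(1) \<kappa>\<^sub>1 \<kappa>\<^sub>2 unfolding good_def
    by (intro exI[of _ "s / 4"] conjI exI[of _ \<kappa>]) (auto simp: \<kappa>_def)
qed

lemma num_rainbow_free_subexponential:
  fixes b K :: real
  assumes "1 < b" "1 \<le> K"
  shows "\<forall>\<^sub>F G :: (int ^ 'd::finite) set in large_sets (small_sumset h K). \<forall>A\<subseteq>G.
    real (num_rainbow_free k h r A) \<le> (2 ^ r + 1) * (b ^ card G * real q ^ card A)"
proof -
  have "1 \<le> real r" using q_ge_3 q_less_r by simp
  obtain \<alpha> where \<alpha>: "0 < \<alpha>" and few_sets: "\<And>S :: (int ^ 'd) set. \<And>M m. finite S \<Longrightarrow> real (card S) \<le> M \<Longrightarrow>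
    m \<le> \<alpha> * M \<Longrightarrow> (\<Sum>E | E \<subseteq> S \<and> real (card E) \<le> m. real r ^ card E) \<le> b powr M"
    using sum_power_card_small_subsets_subexponential[OF assms(1) \<open>1 \<le> real r\<close>] by blast
  obtain \<kappa> where \<kappa>: "0 < \<kappa>" "\<kappa> < 1" and far:
    "\<forall>\<^sub>F G :: (int ^ 'd) set in large_sets (small_sumset h K). \<forall>A\<subseteq>G.
      real (card (far_colorings (\<alpha> * real (card G)) A)) \<le> real q ^ card A * \<kappa> ^ card G"
    using far_colorings_rare[OF \<alpha> assms(2)] by blast
  show ?thesis
    using far eventually_large_sets[of "small_sumset h K" 1]
  proof (eventually_elim, intro allI impI)
    fix G A :: "(int ^ 'd) set"
    assume far_G: "\<forall>A\<subseteq>G. real (card (far_colorings (\<alpha> * real (card G)) A)) \<le> real q ^ card A * \<kappa> ^ card G"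
      and "small_sumset h K G \<and> finite G \<and> 1 \<le> real (card G)" and "A \<subseteq> G"
    define t where "t = \<alpha> * real (card G)"
    define Q where "Q = b ^ card G * real q ^ card A"
    have A: "finite A" "real (card A) \<le> real (card G)"
      using \<open>small_sumset h K G \<and> _\<close> \<open>A \<subseteq> G\<close> finite_subset by (auto intro: card_mono)
    have "\<kappa> ^ card G \<le> 1" "1 \<le> b ^ card G" using \<kappa> assms(1) by (simp_all add: power_le_one)
    then have "real q ^ card A * \<kappa> ^ card G \<le> Q"
      unfolding Q_def by (subst mult.commute) (intro mult_right_mono, auto)
    then have far_le: "real (card (far_colorings t A)) \<le> Q"
      using far_G \<open>A \<subseteq> G\<close> unfolding t_def by (meson order_trans)
    have "(\<Sum>E | E \<subseteq> A \<and> real (card E) \<le> t. real r ^ card E) * real q ^ card A \<le> Q"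
      using few_sets[OF A, of t] assms(1) by (simp add: t_def Q_def powr_realpow mult_right_mono)
    then have near_le: "real (card (near_colorings t A)) \<le> 2 ^ r * Q"
      using card_near_colorings_le[OF A(1), of t] by (meson mult_left_mono order_trans zero_le_numeral zero_le_power)
    have "num_rainbow_free k h r A \<le> card (far_colorings t A) + card (near_colorings t A)"
      unfolding num_rainbow_free_def far_Un_near[of t A, symmetric] by (rule card_Un_le)
    then show "real (num_rainbow_free k h r A) \<le> (2 ^ r + 1) * (b ^ card G * real q ^ card A)"
      using far_le near_le by (simp add: Q_def algebra_simps)
  qed
qed

end

section \<open>Grids\<close>

lemma grid_eq_image: "(grid n :: (int ^ 'd) set) = vec_lambda ` (UNIV \<rightarrow>\<^sub>E {1..int n})"
proof
  show "(grid n :: (int ^ 'd) set) \<subseteq> vec_lambda ` (UNIV \<rightarrow>\<^sub>E {1..int n})"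
  proof
    fix x :: "int ^ 'd" assume "x \<in> grid n"
    then have "x = vec_lambda (vec_nth x)" "vec_nth x \<in> UNIV \<rightarrow>\<^sub>E {1..int n}"
      by (simp_all add: grid_def PiE_iff)
    then show "x \<in> vec_lambda ` (UNIV \<rightarrow>\<^sub>E {1..int n})" by blast
  qed
qed (auto simp: grid_def PiE_iff)

lemma finite_grid [simp]: "finite (grid n :: (int ^ 'd) set)"
  unfolding grid_eq_image by (intro finite_imageI finite_PiE) auto

lemma card_grid: "card (grid n :: (int ^ 'd) set) = n ^ CARD('d)"
proof -
  have "inj_on vec_lambda (UNIV \<rightarrow>\<^sub>E {1..int n} :: ('d \<Rightarrow> int) set)"
    by (simp add: inj_on_def vec_lambda_inject)
  then show ?thesis unfolding grid_eq_image by (simp add: card_image card_funcsetE)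
qed

lemma sumset_grid_subset:
  assumes "1 \<le> h"
  shows "sumset {1..h} (grid n :: (int ^ 'd) set) \<subseteq> grid (h * n)"
proof
  fix z :: "int ^ 'd" assume "z \<in> sumset {1..h} (grid n)"
  then obtain u :: "nat \<Rightarrow> int ^ 'd" where u: "u \<in> {1..h} \<rightarrow>\<^sub>E grid n" "z = sum u {1..h}"
    by (auto simp: sumset_def)
  have "1 \<le> z $ j \<and> z $ j \<le> int (h * n)" for j
  proof
    have coordinates: "1 \<le> u i $ j" "u i $ j \<le> int n" if "i \<in> {1..h}" for i
      using PiE_mem[OF u(1) that] by (auto simp: grid_def)
    show "1 \<le> z $ j"
      using sum_bounded_below[of "{1..h}" 1 "\<lambda>i. u i $ j"] coordinates(1) assms
      by (simp add: u(2) sum_component)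
    show "z $ j \<le> int (h * n)"
      using sum_bounded_above[of "{1..h}" "\<lambda>i. u i $ j" "int n"] coordinates(2)
      by (simp add: u(2) sum_component)
  qed
  then show "z \<in> grid (h * n)" by (simp add: grid_def)
qed

lemma small_sumset_grid:
  assumes "1 \<le> h"
  shows "small_sumset h (real (h ^ CARD('d))) (grid n :: (int ^ 'd) set)"
proof -
  have "card (sumset {1..h} (grid n :: (int ^ 'd) set)) \<le> card (grid (h * n) :: (int ^ 'd) set)"
    using sumset_grid_subset[OF assms] by (intro card_mono) auto
  then show ?thesis
    by (simp add: small_sumset_def card_grid power_mult_distrib flip: of_nat_power of_nat_mult)
qed

lemma filterlim_grid:
  assumes "\<forall>\<^sub>F n in sequentially. P (grid n :: (int ^ 'd) set)"
  shows "filterlim (grid :: nat \<Rightarrow> (int ^ 'd) set) (large_sets P) sequentially"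
proof -
  have "filterlim (\<lambda>n. n ^ CARD('d)) sequentially sequentially"
    by (rule filterlim_at_top_mono[OF filterlim_ident]) (simp add: self_le_power eventually_sequentiallyI[of 1])
  then have "filterlim (grid :: nat \<Rightarrow> (int ^ 'd) set) (filtercomap card sequentially) sequentially"
    by (simp add: filterlim_filtercomap_iff comp_def card_grid)
  moreover have "filterlim grid (principal (Collect P)) sequentially"
    using assms by (simp add: filterlim_principal)
  ultimately show ?thesis unfolding large_sets_def by (simp add: filterlim_inf)
qed

text \<open>A \<open>k \<times> h\<close> array of distinct integers with constant row sums and entry \<open>0\<close> at \<open>(1, 1)\<close>: the
  second column balances the consecutive integers in the other columns.\<close>

definition balanced_array :: "nat \<Rightarrow> nat \<Rightarrow> nat \<times> nat \<Rightarrow> int" where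
  "balanced_array k h = (\<lambda>(l, i). if i = 2 then int h * int k + (int h - 1) * (int k - int l)
     else (int i - 1) * int k + (int l - 1))"

lemma balanced_array_first [simp]: "balanced_array k h (1, 1) = 0"
  by (simp add: balanced_array_def)

lemma balanced_array_less_iff:
  assumes "(l, i) \<in> slots k h"
  shows "balanced_array k h (l, i) < int h * int k \<longleftrightarrow> i \<noteq> 2"
proof (cases "i = 2")
  case False
  have "(int i - 1) * int k + (int l - 1) < (int i - 1) * int k + int k" using assms by auto
  also have "\<dots> = int i * int k" by (simp add: algebra_simps)
  also have "\<dots> \<le> int h * int k" using assms by (intro mult_right_mono) auto
  finally show ?thesis using False by (simp add: balanced_array_def)
next
  case True
  have "0 \<le> (int h - 1) * (int k - int l)" using assms by (intro mult_nonneg_nonneg) auto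
  then show ?thesis using True by (simp add: balanced_array_def)
qed

lemma balanced_array_bounds:
  assumes "(l, i) \<in> slots k h"
  shows "0 \<le> balanced_array k h (l, i)" "balanced_array k h (l, i) < 2 * (int h * int k)"
proof -
  show "0 \<le> balanced_array k h (l, i)" using assms by (auto simp: balanced_array_def)
  have positive: "0 < int h * int k" using assms by simp
  show "balanced_array k h (l, i) < 2 * (int h * int k)"
  proof (cases "i = 2")
    case True
    have "(int h - 1) * (int k - int l) \<le> (int h - 1) * (int k - 1)" using assms by (intro mult_left_mono) auto
    also have "\<dots> < int h * int k" using assms by (simp add: algebra_simps)
    finally show ?thesis using True by (simp add: balanced_array_def)
  next
    case False
    then show ?thesis using balanced_array_less_iff[OF assms] positive by linarith
  qed
qed

lemma inj_on_balanced_array: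
  assumes "2 \<le> h"
  shows "inj_on (balanced_array k h) (slots k h)"
proof (rule inj_onI)
  fix p p' assume p: "p \<in> slots k h" "p' \<in> slots k h" and entries: "balanced_array k h p = balanced_array k h p'"
  obtain l i l' i' where pairs: "p = (l, i)" "p' = (l', i')" by (metis surj_pair)
  then have li: "(l, i) \<in> slots k h" "(l', i') \<in> slots k h"
    and eq: "balanced_array k h (l, i) = balanced_array k h (l', i')" using p entries by simp_all
  have second_iff: "i = 2 \<longleftrightarrow> i' = 2"
    using balanced_array_less_iff[OF li(1)] balanced_array_less_iff[OF li(2)] eq by simp
  show "p = p'"
  proof (cases "i = 2")
    case True
    then have "(int h - 1) * (int k - int l) = (int h - 1) * (int k - int l')"
      using eq second_iff by (simp add: balanced_array_def)
    then show ?thesis using True second_iff assms by (simp add: pairs)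
  next
    case False
    have quotient: "((int i - 1) * int k + (int l - 1)) div int k = int i - 1" if "(l, i) \<in> slots k h" for l i
      using that by simp
    have affine_eq: "(int i - 1) * int k + (int l - 1) = (int i' - 1) * int k + (int l' - 1)"
      using eq False second_iff by (simp add: balanced_array_def)
    then have "int i - 1 = int i' - 1" using quotient[OF li(1)] quotient[OF li(2)] by metis
    then have "i = i'" by simp
    then show ?thesis using affine_eq by (simp add: pairs)
  qed
qed

lemma sum_balanced_array_row:
  assumes "2 \<le> h"
  shows "(\<Sum>i=1..h. balanced_array k h (l, i)) = (\<Sum>i=1..h. balanced_array k h (m, i))"
proof -
  have "(\<Sum>i=1..h. balanced_array k h (l, i))
      = (int h * int k + (int h - 1) * (int k - 1)) + (\<Sum>i\<in>{1..h} - {2}. (int i - 1) * int k)" for l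
  proof -
    have "(\<Sum>i=1..h. balanced_array k h (l, i))
        = balanced_array k h (l, 2) + (\<Sum>i\<in>{1..h} - {2}. balanced_array k h (l, i))"
      using assms by (intro sum.remove) auto
    also have "(\<Sum>i\<in>{1..h} - {2}. balanced_array k h (l, i)) = (\<Sum>i\<in>{1..h} - {2}. (int i - 1) * int k + (int l - 1))"
      by (intro sum.cong) (auto simp: balanced_array_def)
    also have "\<dots> = (\<Sum>i\<in>{1..h} - {2}. (int i - 1) * int k) + (int h - 1) * (int l - 1)"
      using assms by (simp add: sum.distrib of_nat_diff)
    finally show ?thesis by (simp add: balanced_array_def algebra_simps)
  qed
  then show ?thesis by simp
qed

text \<open>The weights \<open>0, 2, 1, \<dots>, 1\<close> of the first row and \<open>1, \<dots>, 1\<close> of the others have equal sums; the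
  residue modulo \<open>2 h k\<close> identifies the slot.\<close>

definition slot_weight :: "nat \<times> nat \<Rightarrow> int" where
  "slot_weight p = (if p = (1, 1) then 0 else if p = (1, 2) then 2 else 1)"

lemma sum_slot_weight_row:
  assumes "2 \<le> h"
  shows "(\<Sum>i=1..h. slot_weight (l, i)) = int h"
proof (cases "l = 1")
  case True
  have "{1..h} = insert 1 (insert 2 {3..h})" using assms by auto
  moreover have "(\<Sum>i=3..h. slot_weight (1, i)) = (\<Sum>i=3..h. 1)"
    by (intro sum.cong) (auto simp: slot_weight_def)
  ultimately show ?thesis using True assms by (simp add: slot_weight_def)
next
  case False
  then show ?thesis by (simp add: slot_weight_def)
qed

definition offset :: "nat \<Rightarrow> nat \<Rightarrow> int \<Rightarrow> nat \<times> nat \<Rightarrow> int" where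
  "offset k h t p = slot_weight p * (2 * (int h * int k) * t) + balanced_array k h p"

lemma offset_first [simp]: "offset k h t (1, 1) = 0"
  using balanced_array_first by (simp add: offset_def slot_weight_def)

lemma offset_bounds:
  assumes "p \<in> slots k h" "0 \<le> t"
  shows "0 \<le> offset k h t p" "offset k h t p < 4 * (int h * int k) * t + 2 * (int h * int k)"
proof -
  obtain l i where p: "p = (l, i)" by force
  have "0 \<le> slot_weight p" "slot_weight p \<le> 2" by (simp_all add: slot_weight_def)
  then have "0 \<le> slot_weight p * (2 * (int h * int k) * t)"
    "slot_weight p * (2 * (int h * int k) * t) \<le> 2 * (2 * (int h * int k) * t)"
    using assms(2) by (simp, intro mult_right_mono) auto
  moreover have "0 \<le> balanced_array k h p" "balanced_array k h p < 2 * (int h * int k)"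
    using balanced_array_bounds[of l i k h] assms(1) by (simp_all only: p)
  ultimately show "0 \<le> offset k h t p" "offset k h t p < 4 * (int h * int k) * t + 2 * (int h * int k)"
    unfolding offset_def by linarith+
qed

lemma sum_offset_row:
  assumes "2 \<le> h"
  shows "(\<Sum>i=1..h. offset k h t (l, i)) = (\<Sum>i=1..h. offset k h t (m, i))"
proof -
  have "(\<Sum>i=1..h. offset k h t (l, i))
      = int h * (2 * (int h * int k) * t) + (\<Sum>i=1..h. balanced_array k h (l, i))" for l
    by (simp only: offset_def sum.distrib sum_slot_weight_row[OF assms] flip: sum_distrib_right)
  then show ?thesis using sum_balanced_array_row[OF assms, of k l m] by simp
qed

lemma offset_eq_imp_slot_eq:
  assumes "2 \<le> h" "p \<in> slots k h" "p' \<in> slots k h" "offset k h t p = offset k h t' p'"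
  shows "p = p'"
proof -
  have "offset k h t p mod (2 * (int h * int k)) = balanced_array k h p" if p: "p \<in> slots k h" for t p
  proof -
    obtain l i where "p = (l, i)" by force
    then have "0 \<le> balanced_array k h p" "balanced_array k h p < 2 * (int h * int k)"
      using balanced_array_bounds p by blast+
    moreover have "offset k h t p = balanced_array k h p + 2 * (int h * int k) * (slot_weight p * t)"
      by (simp add: offset_def)
    ultimately show ?thesis by simp
  qed
  then have "balanced_array k h p = balanced_array k h p'" using assms by metis
  then show ?thesis using inj_on_balanced_array[OF assms(1), of k] assms(2,3) by (auto dest: inj_onD)
qed

lemma offset_eq_imp_eq:
  assumes "p \<in> slots k h - {(1, 1)}" "offset k h t p = offset k h t' p"
  shows "t = t'"
proof -
  have "slot_weight p \<noteq> 0" "int h * int k \<noteq> 0" using assms(1) by (auto simp: slot_weight_def)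
  then show ?thesis using assms(2) by (auto simp: offset_def)
qed

text \<open>The entries of the solutions through \<open>y\<close> are obtained by moving away from the nearest face of the grid.\<close>

definition star_point :: "nat \<Rightarrow> nat \<Rightarrow> nat \<Rightarrow> int ^ 'd \<Rightarrow> int ^ 'd \<Rightarrow> nat \<Rightarrow> nat \<Rightarrow> int ^ 'd" where
  "star_point k h n y t l i =
    (\<chi> j. y $ j + (if 2 * y $ j \<le> int n then 1 else -1) * offset k h (t $ j) (l, i))"

lemma star_point_mem_grid:
  assumes "y \<in> grid n" "t \<in> grid m" "(l, i) \<in> slots k h"
    and m: "16 * (h * k) * m \<le> n - 1" "16 * (h * k) \<le> n - 1"
  shows "star_point k h n y t l i \<in> grid n"
proof -
  have "1 \<le> star_point k h n y t l i $ j \<and> star_point k h n y t l i $ j \<le> int n" for j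
  proof -
    have y: "1 \<le> y $ j" "y $ j \<le> int n" and "1 \<le> t $ j" "t $ j \<le> int m"
      using assms(1,2) by (simp_all add: grid_def)
    then have t: "0 \<le> t $ j" "t $ j \<le> int m" by simp_all
    have "4 * (int h * int k) * (t $ j) \<le> 4 * (int h * int k) * int m"
      using t(2) by (intro mult_left_mono) auto
    moreover have "int (16 * (h * k) * m) \<le> int (n - 1)" "int (16 * (h * k)) \<le> int (n - 1)"
      using m by (simp_all only: of_nat_le_iff)
    then have "16 * (int h * int k) * int m \<le> int n - 1" "16 * (int h * int k) \<le> int n - 1"
      using y by simp_all
    ultimately have "2 * offset k h (t $ j) (l, i) \<le> int n - 1"
      using offset_bounds(2)[OF assms(3) t(1)] by linarith
    then show ?thesis
      using y offset_bounds(1)[OF assms(3) t(1)] by (simp add: star_point_def)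
  qed
  then show ?thesis by (simp add: grid_def)
qed

lemma solution_star_grid:
  fixes y :: "int ^ 'd"
  assumes "2 \<le> h" "1 \<le> k" "y \<in> grid n" "16 * (h * k) * m \<le> n - 1" "16 * (h * k) \<le> n - 1"
  shows "solution_star k h (grid n) y (grid m) (star_point k h n y)"
  unfolding solution_star_def
proof (intro conjI ballI)
  fix t :: "int ^ 'd" assume t: "t \<in> grid m"
  have "(\<Sum>i=1..h. star_point k h n y t l i) = (\<Sum>i=1..h. star_point k h n y t l' i)" for l l'
    using sum_offset_row[OF assms(1), of k _ l l']
    by (simp add: vec_eq_iff star_point_def sum.distrib flip: sum_distrib_left)
  then show "B_solution k h (grid n) (star_point k h n y t)"
    unfolding B_solution_def using star_point_mem_grid[OF assms(3) t _ assms(4,5)] by auto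
  show "star_point k h n y t 1 1 = y"
    using offset_first by (simp add: star_point_def vec_eq_iff)
next
  show "inj_on (\<lambda>(t, l, i). star_point k h n y t l i) (grid m \<times> (slots k h - {(1, 1)}))"
  proof (rule inj_onI)
    fix a b assume mem: "a \<in> grid m \<times> (slots k h - {(1, 1)})" "b \<in> grid m \<times> (slots k h - {(1, 1)})"
      and eq: "(case a of (t, l, i) \<Rightarrow> star_point k h n y t l i) = (case b of (t, l, i) \<Rightarrow> star_point k h n y t l i)"
    obtain t p t' p' where pairs: "a = (t, p)" "b = (t', p')" by (metis surj_pair)
    then have p: "p \<in> slots k h - {(1, 1)}" "p' \<in> slots k h - {(1, 1)}" using mem by blast+
    have offsets: "offset k h (t $ j) p = offset k h (t' $ j) p'" for j
      using arg_cong[OF eq, of "\<lambda>x. x $ j"]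
      by (simp add: pairs star_point_def case_prod_unfold split: if_splits)
    then have "p = p'" using offset_eq_imp_slot_eq[OF assms(1)] p by blast
    moreover have "t = t'"
      unfolding vec_eq_iff using offset_eq_imp_eq[OF p(1)] offsets \<open>p = p'\<close> by blast
    ultimately show "a = b" by (simp add: pairs)
  qed
qed

lemma star_rich_grid:
  assumes "2 \<le> h" "1 \<le> k"
  shows "\<exists>s>0. \<forall>\<^sub>F n in sequentially. star_rich k h s (grid n :: (int ^ 'd) set)"
proof -
  define M where "M = 16 * (h * k)"
  have "0 < M" using assms by (simp add: M_def)
  define s where "s = (1 / (2 * real M)) ^ CARD('d)"
  have "star_rich k h s (grid n :: (int ^ 'd) set)" if n: "M + 1 \<le> n" for n
    unfolding star_rich_def
  proof
    fix y :: "int ^ 'd" assume y: "y \<in> grid n"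
    define m where "m = (n - 1) div M"
    have m: "M * m \<le> n - 1" by (simp add: m_def)
    have "n - 1 < M * m + M"
      unfolding m_def using \<open>0 < M\<close> dividend_less_times_div[of M "n - 1"] by simp
    moreover have "1 \<le> m" unfolding m_def using n \<open>0 < M\<close> by (simp add: Suc_le_eq div_greater_zero_iff)
    then have "M \<le> M * m" by simp
    ultimately have "n \<le> 2 * (M * m)" using n by linarith
    then have "real n \<le> real (2 * (M * m))" by (rule of_nat_mono)
    then have "real n / (2 * real M) \<le> real m" using \<open>0 < M\<close> by (simp add: divide_le_eq mult_ac)
    then have "s * real (card (grid n :: (int ^ 'd) set)) \<le> real (card (grid m :: (int ^ 'd) set))"
      using power_mono[of "real n / (2 * real M)" "real m" "CARD('d)"]
      by (simp add: s_def card_grid power_divide power_mult_distrib)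
    moreover have "solution_star k h (grid n) y (grid m) (star_point k h n y)"
      using assms y m n by (intro solution_star_grid) (auto simp: M_def)
    ultimately show "\<exists>(T :: (int ^ 'd) set) X. finite T \<and>
        s * real (card (grid n :: (int ^ 'd) set)) \<le> real (card T) \<and>
        solution_star k h (grid n) y T X"
      by (intro exI[of _ "grid m"] exI[of _ "star_point k h n y"] conjI finite_grid)
  qed
  then have "\<forall>\<^sub>F n in sequentially. star_rich k h s (grid n :: (int ^ 'd) set)"
    by (intro eventually_sequentiallyI[of "M + 1"])
  moreover have "0 < s" using \<open>0 < M\<close> by (simp add: s_def)
  ultimately show ?thesis by blast
qed

section \<open>Counting colorings with few colors\<close>

lemma few_colors_rainbow_free:
  assumes "c \<in> A \<rightarrow>\<^sub>E {1..r}" "card (c ` A) < k * h" "finite A"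
  shows "c \<in> rainbow_free_colorings k h r A"
proof -
  have False if "B_solution k h A x" "rainbow k h c x" for x
  proof -
    have "(\<lambda>(l, i). c (x l i)) ` slots k h \<subseteq> c ` A"
      using that(1) by (auto simp: B_solution_def)
    then have "card (slots k h) \<le> card (c ` A)"
      using that(2) assms(3) unfolding rainbow_def by (intro card_inj_on_le) auto
    then show False using assms(2) by (simp add: card_cartesian_product)
  qed
  then show ?thesis using assms(1) by (auto simp: rainbow_free_colorings_def)
qed

lemma card_few_colors_le:
  assumes "finite A" "q \<le> r"
  shows "card {c \<in> A \<rightarrow>\<^sub>E {1..r}. card (c ` A) \<le> q} \<le> (r choose q) * q ^ card A"
proof -
  have "{c \<in> A \<rightarrow>\<^sub>E {1..r}. card (c ` A) \<le> q} \<subseteq> (\<Union>L\<in>palettes r q. A \<rightarrow>\<^sub>E L)"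
  proof
    fix c assume c: "c \<in> {c \<in> A \<rightarrow>\<^sub>E {1..r}. card (c ` A) \<le> q}"
    then have "c ` A \<subseteq> {1..r}" by auto
    then obtain L where "c ` A \<subseteq> L" "L \<in> palettes r q"
      using exists_subset_between[of "c ` A" q "{1..r}"] c assms(2) by (auto simp: palettes_def)
    then show "c \<in> (\<Union>L\<in>palettes r q. A \<rightarrow>\<^sub>E L)" using c by (auto simp: PiE_iff)
  qed
  moreover have "finite (\<Union>L\<in>palettes r q. A \<rightarrow>\<^sub>E L)"
    using assms(1) by (intro finite_UN_I finite_palettes finite_PiE finite_palette)
  ultimately have "card {c \<in> A \<rightarrow>\<^sub>E {1..r}. card (c ` A) \<le> q} \<le> card (\<Union>L\<in>palettes r q. A \<rightarrow>\<^sub>E L)"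
    by (rule card_mono[rotated])
  also have "\<dots> \<le> (\<Sum>L\<in>palettes r q. card (A \<rightarrow>\<^sub>E L))" using finite_palettes by (rule card_UN_le)
  also have "\<dots> = (\<Sum>L\<in>palettes r q. q ^ card A)"
    using assms(1) by (intro sum.cong) (auto simp: card_funcsetE palettes_def)
  finally show ?thesis by (simp add: card_palettes)
qed

lemma card_surjective_colorings_ge:
  assumes "finite A" "finite L" "L \<noteq> {}"
  shows "real (card L) ^ card A - real (card L) * (real (card L) - 1) ^ card A
    \<le> real (card {c \<in> A \<rightarrow>\<^sub>E L. c ` A = L})"
proof -
  have "finite (A \<rightarrow>\<^sub>E L)" using assms by (intro finite_PiE) auto
  have "A \<rightarrow>\<^sub>E L \<subseteq> {c \<in> A \<rightarrow>\<^sub>E L. c ` A = L} \<union> (\<Union>j\<in>L. A \<rightarrow>\<^sub>E (L - {j}))"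
    by (auto simp: PiE_iff)
  then have "card (A \<rightarrow>\<^sub>E L) \<le> card ({c \<in> A \<rightarrow>\<^sub>E L. c ` A = L} \<union> (\<Union>j\<in>L. A \<rightarrow>\<^sub>E (L - {j})))"
    using \<open>finite (A \<rightarrow>\<^sub>E L)\<close> assms by (intro card_mono) (auto intro: finite_PiE)
  also have "\<dots> \<le> card {c \<in> A \<rightarrow>\<^sub>E L. c ` A = L} + card (\<Union>j\<in>L. A \<rightarrow>\<^sub>E (L - {j}))" by (rule card_Un_le)
  also have "card (\<Union>j\<in>L. A \<rightarrow>\<^sub>E (L - {j})) \<le> (\<Sum>j\<in>L. card (A \<rightarrow>\<^sub>E (L - {j})))"
    using assms(2) by (rule card_UN_le)
  also have "\<dots> = card L * (card L - 1) ^ card A" using assms(1,2) by (simp add: card_funcsetE)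
  also have "card (A \<rightarrow>\<^sub>E L) = card L ^ card A" using assms(1) by (rule card_funcsetE)
  finally have "real (card L ^ card A) \<le> real (card {c \<in> A \<rightarrow>\<^sub>E L. c ` A = L} + card L * (card L - 1) ^ card A)"
    by (rule of_nat_mono) simp
  moreover have "1 \<le> card L" using assms(2,3) by (simp add: Suc_le_eq card_gt_0_iff)
  ultimately show ?thesis by (simp add: of_nat_diff)
qed

lemma card_few_colors_ge:
  assumes "finite A" "1 \<le> q"
  shows "real (r choose q) * (real q ^ card A - real q * (real q - 1) ^ card A)
    \<le> real (card {c \<in> A \<rightarrow>\<^sub>E {1..r}. card (c ` A) \<le> q})"
proof -
  define surj where "surj L = {c \<in> A \<rightarrow>\<^sub>E L. c ` A = L}" for L :: "nat set"
  have finite_surj: "finite (surj L)" if "L \<in> palettes r q" for L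
    unfolding surj_def using finite_PiE[OF assms(1), of "\<lambda>_. L"] finite_palette[OF that] by simp
  have "real (r choose q) * (real q ^ card A - real q * (real q - 1) ^ card A) =
      (\<Sum>L\<in>palettes r q. real q ^ card A - real q * (real q - 1) ^ card A)" by (simp add: card_palettes)
  also have "\<dots> \<le> (\<Sum>L\<in>palettes r q. real (card (surj L)))"
  proof (rule sum_mono)
    fix L assume L: "L \<in> palettes r q"
    then have "card L = q" "L \<noteq> {}" using assms(2) by (auto simp: palettes_def)
    then show "real q ^ card A - real q * (real q - 1) ^ card A \<le> real (card (surj L))"
      using card_surjective_colorings_ge[OF assms(1) finite_palette[OF L]] by (simp add: surj_def)
  qed
  also have "\<dots> = real (card (\<Union>L\<in>palettes r q. surj L))"
    using finite_surj finite_palettes by (subst card_UN_disjoint) (auto simp: surj_def)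
  also have "\<dots> \<le> real (card {c \<in> A \<rightarrow>\<^sub>E {1..r}. card (c ` A) \<le> q})"
  proof (intro of_nat_mono card_mono)
    show "finite {c \<in> A \<rightarrow>\<^sub>E {1..r}. card (c ` A) \<le> q}"
      using finite_PiE[OF assms(1), of "\<lambda>_. {1..r}"] by simp
    show "(\<Union>L\<in>palettes r q. surj L) \<subseteq> {c \<in> A \<rightarrow>\<^sub>E {1..r}. card (c ` A) \<le> q}"
    proof (rule UN_least)
      fix L assume "L \<in> palettes r q"
      then have "L \<subseteq> {1..r}" "card L = q" by (auto simp: palettes_def)
      then show "surj L \<subseteq> {c \<in> A \<rightarrow>\<^sub>E {1..r}. card (c ` A) \<le> q}"
        using PiE_mono[of A "\<lambda>_. L" "\<lambda>_. {1..r}"] by (auto simp: surj_def)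
    qed
  qed
  finally show ?thesis .
qed

section \<open>Asymptotics\<close>

lemma dense_in_mono: "dense_in \<delta> G A \<Longrightarrow> \<delta> \<le> \<delta>' \<Longrightarrow> dense_in \<delta>' G A"
  unfolding dense_in_def by (meson diff_left_mono mult_right_mono of_nat_0_le_iff order_trans)

lemma eventually_dense_power_le:
  fixes x \<epsilon> :: real
  assumes "0 \<le> x" "x < 1" "0 < \<epsilon>"
  shows "\<forall>\<^sub>F G in large_sets P. \<forall>A. dense_in (1/2) G A \<longrightarrow> x ^ card A \<le> \<epsilon>"
proof -
  obtain m where m: "x ^ m < \<epsilon>" using real_arch_pow_inv[OF assms(3,2)] by blast
  show ?thesis
    using eventually_large_sets[of P "2 * real m"]
  proof (eventually_elim, intro allI impI)
    fix G A assume "P G \<and> finite G \<and> 2 * real m \<le> real (card G)" "dense_in (1/2) G A"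
    then have "m \<le> card A" by (simp add: dense_in_def)
    then show "x ^ card A \<le> \<epsilon>" using power_decreasing[of m "card A" x] assms m by linarith
  qed
qed

context rainbow_parameters
begin

definition palette_asymptotics :: "real \<Rightarrow> (int ^ 'd) set \<Rightarrow> bool" where
  "palette_asymptotics \<epsilon> A \<longleftrightarrow>
    (1 - \<epsilon>) * real (r choose q) * real q ^ card A \<le> real (num_rainbow_free k h r A) \<and>
    real (num_rainbow_free k h r A) \<le> (1 + \<epsilon>) * real (r choose q) * real q ^ card A \<and>
    real (card (multicolored A)) \<le> \<epsilon> * real (num_rainbow_free k h r A)"

lemma choose_q_ge_1: "1 \<le> real (r choose q)"
  using zero_less_binomial[of q r] q_less_r by linarith

lemma num_rainbow_free_eq:
  assumes "finite A"
  shows "num_rainbow_free k h r A = card (multicolored A) + card {c \<in> A \<rightarrow>\<^sub>E {1..r}. card (c ` A) \<le> q}"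
proof -
  have union: "rainbow_free_colorings k h r A = multicolored A \<union> {c \<in> A \<rightarrow>\<^sub>E {1..r}. card (c ` A) \<le> q}"
    using few_colors_rainbow_free[of _ A r k h] assms
    by (auto simp: multicolored_def rainbow_free_colorings_def kh_eq_Suc_q less_Suc_eq_le)
  have "finite (multicolored A)" "finite {c \<in> A \<rightarrow>\<^sub>E {1..r}. card (c ` A) \<le> q}"
    using finite_rainbow_free_colorings[OF assms, of k h r] finite_PiE[OF assms, of "\<lambda>_. {1..r}"]
    by (simp_all add: multicolored_def)
  moreover have "multicolored A \<inter> {c \<in> A \<rightarrow>\<^sub>E {1..r}. card (c ` A) \<le> q} = {}"
    by (auto simp: multicolored_def)
  ultimately show ?thesis unfolding num_rainbow_free_def union by (rule card_Un_disjoint)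
qed

lemma palette_asymptoticsI:
  assumes "finite A" "0 < e" "e \<le> \<epsilon>" "e \<le> 1/2"
    and multicolored_le: "real (card (multicolored A)) \<le> e / 2 * real q ^ card A"
    and nonsurjective_le: "real q * ((real q - 1) / real q) ^ card A \<le> e"
  shows "palette_asymptotics \<epsilon> A"
proof -
  define Q where "Q = real q ^ card A"
  define R where "R = real (r choose q)"
  define M where "M = real (card (multicolored A))"
  define F where "F = real (card {c \<in> A \<rightarrow>\<^sub>E {1..r}. card (c ` A) \<le> q})"
  have num: "real (num_rainbow_free k h r A) = M + F"
    using num_rainbow_free_eq[OF assms(1)] by (simp add: M_def F_def)
  have Q: "0 < Q" "Q \<le> R * Q" using q_ge_3 choose_q_ge_1 by (simp_all add: Q_def R_def)
  have M: "0 \<le> M" "M \<le> e / 2 * Q" using multicolored_le by (simp_all add: M_def Q_def)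
  have "F \<le> real ((r choose q) * q ^ card A)"
    unfolding F_def using card_few_colors_le[OF assms(1), of q r] q_less_r by (intro of_nat_mono) simp
  then have F_le: "F \<le> R * Q" by (simp add: R_def Q_def)
  have "real q * (real q - 1) ^ card A = real q * ((real q - 1) / real q) ^ card A * Q"
    using q_ge_3 by (simp add: Q_def power_divide)
  also have "\<dots> \<le> e * Q" using nonsurjective_le Q(1) by (intro mult_right_mono) auto
  finally have "R * ((1 - e) * Q) \<le> R * (Q - real q * (real q - 1) ^ card A)"
    using choose_q_ge_1 by (intro mult_left_mono) (auto simp: algebra_simps R_def)
  also have "\<dots> \<le> F" unfolding F_def Q_def R_def using q_ge_3 by (intro card_few_colors_ge[OF assms(1)]) simp
  finally have F_ge: "(1 - e) * (R * Q) \<le> F" by (simp add: mult_ac)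
  have lower: "(1 - \<epsilon>) * (R * Q) \<le> M + F"
    using mult_right_mono[of "1 - \<epsilon>" "1 - e" "R * Q"] assms(3) Q M(1) F_ge by linarith
  have "e / 2 * Q \<le> \<epsilon> * (R * Q)" using assms(2,3) Q by (intro mult_mono) auto
  then have upper: "M + F \<le> (1 + \<epsilon>) * (R * Q)" using M(2) F_le by (simp add: algebra_simps)
  have "1/2 * (R * Q) \<le> (1 - e) * (R * Q)" using assms(4) Q by (intro mult_right_mono) auto
  then have "1/2 * Q \<le> M + F" using F_ge M(1) Q(2) by linarith
  then have "e * (1/2 * Q) \<le> \<epsilon> * (M + F)" using assms(2,3) Q(1) by (intro mult_mono) auto
  then have "M \<le> \<epsilon> * (M + F)" using M(2) by simp
  then show ?thesis
    using lower upper unfolding palette_asymptotics_def num M_def R_def Q_def by (simp add: mult.assoc)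
qed

abbreviation rich_set :: "real \<Rightarrow> real \<Rightarrow> (int ^ 'd) set \<Rightarrow> bool" where
  "rich_set K s G \<equiv> small_sumset h K G \<and> star_rich k h s G"

lemma palette_asymptotics_dense:
  fixes s K :: real
  assumes "0 < s" "1 \<le> K"
  shows "\<exists>\<delta>>0. \<forall>\<epsilon>>0. \<forall>\<^sub>F G :: (int ^ 'd::finite) set in large_sets (rich_set K s).
    \<forall>A. dense_in \<delta> G A \<longrightarrow> palette_asymptotics \<epsilon> A"
proof -
  obtain \<delta>\<^sub>0 \<kappa> where \<delta>\<^sub>0: "0 < \<delta>\<^sub>0" and \<kappa>: "0 < \<kappa>" "\<kappa> < 1" and rare:
    "\<forall>\<^sub>F G :: (int ^ 'd) set in large_sets (rich_set K s). \<forall>A. dense_in \<delta>\<^sub>0 G A \<longrightarrow>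
      real (card (multicolored A)) \<le> (2 ^ r + 1) * (real q ^ card A * \<kappa> ^ card G)"
    using multicolored_rare[OF assms, where 'd = 'd] by blast
  define \<delta> where "\<delta> = min \<delta>\<^sub>0 (1/2)"
  have "\<forall>\<^sub>F G :: (int ^ 'd) set in large_sets (rich_set K s). \<forall>A. dense_in \<delta> G A \<longrightarrow> palette_asymptotics \<epsilon> A"
    if "0 < \<epsilon>" for \<epsilon>
  proof -
    define e where "e = min \<epsilon> (1/2)"
    have e: "0 < e" "e \<le> \<epsilon>" "e \<le> 1/2" using that by (simp_all add: e_def)
    define C :: real where "C = 2 ^ r + 1"
    have "0 < C" by (simp add: C_def add_pos_pos)
    then have small: "0 < e / (2 * C)" "0 < e / real q" using e(1) q_ge_3 by simp_all
    have \<theta>: "0 \<le> (real q - 1) / real q" "(real q - 1) / real q < 1" using q_ge_3 by simp_all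
    show ?thesis
      using rare eventually_large_sets_power_le[OF less_imp_le[OF \<kappa>(1)] \<kappa>(2) small(1)]
        eventually_dense_power_le[OF \<theta> small(2)] eventually_large_sets[of _ 1]
    proof (eventually_elim, intro allI impI)
      fix G A :: "(int ^ 'd) set"
      assume rare_G: "\<forall>A. dense_in \<delta>\<^sub>0 G A \<longrightarrow>
          real (card (multicolored A)) \<le> (2 ^ r + 1) * (real q ^ card A * \<kappa> ^ card G)"
        and \<kappa>_G: "\<kappa> ^ card G \<le> e / (2 * C)"
        and \<theta>_G: "\<forall>A. dense_in (1/2) G A \<longrightarrow> ((real q - 1) / real q) ^ card A \<le> e / real q"
        and G: "rich_set K s G \<and> finite G \<and> 1 \<le> real (card G)" and "dense_in \<delta> G A"
      then have dense: "dense_in \<delta>\<^sub>0 G A" "dense_in (1/2) G A"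
        by (auto simp: \<delta>_def intro: dense_in_mono)
      have "real (card (multicolored A)) \<le> real q ^ card A * (C * \<kappa> ^ card G)"
        using rare_G dense(1) by (simp add: C_def mult_ac)
      also have "\<dots> \<le> real q ^ card A * (C * (e / (2 * C)))"
        using \<kappa>_G \<open>0 < C\<close> by (intro mult_left_mono) auto
      also have "\<dots> = e / 2 * real q ^ card A" using \<open>0 < C\<close> by simp
      finally have "real (card (multicolored A)) \<le> e / 2 * real q ^ card A" .
      moreover have "real q * ((real q - 1) / real q) ^ card A \<le> e"
        using \<theta>_G dense(2) q_ge_3 by (simp add: le_divide_eq mult.commute)
      moreover have "finite A" using dense(1) G finite_subset by (auto simp: dense_in_def)
      ultimately show "palette_asymptotics \<epsilon> A" using e by (intro palette_asymptoticsI)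
    qed
  qed
  then show ?thesis using \<delta>\<^sub>0 by (intro exI[of _ \<delta>]) (auto simp: \<delta>_def)
qed

lemma power_card_sparse_le:
  assumes "\<not> dense_in (2 * \<delta>) G A" "A \<subseteq> G"
  shows "(real q powr \<delta>) ^ card G * real q ^ card A \<le> real q ^ card G * (1 / real q powr \<delta>) ^ card G"
proof -
  define b where "b = real q powr \<delta>"
  have "0 < b" "0 < real q" using q_ge_3 by (simp_all add: b_def)
  have b_power: "b ^ card G = real q powr (\<delta> * real (card G))"
    using \<open>0 < b\<close> by (simp add: b_def powr_powr flip: powr_realpow)
  have "real (card A) \<le> real (card G) - 2 * (\<delta> * real (card G))"
    using assms by (simp add: dense_in_def algebra_simps)
  then have "real q powr (\<delta> * real (card G) + real (card A)) \<le> real q powr (real (card G) - \<delta> * real (card G))"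
    using q_ge_3 by (intro powr_mono) auto
  then show ?thesis
    using \<open>0 < real q\<close> unfolding b_def[symmetric] power_one_over b_power
    by (simp add: powr_add powr_diff powr_realpow)
qed

lemma num_rainbow_free_less_dense:
  assumes "finite G" "A \<subset> G" "palette_asymptotics (1/4) A" "palette_asymptotics (1/4) G"
  shows "num_rainbow_free k h r A < num_rainbow_free k h r G"
proof -
  define R where "R = real (r choose q)"
  have "1 \<le> R" unfolding R_def by (rule choose_q_ge_1)
  have card_less: "card A < card G" using assms(1,2) by (rule psubset_card_mono)
  have "real (num_rainbow_free k h r A) \<le> 5/4 * R * real q ^ card A"
    using assms(3) by (simp add: palette_asymptotics_def R_def)
  also have "\<dots> \<le> 5/4 * R * real q ^ (card G - 1)"
    using card_less q_ge_3 \<open>1 \<le> R\<close> by (intro mult_left_mono power_increasing) auto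
  also have "\<dots> = 5/4 * R * real q ^ card G / real q"
    using card_less q_ge_3 by (cases "card G") auto
  also have "\<dots> \<le> 5/4 * R * real q ^ card G / 3"
    using q_ge_3 \<open>1 \<le> R\<close> by (intro divide_left_mono) auto
  also have "\<dots> < 3/4 * R * real q ^ card G" using q_ge_3 \<open>1 \<le> R\<close> by simp
  also have "\<dots> \<le> real (num_rainbow_free k h r G)"
    using assms(4) by (simp add: palette_asymptotics_def R_def)
  finally show ?thesis by simp
qed

lemma num_rainbow_free_less_sparse:
  fixes A G :: "(int ^ 'd::finite) set" and b C \<delta> :: real
  defines "b \<equiv> real q powr (\<delta> / 2)"
  assumes "finite G" "A \<subseteq> G" "\<not> dense_in \<delta> G A" "0 < \<delta>" "0 < C"
    and few: "real (num_rainbow_free k h r A) \<le> C * (b ^ card G * real q ^ card A)"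
    and large: "(1 / b) ^ card G \<le> 1 / (2 * C)" and asymptotics: "palette_asymptotics (1/4) G"
  shows "num_rainbow_free k h r A < num_rainbow_free k h r G"
proof -
  note few
  also have "C * (b ^ card G * real q ^ card A) \<le> C * (real q ^ card G * (1 / b) ^ card G)"
    using power_card_sparse_le[of "\<delta> / 2" G A] assms(2-6) by (simp add: b_def)
  also have "\<dots> \<le> C * (real q ^ card G * (1 / (2 * C)))"
    using large \<open>0 < C\<close> by (intro mult_left_mono) auto
  also have "\<dots> = 1/2 * real q ^ card G" using \<open>0 < C\<close> by simp
  also have "\<dots> < 3/4 * real (r choose q) * real q ^ card G"
    using q_ge_3 choose_q_ge_1 by (intro mult_strict_right_mono) auto
  also have "\<dots> \<le> real (num_rainbow_free k h r G)"
    using asymptotics by (simp add: palette_asymptotics_def)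
  finally show ?thesis by simp
qed

lemma num_rainbow_free_unique_maximum:
  fixes s K :: real
  assumes "0 < s" "1 \<le> K"
  shows "\<forall>\<^sub>F G :: (int ^ 'd::finite) set in large_sets (rich_set K s).
    \<forall>A. A \<subset> G \<longrightarrow> num_rainbow_free k h r A < num_rainbow_free k h r G"
proof -
  obtain \<delta> where \<delta>: "0 < \<delta>" and asymptotics: "\<forall>\<epsilon>>0. \<forall>\<^sub>F G :: (int ^ 'd) set in large_sets (rich_set K s).
    \<forall>A. dense_in \<delta> G A \<longrightarrow> palette_asymptotics \<epsilon> A"
    using palette_asymptotics_dense[OF assms, where 'd = 'd] by blast
  define b where "b = real q powr (\<delta> / 2)"
  have b: "1 < b" unfolding b_def using q_ge_3 \<delta> by (intro gr_one_powr) auto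
  define C :: real where "C = 2 ^ r + 1"
  have "0 < C" by (simp add: C_def add_pos_pos)
  have "large_sets (rich_set K s) \<le> large_sets (small_sumset h K :: (int ^ 'd) set \<Rightarrow> bool)"
    by (rule large_sets_mono) simp
  note subexponential = filter_leD[OF this num_rainbow_free_subexponential[OF b assms(2)]]
  have "\<forall>\<^sub>F G :: (int ^ 'd) set in large_sets (rich_set K s). (1 / b) ^ card G \<le> 1 / (2 * C)"
    using b \<open>0 < C\<close> by (intro eventually_large_sets_power_le) auto
  moreover have "\<forall>\<^sub>F G :: (int ^ 'd) set in large_sets (rich_set K s).
      \<forall>A. dense_in \<delta> G A \<longrightarrow> palette_asymptotics (1/4) A"
    using asymptotics[THEN spec[of _ "1/4"]] by simp
  ultimately show ?thesis
    using subexponential eventually_large_sets[of _ 1]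
  proof (eventually_elim, intro allI impI)
    fix G A :: "(int ^ 'd) set"
    assume b_G: "(1 / b) ^ card G \<le> 1 / (2 * C)"
      and asymptotics_G: "\<forall>A. dense_in \<delta> G A \<longrightarrow> palette_asymptotics (1/4) A"
      and num_G: "\<forall>A\<subseteq>G. real (num_rainbow_free k h r A) \<le> (2 ^ r + 1) * (b ^ card G * real q ^ card A)"
      and G: "rich_set K s G \<and> finite G \<and> 1 \<le> real (card G)" and A: "A \<subset> G"
    have "dense_in \<delta> G G" using \<delta> by (simp add: dense_in_def algebra_simps)
    then have asymptotics_whole: "palette_asymptotics (1/4) G" using asymptotics_G by blast
    show "num_rainbow_free k h r A < num_rainbow_free k h r G"
    proof (cases "dense_in \<delta> G A")
      case True
      then show ?thesis using num_rainbow_free_less_dense[OF _ A _ asymptotics_whole] asymptotics_G G by blast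
    next
      case False
      then show ?thesis
        using num_rainbow_free_less_sparse[OF _ _ _ \<delta> \<open>0 < C\<close> _ _ asymptotics_whole] num_G b_G G A
        unfolding b_def C_def by blast
    qed
  qed
qed

lemma filterlim_grid_rich:
  shows "\<exists>K s. 1 \<le> K \<and> 0 < s \<and>
    filterlim (grid :: nat \<Rightarrow> (int ^ 'd) set) (large_sets (rich_set K s)) sequentially"
proof -
  have kh: "1 \<le> k" "1 \<le> h" using k_ge_2 h_ge_2 by simp_all
  obtain s where s: "0 < s" "\<forall>\<^sub>F n in sequentially. star_rich k h s (grid n :: (int ^ 'd) set)"
    using star_rich_grid[OF h_ge_2 kh(1), where 'd = 'd] by blast
  define K where "K = real (h ^ CARD('d))"
  have "\<forall>\<^sub>F n in sequentially. rich_set K s (grid n :: (int ^ 'd) set)"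
    using s(2) small_sumset_grid[OF kh(2), where 'd = 'd] by (simp add: K_def)
  moreover have "1 \<le> K" using kh(2) by (simp add: K_def)
  ultimately show ?thesis using s(1) filterlim_grid[of "rich_set K s"] by blast
qed

end

lemma eventually_log_dense_grid:
  assumes "0 < \<delta>"
  shows "\<forall>\<^sub>F n in sequentially. \<forall>A\<subseteq>(grid n :: (int ^ 'd) set).
    real n ^ CARD('d) - real n ^ CARD('d) / log 2 (real n) \<le> real (card A) \<longrightarrow> dense_in \<delta> (grid n) A"
proof -
  have "\<forall>\<^sub>F n in sequentially. 2 powr (1 / \<delta>) \<le> real n"
    using filterlim_real_sequentially unfolding filterlim_at_top by blast
  then show ?thesis
  proof (eventually_elim, intro allI impI)
    fix n and A :: "(int ^ 'd) set"
    assume n: "2 powr (1 / \<delta>) \<le> real n" and "A \<subseteq> grid n"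
      and card_A: "real n ^ CARD('d) - real n ^ CARD('d) / log 2 (real n) \<le> real (card A)"
    have "0 < real n" using n by (rule less_le_trans[rotated]) simp
    then have log_ge: "1 / \<delta> \<le> log 2 (real n)" using n by (simp add: le_log_iff)
    moreover have "0 < 1 / \<delta>" using assms by simp
    ultimately have "0 < log 2 (real n)" by linarith
    then have "1 / log 2 (real n) \<le> \<delta>" using log_ge assms by (simp add: divide_le_eq mult.commute)
    then have "real n ^ CARD('d) * (1 / log 2 (real n)) \<le> real n ^ CARD('d) * \<delta>"
      by (rule mult_left_mono) simp
    then show "dense_in \<delta> (grid n) A"
      using \<open>A \<subseteq> grid n\<close> card_A by (simp add: dense_in_def card_grid algebra_simps)
  qed
qed

theorem theorem1p1:
  fixes k h r :: nat
  assumes "k \<ge> 2" and "h \<ge> 2" and "r \<ge> k * h"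
  shows
    "(\<forall>\<epsilon>::real>0. \<exists>n0. \<forall>n\<ge>n0. \<forall>A \<subseteq> (grid n :: (int ^ 'd::finite) set).
        real (card A) \<ge> real n ^ CARD('d) - real n ^ CARD('d) / log 2 (real n) \<longrightarrow>
          (1 - \<epsilon>) * real (r choose (k * h - 1)) * real (k * h - 1) ^ card A \<le> real (num_rainbow_free k h r A) \<and>
          real (num_rainbow_free k h r A) \<le> (1 + \<epsilon>) * real (r choose (k * h - 1)) * real (k * h - 1) ^ card A)
     \<and>
     (\<forall>\<epsilon>::real>0. \<exists>n0. \<forall>n\<ge>n0. \<forall>A \<subseteq> (grid n :: (int ^ 'd) set).
        real (card A) \<ge> real n ^ CARD('d) - real n ^ CARD('d) / log 2 (real n) \<longrightarrow>
          real (card {c \<in> rainbow_free_colorings k h r A. \<not> card (c ` A) \<le> k * h - 1})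
            \<le> \<epsilon> * real (num_rainbow_free k h r A))
     \<and>
     (\<exists>n0. \<forall>n\<ge>n0. \<forall>A. A \<subset> (grid n :: (int ^ 'd) set) \<longrightarrow> num_rainbow_free k h r A < num_rainbow_free k h r (grid n :: (int ^ 'd) set))"
proof -
  interpret rainbow_parameters k h r using assms by unfold_locales
  obtain K s where params: "0 < s" "1 \<le> K"
    and grid_large: "filterlim (grid :: nat \<Rightarrow> (int ^ 'd) set) (large_sets (rich_set K s)) sequentially"
    using filterlim_grid_rich[where 'd = 'd] by blast
  obtain \<delta> where \<delta>: "0 < \<delta>" and asymptotics: "\<forall>\<epsilon>>0. \<forall>\<^sub>F G :: (int ^ 'd) set in large_sets (rich_set K s).
    \<forall>A. dense_in \<delta> G A \<longrightarrow> palette_asymptotics \<epsilon> A"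
    using palette_asymptotics_dense[OF params, where 'd = 'd] by blast
  have "\<forall>\<^sub>F n in sequentially. \<forall>A\<subseteq>(grid n :: (int ^ 'd) set).
    real n ^ CARD('d) - real n ^ CARD('d) / log 2 (real n) \<le> real (card A) \<longrightarrow> palette_asymptotics \<epsilon> A"
    if "0 < \<epsilon>" for \<epsilon>
    using eventually_compose_filterlim[OF asymptotics[rule_format, OF that] grid_large]
      eventually_log_dense_grid[OF \<delta>, where 'd = 'd]
    by eventually_elim blast
  moreover have "\<forall>\<^sub>F n in sequentially. \<forall>A. A \<subset> (grid n :: (int ^ 'd) set) \<longrightarrow>
      num_rainbow_free k h r A < num_rainbow_free k h r (grid n :: (int ^ 'd) set)"
    by (rule eventually_compose_filterlim[OF num_rainbow_free_unique_maximum[OF params] grid_large])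
  ultimately show ?thesis
    unfolding eventually_sequentially palette_asymptotics_def multicolored_def q_def by meson
qed

end
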